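(* Let $n\ge2$, let $D$ and $D'$ be bounded domains in $\mathbb{R}^n$ with weakly flat boundaries, and let $f:D\to D'$ be a finitely bi-Lipschitz homeomorphism. Suppose that $$\int_{D}\Phi\big(K_O^{\,n-1}(x,f)\big)\,dm(x)<\infty$$ where $\Phi:[0,\infty]\to[0,\infty]$ is a convex non-decreasing function. With $\Phi_{n-1}(t)=\Phi(t^{n-1})$ and $H_{n-1}(t)=\log\Phi_{n-1}(t)$, suppose $\Phi$ satisfies at least one of the following conditions: (a) $\int_{\delta}^{\infty}H_{n-1}'(t)\,\frac{dt}{t}=\infty$ for some $\delta>0$; (b) $\int_{\delta}^{\infty}\frac{dH_{n-1}(t)}{t}=\infty$ for some $\delta>0$; (c) $\int_{\delta}^{\infty}H_{n-1}(t)\,\frac{dt}{t^2}=\infty$ for some $\delta>0$ (equivalently, $\int_{\delta}^{\infty}\log\Phi(t)\,\frac{dt}{t^{n'}}=+\infty$ for some $\delta>0$, where $\frac1n+\frac1{n'}=1$); (d) $\int_{0}^{\delta}H_{n-1}\big(\tfrac1t\big)\,dt=\infty$ for some $\delta>0$; (e) $\int_{\delta_*}^{\infty}\frac{d\eta}{H_{n-1}^{-1}(\eta)}=\infty$ for some $\delta_*>H_{n-1}(+0)$; (f) $\int_{\delta_*}^{\infty}\frac{d\tau}{\tau\,\Phi_{n-1}^{-1}(\tau)}=\infty$ for some $\delta_*>\Phi(+0)$ (equivalently, $\int_{\delta_0}^{\infty}\frac{d\tau}{\tau[\Phi^{-1}(\tau)]^{1/(n-1)}}=\infty$ for some $\delta_0>\Phi(0)$).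 Then $f$ admits a homeomorphic extension $\overline f:\overline D\to\overline{D'}$ to the closures of the domains.
   Context: $dm$ is Lebesgue measure in $\mathbb{R}^n$; $\overline{\mathbb{R}^n}=\mathbb{R}^n\cup\{\infty\}$. Conventions $1/0=\infty$, $1/\infty=0$. Finitely bi-Lipschitz: a homeomorphism $f:D\to D'$ such that $0<l(x,f)\le L(x,f)<\infty$ for every $x\in D$, where $L(x,f)=\limsup_{y\to x}\frac{|f(x)-f(y)|}{|x-y|}$ and $l(x,f)=\liminf_{y\to x}\frac{|f(x)-f(y)|}{|x-y|}$. Outer dilatation: at a point $x$ of differentiability, $K_O(x,f)=\|f'(x)\|^n/|J(x,f)|$ if $J(x,f)=\det f'(x)\ne0$, $K_O(x,f)=1$ if $f'(x)=0$, and $K_O(x,f)=\infty$ at all other points; $\|f'(x)\|=\sup_{h\ne0}|f'(x)h|/|h|$. Inverse function: for a non-decreasing function $\Psi$ on $[0,\infty]$, $\Psi^{-1}(\tau)=\inf\{t\in[0,\infty]:\Psi(t)\ge\tau\}$, $\inf\emptyset=\infty$ (applied to $\Phi$, $\Phi_{n-1}$, and to $H_{n-1}$, so that $H_{n-1}^{-1}(\eta)=\Phi_{n-1}^{-1}(e^\eta)$). Conventions on the integral conditions: "$=\infty$" means $+\infty$. The integral in (b) is a Lebesgue–Stieltjes integral, the others are Lebesgue integrals; the integrals in (a) and (b) are defined to be $\infty$ if $\Phi_{n-1}(t)=\infty$ for all $t\ge T$ for some $T\in[0,\infty)$. If $\Phi_{n-1}=0$ on $[0,t_*]$, then $H_{n-1}=-\infty$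 there and one sets $H_{n-1}'=0$ there. With $t_0=\sup\{t:\Phi_{n-1}(t)=0\}$ ($t_0=0$ if $\Phi_{n-1}(0)>0$), in (a)–(c) one takes $\delta>t_0$ and in (d) $\delta<1/t_0$ (correspondingly in the reformulation of (c), $\delta>\sup\{t:\Phi(t)=0\}$). Weakly flat boundary: $\Delta(E,F;D)$ is the family of all paths $\gamma:[a,b]\to\overline{\mathbb{R}^n}$ with $\gamma(a)\in E$, $\gamma(b)\in F$, $\gamma(t)\in D$ for $t\in(a,b)$. For a path family $\Gamma$, $M(\Gamma)=\inf\int_{\mathbb{R}^n}\varrho^n\,dm$ over Borel $\varrho:\mathbb{R}^n\to[0,\infty]$ with $\int_\gamma\varrho\,ds\ge1$ for all $\gamma\in\Gamma$. $\partial D$ is weakly flat if for every $x_0\in\partial D$, every neighborhood $U$ of $x_0$ and every $P>0$ there is a neighborhood $V\subset U$ of $x_0$ such that $M(\Delta(E,F;D))\ge P$ for all continua $E$ and $F$ in $D$, each intersecting both $\partial U$ and $\partial V$. *)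

theory Defs
  imports "HOL-Analysis.Analysis"
begin

section \<open>Finitely bi-Lipschitz homeomorphisms and the outer dilatation\<close>

definition is_domain :: "(real ^ 'n) set \<Rightarrow> bool" where
  "is_domain D \<longleftrightarrow> open D \<and> connected D \<and> D \<noteq> {}"

definition upper_stretch :: "(real ^ 'n) set \<Rightarrow> (real ^ 'n \<Rightarrow> real ^ 'n) \<Rightarrow> real ^ 'n \<Rightarrow> ereal" where
  "upper_stretch D f x = Limsup (at x within D) (\<lambda>y. ereal (norm (f x - f y) / norm (x - y)))"

definition lower_stretch :: "(real ^ 'n) set \<Rightarrow> (real ^ 'n \<Rightarrow> real ^ 'n) \<Rightarrow> real ^ 'n \<Rightarrow> ereal" where
  "lower_stretch D f x = Liminf (at x within D) (\<lambda>y. ereal (norm (f x - f y) / norm (x - y)))"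

definition finitely_bi_Lipschitz ::
  "(real ^ 'n) set \<Rightarrow> (real ^ 'n) set \<Rightarrow> (real ^ 'n \<Rightarrow> real ^ 'n) \<Rightarrow> bool" where
  "finitely_bi_Lipschitz D D' f \<longleftrightarrow>
     (\<exists>g. homeomorphism D D' f g) \<and>
     (\<forall>x\<in>D. 0 < lower_stretch D f x \<and> lower_stretch D f x \<le> upper_stretch D f x \<and>
            upper_stretch D f x < \<infinity>)"

text \<open>The value is infinite both at points of non-differentiability and at points where the
  derivative is singular but nonzero.\<close>

definition outer_dilatation :: "(real ^ 'n \<Rightarrow> real ^ 'n) \<Rightarrow> real ^ 'n \<Rightarrow> ennreal" where
  "outer_dilatation f x =
     (let f' = frechet_derivative f (at x); J = det (matrix f')
      in if f differentiable (at x) \<and> J \<noteq> 0 then ennreal (onorm f' ^ CARD('n) / \<bar>J\<bar>)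
         else if f differentiable (at x) \<and> f' = (\<lambda>h. 0) then 1
         else \<infinity>)"


section \<open>Modulus of path families and weakly flat boundaries\<close>

definition curve_length :: "(real \<Rightarrow> real ^ 'n) \<Rightarrow> real \<Rightarrow> real \<Rightarrow> ennreal" where
  "curve_length \<gamma> a b =
     (SUP ts\<in>{ts. sorted ts \<and> set ts \<subseteq> {a..b}}.
        \<Sum>i<length ts - 1. ennreal (dist (\<gamma> (ts ! i)) (\<gamma> (ts ! Suc i))))"

text \<open>Any two parameters at which the arc length from \<open>0\<close> equals \<open>s\<close> have the same image under
  \<open>\<gamma>\<close>, so the choice is immaterial; such parameters exist whenever \<open>\<gamma>\<close> is a rectifiable path and
  \<open>s\<close> lies between \<open>0\<close> and its length.\<close>

definition arclength_param :: "(real \<Rightarrow> real ^ 'n) \<Rightarrow> real \<Rightarrow> real ^ 'n" where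
  "arclength_param \<gamma> s = \<gamma> (SOME t. t \<in> {0..1} \<and> curve_length \<gamma> 0 t = ennreal s)"

text \<open>The usual convention is made that a non-rectifiable path imposes no constraint on admissible
  functions, i.e. its line integrals are taken to be infinite.\<close>

definition line_integral :: "(real ^ 'n \<Rightarrow> ennreal) \<Rightarrow> (real \<Rightarrow> real ^ 'n) \<Rightarrow> ennreal" where
  "line_integral \<rho> \<gamma> =
     (if curve_length \<gamma> 0 1 < \<infinity>
      then (\<integral>\<^sup>+ s \<in> {0..enn2real (curve_length \<gamma> 0 1)}. \<rho> (arclength_param \<gamma> s) \<partial>lebesgue)
      else \<infinity>)"

definition modulus :: "(real \<Rightarrow> real ^ 'n) set \<Rightarrow> ennreal" where
  "modulus \<Gamma> =
     (INF \<rho>\<in>{\<rho>. \<rho> \<in> borel_measurable borel \<and> (\<forall>\<gamma>\<in>\<Gamma>. 1 \<le> line_integral \<rho> \<gamma>)}.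
        \<integral>\<^sup>+ x. \<rho> x ^ CARD('n) \<partial>lebesgue)"

text \<open>As \<open>E\<close>, \<open>F\<close> and \<open>D\<close> are subsets of the finite space, a path of this family never meets the
  point at infinity, even if it is allowed to run in the one-point compactification. Line integrals
  do not depend on the parametrisation, so the parameter interval is normalised to \<open>[0,1]\<close>.\<close>

definition joining_paths ::
  "(real ^ 'n) set \<Rightarrow> (real ^ 'n) set \<Rightarrow> (real ^ 'n) set \<Rightarrow> (real \<Rightarrow> real ^ 'n) set" where
  "joining_paths E F D =
     {\<gamma>. path \<gamma> \<and> pathstart \<gamma> \<in> E \<and> pathfinish \<gamma> \<in> F \<and> (\<forall>t\<in>{0<..<1}. \<gamma> t \<in> D)}"

definition weakly_flat_boundary :: "(real ^ 'n) set \<Rightarrow> bool" where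
  "weakly_flat_boundary D \<longleftrightarrow>
     (\<forall>x0\<in>frontier D. \<forall>U. open U \<and> x0 \<in> U \<longrightarrow> (\<forall>P::real. 0 < P \<longrightarrow>
        (\<exists>V. open V \<and> x0 \<in> V \<and> V \<subseteq> U \<and>
          (\<forall>E F. compact E \<and> connected E \<and> E \<subseteq> D \<and> compact F \<and> connected F \<and> F \<subseteq> D \<and>
                 E \<inter> frontier U \<noteq> {} \<and> E \<inter> frontier V \<noteq> {} \<and>
                 F \<inter> frontier U \<noteq> {} \<and> F \<inter> frontier V \<noteq> {} \<longrightarrow>
                 ennreal P \<le> modulus (joining_paths E F D)))))"


section \<open>The integral conditions\<close>

text \<open>Convexity on the whole of \<open>[0,\<infinity>]\<close>, in the arithmetic of the extended half-line
  (with \<open>0 \<cdot> \<infinity> = 0\<close>).\<close>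

definition convex_ennreal :: "(ennreal \<Rightarrow> ennreal) \<Rightarrow> bool" where
  "convex_ennreal \<Phi> \<longleftrightarrow>
     (\<forall>x y. \<forall>u\<in>{0..1::real}.
        \<Phi> (ennreal u * x + ennreal (1 - u) * y) \<le> ennreal u * \<Phi> x + ennreal (1 - u) * \<Phi> y)"

definition log_ennreal :: "ennreal \<Rightarrow> ereal" where
  "log_ennreal x = (if x = 0 then - \<infinity> else if x = \<infinity> then \<infinity> else ereal (ln (enn2real x)))"

text \<open>Intended for exponents \<open>a > 0\<close>.\<close>

definition powr_ennreal :: "ennreal \<Rightarrow> real \<Rightarrow> ennreal" where
  "powr_ennreal x a = (if x = \<infinity> then \<infinity> else ennreal (enn2real x powr a))"

definition Phi_sub :: "nat \<Rightarrow> (ennreal \<Rightarrow> ennreal) \<Rightarrow> ennreal \<Rightarrow> ennreal" where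
  "Phi_sub n \<Phi> t = \<Phi> (t ^ (n - 1))"

definition H_sub :: "nat \<Rightarrow> (ennreal \<Rightarrow> ennreal) \<Rightarrow> ennreal \<Rightarrow> ereal" where
  "H_sub n \<Phi> t = log_ennreal (Phi_sub n \<Phi> t)"

text \<open>For the functions of interest the real derivative exists at all but countably many points at
  which \<open>H_sub n \<Phi>\<close> is finite; the remaining points are given the value \<open>0\<close>.\<close>

definition H_sub_deriv :: "nat \<Rightarrow> (ennreal \<Rightarrow> ennreal) \<Rightarrow> real \<Rightarrow> real" where
  "H_sub_deriv n \<Phi> t =
     (let h = (\<lambda>s. real_of_ereal (H_sub n \<Phi> (ennreal s)))
      in if H_sub n \<Phi> (ennreal t) \<noteq> - \<infinity> \<and> h differentiable (at t) then deriv h t else 0)"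

text \<open>The infimum of the empty set is \<open>\<infinity>\<close>.\<close>

definition gen_inverse :: "(ennreal \<Rightarrow> 'b::order) \<Rightarrow> 'b \<Rightarrow> ennreal" where
  "gen_inverse \<Psi> \<tau> = Inf {t. \<tau> \<le> \<Psi> t}"

text \<open>The supremum of the empty set is \<open>0\<close>.\<close>

definition zero_sup :: "(ennreal \<Rightarrow> ennreal) \<Rightarrow> ennreal" where
  "zero_sup \<Psi> = Sup {t. \<Psi> t = 0}"

definition eventually_infinite :: "(ennreal \<Rightarrow> ennreal) \<Rightarrow> bool" where
  "eventually_infinite \<Psi> \<longleftrightarrow> (\<exists>T<\<infinity>. \<forall>t\<ge>T. \<Psi> t = \<infinity>)"

text \<open>The Lebesgue integral of an extended real-valued function exists and equals \<open>+\<infinity>\<close>.\<close>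

definition integral_is_top :: "real set \<Rightarrow> (real \<Rightarrow> ereal) \<Rightarrow> bool" where
  "integral_is_top A g \<longleftrightarrow>
     (\<integral>\<^sup>+ t \<in> A. e2ennreal (g t) \<partial>lebesgue) = \<infinity> \<and>
     (\<integral>\<^sup>+ t \<in> A. e2ennreal (- g t) \<partial>lebesgue) < \<infinity>"

definition cond_a :: "nat \<Rightarrow> (ennreal \<Rightarrow> ennreal) \<Rightarrow> bool" where
  "cond_a n \<Phi> \<longleftrightarrow>
     (\<exists>\<delta>>0. zero_sup (Phi_sub n \<Phi>) < ennreal \<delta> \<and>
        (eventually_infinite (Phi_sub n \<Phi>) \<or>
         (\<integral>\<^sup>+ t \<in> {\<delta>..}. ennreal (H_sub_deriv n \<Phi> t / t) \<partial>lebesgue) = \<infinity>))"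

text \<open>Unless \<open>Phi_sub n \<Phi>\<close> is eventually infinite, \<open>H_sub n \<Phi>\<close> is finite, non-decreasing and
  continuous on \<open>[\<delta>,\<infinity>)\<close>. Freezing it to the left of \<open>\<delta>\<close> gives a distribution function on the whole
  line whose Stieltjes measure is \<open>dH\<close> on \<open>[\<delta>,\<infinity>)\<close>.\<close>

definition cond_b :: "nat \<Rightarrow> (ennreal \<Rightarrow> ennreal) \<Rightarrow> bool" where
  "cond_b n \<Phi> \<longleftrightarrow>
     (\<exists>\<delta>>0. zero_sup (Phi_sub n \<Phi>) < ennreal \<delta> \<and>
        (eventually_infinite (Phi_sub n \<Phi>) \<or>
         (\<integral>\<^sup>+ t \<in> {\<delta>..}. ennreal (1 / t)
            \<partial>interval_measure (\<lambda>t. real_of_ereal (H_sub n \<Phi> (ennreal (max \<delta> t))))) = \<infinity>))"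

definition cond_c :: "nat \<Rightarrow> (ennreal \<Rightarrow> ennreal) \<Rightarrow> bool" where
  "cond_c n \<Phi> \<longleftrightarrow>
     (\<exists>\<delta>>0. zero_sup (Phi_sub n \<Phi>) < ennreal \<delta> \<and>
        integral_is_top {\<delta>..} (\<lambda>t. H_sub n \<Phi> (ennreal t) / ereal (t\<^sup>2)))"

text \<open>The reformulation of \<open>cond_c\<close>; \<open>n'\<close> is the exponent conjugate to the dimension.\<close>

definition cond_c' :: "real \<Rightarrow> (ennreal \<Rightarrow> ennreal) \<Rightarrow> bool" where
  "cond_c' n' \<Phi> \<longleftrightarrow>
     (\<exists>\<delta>>0. zero_sup \<Phi> < ennreal \<delta> \<and>
        integral_is_top {\<delta>..} (\<lambda>t. log_ennreal (\<Phi> (ennreal t)) / ereal (t powr n')))"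

definition cond_d :: "nat \<Rightarrow> (ennreal \<Rightarrow> ennreal) \<Rightarrow> bool" where
  "cond_d n \<Phi> \<longleftrightarrow>
     (\<exists>\<delta>>0. ennreal \<delta> < 1 / zero_sup (Phi_sub n \<Phi>) \<and>
        integral_is_top {0<..\<delta>} (\<lambda>t. H_sub n \<Phi> (ennreal (1 / t))))"

definition cond_e :: "nat \<Rightarrow> (ennreal \<Rightarrow> ennreal) \<Rightarrow> bool" where
  "cond_e n \<Phi> \<longleftrightarrow>
     (\<exists>\<delta>::real. Lim (at_right 0) (H_sub n \<Phi>) < ereal \<delta> \<and>
        (\<integral>\<^sup>+ \<eta> \<in> {\<delta>..}. 1 / gen_inverse (H_sub n \<Phi>) (ereal \<eta>) \<partial>lebesgue) = \<infinity>)"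

definition cond_f :: "nat \<Rightarrow> (ennreal \<Rightarrow> ennreal) \<Rightarrow> bool" where
  "cond_f n \<Phi> \<longleftrightarrow>
     (\<exists>\<delta>::real. Lim (at_right 0) \<Phi> < ennreal \<delta> \<and>
        (\<integral>\<^sup>+ \<tau> \<in> {\<delta>..}. 1 / (ennreal \<tau> * gen_inverse (Phi_sub n \<Phi>) (ennreal \<tau>)) \<partial>lebesgue) = \<infinity>)"

text \<open>The reformulation of \<open>cond_f\<close> in terms of the inverse of \<open>\<Phi>\<close> itself.\<close>

definition cond_f' :: "nat \<Rightarrow> (ennreal \<Rightarrow> ennreal) \<Rightarrow> bool" where
  "cond_f' n \<Phi> \<longleftrightarrow>
     (\<exists>\<delta>::real. \<Phi> 0 < ennreal \<delta> \<and>
        (\<integral>\<^sup>+ \<tau> \<in> {\<delta>..}.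
           1 / (ennreal \<tau> * powr_ennreal (gen_inverse \<Phi> (ennreal \<tau>)) (1 / (real n - 1)))
           \<partial>lebesgue) = \<infinity>)"

end

theory Submission
  imports Defs
begin

text \<open>An upper gradient \<open>\<sigma>\<close> on \<open>D\<close> is carried by the inverse \<open>g\<close> of \<open>f\<close> to the density \<open>(\<sigma> \<circ> g) \<cdot> Lip g\<close>
  on \<open>D'\<close>, and since the inner dilatation is at most \<open>Q = K\<^sub>O ^ (n - 1)\<close>, a change of variables bounds
  the modulus of an image family by \<open>\<integral> \<sigma> ^ n * Q\<close>. The theorems of Rademacher and Stepanov are not
  needed: \<open>\<Phi> \<infinity> = \<infinity>\<close>, so \<open>K\<^sub>O\<close> is finite almost everywhere, which says that \<open>f\<close> is differentiable with
  invertible derivative there.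

  If \<open>f\<close> had two cluster values at a boundary point \<open>x0\<close>, then by weak flatness of the boundary of \<open>D'\<close>
  the images of a fixed continuum and of continua shrinking to \<open>x0\<close> would span path families of
  modulus at least \<open>1\<close>. A radial \<open>\<sigma>\<close> with slope proportional to \<open>w k / r k\<close> on the annulus between the
  radii \<open>r (k + 1)\<close> and \<open>r k = exp (- k / n)\<close>, where \<open>w k\<close> is half the reciprocal of the generalised
  inverse of \<open>\<Phi>\<^sub>n\<^sub>-\<^sub>1\<close> at a multiple of \<open>exp k\<close>, makes these moduli tend to \<open>0\<close> as soon as the series of
  the \<open>w k\<close> diverges; and each of (a) to (f) entails this divergence. For the inverse map it is
  enough that \<open>Q\<close> is integrable, which bounds the moduli of families joining continua near distinct
  boundary points. Weak flatness of the boundary of \<open>D\<close> enters through the local connectedness of \<open>D\<close>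
  at its boundary.\<close>

text \<open>Geometry and growth meet in one pointwise inequality,
  \<open>s * w k ^ (n - 1) \<le> 1 + \<Phi> s * exp (- k)\<close>. On the k-th annulus the slope is
  \<open>\<sigma> = q * w k / r k\<close>, and \<open>r k ^ n = exp (- k)\<close>, so
  \<open>\<sigma> ^ n * Q = q ^ n * w k * exp k * (w k ^ (n - 1) * Q)\<close> is at most
  \<open>q ^ n * w k * (exp k + \<Phi> Q)\<close>. The volume of the ball of radius
  \<open>r k\<close> cancels \<open>exp k\<close>. With \<open>S\<close> the sum of the weights
  involved, the modulus is therefore at most \<open>q ^ n * S\<close> times a constant; a total
  increment of 1 forces \<open>q\<close> to be of order \<open>1 / S\<close>, and the bound decays
  like \<open>S ^ (1 - n)\<close>. This is where the dimension and the divergence of the weights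
  enter. The inequality itself comes from convexity, by comparing \<open>\<Phi>\<close> with the
  chord from 0 to a point where it has reached at least \<open>\<Phi> 0 + exp k\<close>. On the side
  of the conditions, \<open>u k\<close> is the level at which the logarithm of
  \<open>\<Phi>\<^sub>n\<^sub>-\<^sub>1\<close> passes \<open>c0 + k\<close>. That logarithm stays
  below \<open>c0\<close> plus the counting function of these levels, which reduces every condition
  to the series of the \<open>1 / u k\<close>.\<close>

section \<open>Change of variables over arbitrary finite index types\<close>

text \<open>The change of variables theorem of HOL-Analysis requires a well-ordered index type. The type
  \<open>'a wo\<close> is a copy of \<open>'a\<close> with an arbitrarily chosen well-order, along which the theorem is
  transported.\<close>

typedef 'a wo = "UNIV :: 'a set" morphisms unwo wo by auto

lemma bij_wo: "bij wo" and bij_unwo: "bij unwo"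
  by (auto intro: o_bij[of unwo wo] o_bij[of wo unwo] simp: fun_eq_iff wo_inverse unwo_inverse)

instance wo :: (finite) finite
proof
  show "finite (UNIV :: 'a wo set)"
    by (metis bij_wo bij_betw_finite finite)
qed

definition wo_index :: "'a::finite \<Rightarrow> nat" where
  "wo_index = (SOME f. inj f)"

lemma inj_wo_index: "inj (wo_index :: 'a::finite \<Rightarrow> nat)"
  unfolding wo_index_def
proof -
  show "inj (SOME f :: 'a \<Rightarrow> nat. inj f)"
    using finite_imp_inj_to_nat_seg[of "UNIV :: 'a set"] by (metis finite someI_ex)
qed

instantiation wo :: (finite) wellorder
begin

definition less_eq_wo :: "'a wo \<Rightarrow> 'a wo \<Rightarrow> bool" where
  "x \<le> y \<longleftrightarrow> wo_index (unwo x) \<le> wo_index (unwo y)"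

definition less_wo :: "'a wo \<Rightarrow> 'a wo \<Rightarrow> bool" where
  "x < y \<longleftrightarrow> wo_index (unwo x) < wo_index (unwo y)"

instance
proof
  fix x y z :: "'a wo" and P
  show "(x < y) = (x \<le> y \<and> \<not> y \<le> x)" "x \<le> x" "x \<le> y \<or> y \<le> x"
    by (auto simp: less_eq_wo_def less_wo_def)
  show "x \<le> y \<Longrightarrow> y \<le> z \<Longrightarrow> x \<le> z"
    by (auto simp: less_eq_wo_def)
  show "x \<le> y \<Longrightarrow> y \<le> x \<Longrightarrow> x = y"
    unfolding less_eq_wo_def by (metis inj_wo_index injD order_antisym unwo_inject)
  assume step: "\<And>x::'a wo. (\<And>y. y < x \<Longrightarrow> P y) \<Longrightarrow> P x"
  show "P x"
  proof (induction x rule: measure_induct_rule[where f="\<lambda>x. wo_index (unwo x)"])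
    case (less x)
    show ?case by (rule step, rule less) (simp add: less_wo_def)
  qed
qed

end

lemma CARD_wo: "CARD('a wo) = CARD('a::finite)"
  using bij_wo by (metis bij_betw_same_card)

definition to_wo :: "real ^ 'n \<Rightarrow> real ^ 'n wo" where
  "to_wo x = (\<chi> i. x $ unwo i)"

definition of_wo :: "real ^ 'n wo \<Rightarrow> real ^ 'n" where
  "of_wo y = (\<chi> i. y $ wo i)"

lemma of_to_wo [simp]: "of_wo (to_wo x) = x" and to_of_wo [simp]: "to_wo (of_wo y) = y"
  by (simp_all add: of_wo_def to_wo_def vec_eq_iff wo_inverse unwo_inverse)

lemma linear_to_wo: "linear to_wo" and linear_of_wo: "linear of_wo"
  by (auto simp: to_wo_def of_wo_def vec_eq_iff intro!: linearI)

lemma norm_to_wo [simp]: "norm (to_wo x) = norm x"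
  unfolding norm_vec_def L2_set_def to_wo_def
  using sum.reindex_bij_betw[OF bij_unwo, of "\<lambda>i. (norm (x $ i))\<^sup>2"] by simp

lemma norm_of_wo [simp]: "norm (of_wo y) = norm y"
  by (metis norm_to_wo to_of_wo)

text \<open>Relabelling acts on rows and columns at once. In the Leibniz expansion the permutation
  \<open>p\<close> corresponds to \<open>map_permutation UNIV wo p\<close>, which has the same sign
  and selects the same entries.\<close>

lemma det_wo:
  fixes A :: "real ^ 'n \<Rightarrow> real ^ 'n"
  shows "det (matrix (to_wo \<circ> A \<circ> of_wo)) = det (matrix A)"
proof -
  define M where "M = matrix A"
  have of_axis: "of_wo (axis i 1) = axis (unwo i) 1" for i :: "'n wo"
    by (auto simp: of_wo_def axis_def vec_eq_iff wo_inverse unwo_inverse)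
  have M': "matrix (to_wo \<circ> A \<circ> of_wo) = (\<chi> i j. M $ unwo i $ unwo j)"
    by (simp add: M_def matrix_def vec_eq_iff of_axis) (simp add: to_wo_def)
  have per: "p \<in> {p. p permutes (UNIV::'n set)} \<Longrightarrow>
      of_int (sign (map_permutation UNIV wo p)) * (\<Prod>i\<in>UNIV. M $ unwo i $ unwo (map_permutation UNIV wo p i))
      = of_int (sign p) * (\<Prod>i\<in>UNIV. M $ i $ p i)" for p
  proof -
    assume p: "p \<in> {p. p permutes (UNIV::'n set)}"
    have s: "sign (map_permutation UNIV wo p) = sign p"
      using p bij_wo by (intro sign_map_permutation) (auto simp: bij_def)
    have "unwo (map_permutation UNIV wo p (wo i)) = p i" for i
      using bij_wo by (subst map_permutation_apply) (auto simp: bij_def wo_inverse)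
    then have "(\<Prod>i\<in>UNIV. M $ unwo i $ unwo (map_permutation UNIV wo p i)) = (\<Prod>i\<in>UNIV. M $ i $ p i)"
      using prod.reindex_bij_betw[OF bij_wo, of "\<lambda>i. M $ unwo i $ unwo (map_permutation UNIV wo p i)"]
      by (simp add: wo_inverse)
    then show ?thesis using s by simp
  qed
  have bb: "bij_betw (map_permutation UNIV wo) {p. p permutes (UNIV::'n set)} {p. p permutes (UNIV::'n wo set)}"
  proof (rule bij_betw_cong[THEN iffD1, OF _ bij_betw_permutations[OF bij_wo]])
    fix p assume "p \<in> {p. p permutes (UNIV::'n set)}"
    have "map_permutation UNIV wo p x = wo (p (inv_into UNIV wo x))" for x
      using bij_is_surj[OF bij_wo] by (auto simp: map_permutation_def restrict_id_def)
    then show "(\<lambda>x. if x \<in> UNIV then wo (p (inv_into UNIV wo x)) else x) = map_permutation UNIV wo p"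
      by (simp add: fun_eq_iff)
  qed
  have "det (matrix (to_wo \<circ> A \<circ> of_wo)) = det M"
    unfolding M' det_def
    by (subst sum.reindex_bij_betw[OF bb, symmetric]) (rule sum.cong, auto simp: per)
  then show ?thesis by (simp add: M_def)
qed

lemma Basis_wo: "bij_betw to_wo (Basis :: (real ^ 'n) set) Basis"
proof (rule bij_betw_byWitness[where f' = of_wo])
  have to_axis: "to_wo (axis i r) = axis (wo i) r" for i and r :: real
    by (auto simp: to_wo_def axis_def vec_eq_iff wo_inverse unwo_inverse)
  have of_axis: "of_wo (axis i r) = axis (unwo i) r" for i and r :: real
    by (auto simp: of_wo_def axis_def vec_eq_iff wo_inverse unwo_inverse)
  show "to_wo ` Basis \<subseteq> Basis" "of_wo ` Basis \<subseteq> Basis"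
    by (auto simp: Basis_vec_def to_axis of_axis)
qed auto

lemma inner_wo: "to_wo x \<bullet> to_wo y = x \<bullet> y"
  by (simp only: dot_norm linear_add[OF linear_to_wo, symmetric] norm_to_wo)

lemma continuous_to_wo: "continuous_on S to_wo" and continuous_of_wo: "continuous_on T of_wo"
  by (intro linear_continuous_on linear_to_wo[unfolded linear_conv_bounded_linear]
      linear_of_wo[unfolded linear_conv_bounded_linear])+

text \<open>Lebesgue measure is determined by its values on boxes. As \<open>to_wo\<close> preserves
  inner products and maps \<open>Basis\<close> onto \<open>Basis\<close>, the preimage of a box is a
  box with the same side lengths.\<close>

lemma lborel_to_wo: "distr lborel borel to_wo = (lborel :: (real ^ 'n::finite wo) measure)"
proof (rule lborel_eqI[symmetric])
  have meas: "(to_wo :: real ^ 'n \<Rightarrow> _) \<in> measurable lborel borel"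
    using borel_measurable_continuous_onI[OF continuous_to_wo] by simp
  have BW: "(Basis :: (real ^ 'n wo) set) = to_wo ` Basis"
    using bij_betw_imp_surj_on[OF Basis_wo] by blast
  fix l u :: "real ^ 'n wo" assume lu: "\<And>b. b \<in> Basis \<Longrightarrow> l \<bullet> b \<le> u \<bullet> b"
  have vim: "to_wo -` box l u = box (of_wo l) (of_wo u)"
  proof (intro set_eqI)
    fix x
    have "to_wo x \<in> box l u \<longleftrightarrow> (\<forall>b\<in>Basis. l \<bullet> to_wo b < to_wo x \<bullet> to_wo b \<and> to_wo x \<bullet> to_wo b < u \<bullet> to_wo b)"
      unfolding mem_box BW by simp
    also have "\<dots> \<longleftrightarrow> x \<in> box (of_wo l) (of_wo u)"
      unfolding mem_box using inner_wo[of "of_wo l"] inner_wo[of "of_wo u"] by (simp add: inner_wo)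
    finally show "x \<in> to_wo -` box l u \<longleftrightarrow> x \<in> box (of_wo l) (of_wo u)" by simp
  qed
  have le: "of_wo l \<bullet> b \<le> of_wo u \<bullet> b" if "b \<in> Basis" for b
    using lu[of "to_wo b"] bij_betw_imp_surj_on[OF Basis_wo] that
      inner_wo[of "of_wo l" b] inner_wo[of "of_wo u" b] by auto
  have "emeasure (distr lborel borel to_wo) (box l u) = (\<Prod>b\<in>Basis. (of_wo u - of_wo l) \<bullet> b)"
    using meas by (simp add: emeasure_distr vim emeasure_lborel_box le)
  also have "(\<Prod>b\<in>Basis. (of_wo u - of_wo l) \<bullet> b) = (\<Prod>b\<in>Basis. (u - l) \<bullet> b)"
    using prod.reindex_bij_betw[OF Basis_wo, of "\<lambda>b. (u - l) \<bullet> b"]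
      inner_wo[of "of_wo (u - l)", symmetric] by (simp add: linear_diff[OF linear_of_wo, symmetric])
  finally show "emeasure (distr lborel borel to_wo) (box l u) = ennreal (\<Prod>b\<in>Basis. (u - l) \<bullet> b)" .
qed simp

lemma nn_integral_to_wo:
  fixes h :: "real ^ 'n \<Rightarrow> ennreal"
  assumes "h \<in> borel_measurable borel"
  shows "(\<integral>\<^sup>+ y. h (of_wo y) \<partial>lborel) = (\<integral>\<^sup>+ x. h x \<partial>lborel)"
proof -
  have meas: "(to_wo :: real ^ 'n \<Rightarrow> _) \<in> measurable lborel borel"
      "(of_wo :: _ \<Rightarrow> real ^ 'n) \<in> measurable borel borel"
    using borel_measurable_continuous_onI[OF continuous_to_wo]
      borel_measurable_continuous_onI[OF continuous_of_wo] by simp_all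
  have "(\<integral>\<^sup>+ y. h (of_wo y) \<partial>lborel) = (\<integral>\<^sup>+ y. h (of_wo y) \<partial>distr lborel borel to_wo)"
    by (simp add: lborel_to_wo)
  also have "\<dots> = (\<integral>\<^sup>+ x. h x \<partial>lborel)"
    by (subst nn_integral_distr) (use meas assms in \<open>auto intro!: measurable_compose[OF meas(2)]\<close>)
  finally show ?thesis .
qed

text \<open>An infinite right-hand side is trivial. Otherwise the integrand on the right is
  absolutely integrable, and the substitution rule for vector-valued integrals, with values in
  \<open>real ^ 1\<close>, even gives equality.\<close>

lemma nn_integral_change_of_variables_le_wellorder:
  fixes f :: "real ^ 'm::{finite,wellorder} \<Rightarrow> real ^ 'm::_" and h :: "real ^ 'm::_ \<Rightarrow> real"
  assumes S: "S \<in> sets lebesgue"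
    and der: "\<And>x. x \<in> S \<Longrightarrow> (f has_derivative f' x) (at x within S)"
    and inj: "inj_on f S"
    and h: "h \<in> borel_measurable borel" and h0: "\<And>y. 0 \<le> h y"
  shows "(\<integral>\<^sup>+ y\<in>f ` S. ennreal (h y) \<partial>lebesgue)
           \<le> (\<integral>\<^sup>+ x\<in>S. ennreal (h (f x) * \<bar>det (matrix (f' x))\<bar>) \<partial>lebesgue)"
    (is "_ \<le> ?R")
proof (cases "?R = \<infinity>")
  case False
  let ?F = "\<lambda>y. vec (h y) :: real ^ 1"
  let ?g = "\<lambda>x. \<bar>det (matrix (f' x))\<bar> * h (f x)"
  have contf: "continuous_on S f"
    using der has_derivative_continuous_on by blast
  have "f \<in> borel_measurable (lebesgue_on S)"
    using contf S by (rule continuous_imp_measurable_on_sets_lebesgue)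
  then have "(\<lambda>x. h (f x)) \<in> borel_measurable (lebesgue_on S)"
    by (rule measurable_compose[OF _ h])
  then have gm: "?g \<in> borel_measurable (lebesgue_on S)"
    by (intro borel_measurable_times borel_measurable_abs borel_measurable_det_Jacobian[OF S der])
  have "integrable (lebesgue_on S) ?g"
  proof (rule integrableI_nonneg[OF gm])
    show "AE x in lebesgue_on S. 0 \<le> ?g x" using h0 by simp
    have "(\<integral>\<^sup>+ x. ennreal (?g x) \<partial>lebesgue_on S) = ?R"
      using S by (subst nn_integral_restrict_space) (auto simp: mult.commute)
    then show "(\<integral>\<^sup>+ x. ennreal (?g x) \<partial>lebesgue_on S) < \<infinity>"
      using False by (simp add: top.not_eq_extremum)
  qed
  then have gi: "?g absolutely_integrable_on S"
    using S by (simp add: integrable_restrict_space set_integrable_def)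
  have "(\<lambda>x. \<bar>det (matrix (f' x))\<bar> *\<^sub>R ?F (f x)) absolutely_integrable_on S"
    using gi unfolding absolutely_integrable_on_1_iff by simp
  then have 1: "?F absolutely_integrable_on (f ` S)"
     and 2: "integral (f ` S) ?F = integral S (\<lambda>x. \<bar>det (matrix (f' x))\<bar> *\<^sub>R ?F (f x))"
    using absolutely_integrable_change_of_variables[OF S der inj, of ?F]
      integral_change_of_variables[OF S der inj, of ?F] by blast+
  have hi: "h absolutely_integrable_on (f ` S)"
    using 1 unfolding absolutely_integrable_on_1_iff by simp
  have "integral (f ` S) h = integral S ?g"
    using arg_cong[OF 2, of "\<lambda>v. v $ 1"] by (simp add: integral_on_1_eq)
  have nn: "(\<integral>\<^sup>+ x. ennreal (indicator U x * u x) \<partial>lebesgue) = ennreal (integral U u)"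
    if u: "u absolutely_integrable_on U" and "\<And>x. 0 \<le> u x" for u and U :: "(real ^ 'm::_) set"
  proof -
    have "(\<integral>\<^sup>+ x. ennreal (indicator U x * u x) \<partial>lebesgue) = ennreal (set_lebesgue_integral lebesgue U u)"
      using that unfolding set_integrable_def set_lebesgue_integral_def
      by (subst nn_integral_eq_integral) auto
    then show ?thesis using set_lebesgue_integral_eq_integral(2)[OF u] by simp
  qed
  have "(\<integral>\<^sup>+ x. ennreal (indicator (f ` S) x * h x) \<partial>lebesgue) = ennreal (integral S ?g)"
    using nn[OF hi] h0 \<open>integral (f ` S) h = integral S ?g\<close> by simp
  moreover have "(\<integral>\<^sup>+ x. ennreal (indicator S x * ?g x) \<partial>lebesgue) = ennreal (integral S ?g)"
    using nn[OF gi] h0 by simp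
  moreover have "(\<integral>\<^sup>+ y\<in>f ` S. ennreal (h y) \<partial>lebesgue) = (\<integral>\<^sup>+ x. ennreal (indicator (f ` S) x * h x) \<partial>lebesgue)"
    by (intro nn_integral_cong) (auto simp: indicator_def)
  moreover have "?R = (\<integral>\<^sup>+ x. ennreal (indicator S x * ?g x) \<partial>lebesgue)"
    by (intro nn_integral_cong) (auto simp: indicator_def mult.commute)
  ultimately show ?thesis by simp
qed simp

text \<open>Conjugation with \<open>to_wo\<close> reduces the claim to the well-ordered case. The
  Borel assumptions on the domain, its image and the Jacobian make both integrands Borel functions,
  as the transport by \<open>nn_integral_to_wo\<close> demands.\<close>

lemma nn_integral_change_of_variables_le:
  fixes f :: "real ^ 'n \<Rightarrow> real ^ 'n" and h :: "real ^ 'n \<Rightarrow> real"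
  assumes S: "S \<in> sets borel" and fS: "f ` S \<in> sets borel"
    and der: "\<And>x. x \<in> S \<Longrightarrow> (f has_derivative f' x) (at x within S)"
    and inj: "inj_on f S"
    and h: "h \<in> borel_measurable borel" and h0: "\<And>y. 0 \<le> h y"
    and J: "(\<lambda>x. indicator S x * det (matrix (f' x))) \<in> borel_measurable borel"
  shows "(\<integral>\<^sup>+ y\<in>f ` S. ennreal (h y) \<partial>lebesgue)
           \<le> (\<integral>\<^sup>+ x\<in>S. ennreal (h (f x) * \<bar>det (matrix (f' x))\<bar>) \<partial>lebesgue)"
proof -
  define T where "T = of_wo -` S"
  define F where "F = to_wo \<circ> f \<circ> of_wo"
  define F' where "F' y = to_wo \<circ> f' (of_wo y) \<circ> of_wo" for y
  have of_meas: "(of_wo :: _ \<Rightarrow> real ^ 'n) \<in> measurable borel borel"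
    by (rule borel_measurable_continuous_onI[OF continuous_of_wo])
  have T: "T \<in> sets borel" using measurable_sets[OF of_meas S] by (simp add: T_def)
  have ofT: "of_wo ` T = S"
    unfolding T_def by (rule surj_image_vimage_eq) (rule surjI, rule of_to_wo)
  have FT: "F ` T = of_wo -` (f ` S)"
  proof -
    have "to_wo ` B = of_wo -` B" for B :: "(real ^ 'n) set"
    proof (intro set_eqI iffI)
      fix y assume "y \<in> of_wo -` B"
      then have "to_wo (of_wo y) \<in> to_wo ` B" by (intro imageI) simp
      then show "y \<in> to_wo ` B" by simp
    qed auto
    then show ?thesis unfolding F_def image_comp[symmetric] ofT by simp
  qed
  have bl: "bounded_linear (to_wo :: real ^ 'n \<Rightarrow> _)" "bounded_linear (of_wo :: _ \<Rightarrow> real ^ 'n)"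
    by (rule linear_to_wo[unfolded linear_conv_bounded_linear],
        rule linear_of_wo[unfolded linear_conv_bounded_linear])
  have derF: "(F has_derivative F' y) (at y within T)" if "y \<in> T" for y
  proof -
    have "of_wo y \<in> S" using that by (simp add: T_def)
    then have "(f has_derivative f' (of_wo y)) (at (of_wo y) within of_wo ` T)"
      using der ofT by simp
    then have "(f \<circ> of_wo has_derivative f' (of_wo y) \<circ> of_wo) (at y within T)"
      by (rule diff_chain_within[OF bounded_linear_imp_has_derivative[OF bl(2)]])
    then have "(to_wo \<circ> (f \<circ> of_wo) has_derivative to_wo \<circ> (f' (of_wo y) \<circ> of_wo)) (at y within T)"
      by (rule diff_chain_within[OF _ bounded_linear_imp_has_derivative[OF bl(1)]])
    then show ?thesis by (simp add: F_def F'_def o_assoc)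
  qed
  have injF: "inj_on F T"
  proof (rule inj_onI)
    fix x y assume "x \<in> T" "y \<in> T" "F x = F y"
    then have "of_wo (F x) = of_wo (F y)" by simp
    then have "f (of_wo x) = f (of_wo y)" by (simp add: F_def)
    then have "of_wo x = of_wo y"
      using inj_onD[OF inj] \<open>x \<in> T\<close> \<open>y \<in> T\<close> by (simp add: T_def)
    then have "to_wo (of_wo x) = to_wo (of_wo y)" by simp
    then show "x = y" by simp
  qed
  have hF: "(\<lambda>y. h (of_wo y)) \<in> borel_measurable borel"
    by (rule measurable_compose[OF of_meas h])
  have k1: "(\<lambda>y. ennreal (h y) * indicator (f ` S) y) \<in> borel_measurable borel"
    using h fS by measurable
  have fm: "(\<lambda>x. indicator S x * h (f x)) \<in> borel_measurable borel"
  proof -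
    have "f \<in> borel_measurable (restrict_space borel S)"
      using has_derivative_continuous_on[OF der] by (rule borel_measurable_continuous_on_restrict)
    then have "(\<lambda>x. h (f x)) \<in> borel_measurable (restrict_space borel S)"
      by (rule measurable_compose[OF _ h])
    then show ?thesis using S by (subst (asm) borel_measurable_restrict_space_iff) auto
  qed
  have "(\<lambda>x. ennreal ((indicator S x * h (f x)) * \<bar>indicator S x * det (matrix (f' x))\<bar>)) \<in> borel_measurable borel"
    using fm J by measurable
  moreover have "(\<lambda>x. ennreal ((indicator S x * h (f x)) * \<bar>indicator S x * det (matrix (f' x))\<bar>))
      = (\<lambda>x. ennreal (h (f x) * \<bar>det (matrix (f' x))\<bar>) * indicator S x)"
    by (auto simp: indicator_def fun_eq_iff)
  ultimately have k2: "(\<lambda>x. ennreal (h (f x) * \<bar>det (matrix (f' x))\<bar>) * indicator S x) \<in> borel_measurable borel"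
    by simp
  have "(\<integral>\<^sup>+ y\<in>f ` S. ennreal (h y) \<partial>lebesgue) = (\<integral>\<^sup>+ y\<in>f ` S. ennreal (h y) \<partial>lborel)"
    by (rule nn_integral_completion)
  also have "\<dots> = (\<integral>\<^sup>+ y. ennreal (h (of_wo y)) * indicator (f ` S) (of_wo y) \<partial>lborel)"
    using nn_integral_to_wo[OF k1] by simp
  also have "\<dots> = (\<integral>\<^sup>+ y\<in>F ` T. ennreal (h (of_wo y)) \<partial>lborel)"
    by (simp add: FT indicator_def)
  also have "\<dots> = (\<integral>\<^sup>+ y\<in>F ` T. ennreal (h (of_wo y)) \<partial>lebesgue)"
    by (rule nn_integral_completion[symmetric])
  also have "\<dots> \<le> (\<integral>\<^sup>+ x\<in>T. ennreal (h (of_wo (F x)) * \<bar>det (matrix (F' x))\<bar>) \<partial>lebesgue)"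
    using T h0 by (intro nn_integral_change_of_variables_le_wellorder derF injF hF) auto
  also have "\<dots> = (\<integral>\<^sup>+ x. ennreal (h (f (of_wo x)) * \<bar>det (matrix (f' (of_wo x)))\<bar>) * indicator S (of_wo x) \<partial>lebesgue)"
    by (intro nn_integral_cong) (auto simp: F_def F'_def det_wo T_def indicator_def)
  also have "\<dots> = (\<integral>\<^sup>+ x. ennreal (h (f (of_wo x)) * \<bar>det (matrix (f' (of_wo x)))\<bar>) * indicator S (of_wo x) \<partial>lborel)"
    by (rule nn_integral_completion)
  also have "\<dots> = (\<integral>\<^sup>+ x\<in>S. ennreal (h (f x) * \<bar>det (matrix (f' x))\<bar>) \<partial>lborel)"
    using nn_integral_to_wo[OF k2] by simp
  also have "\<dots> = (\<integral>\<^sup>+ x\<in>S. ennreal (h (f x) * \<bar>det (matrix (f' x))\<bar>) \<partial>lebesgue)"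
    by (rule nn_integral_completion[symmetric])
  finally show ?thesis .
qed

section \<open>Inner and outer dilatation\<close>

text \<open>The image of the unit ball has volume \<open>\<bar>det (matrix A)\<bar>\<close> times
  that of the ball and lies in the ball of radius \<open>onorm A\<close>.\<close>

lemma abs_det_le_onorm_power_wellorder:
  fixes A :: "real ^ 'm::{finite,wellorder} \<Rightarrow> real ^ 'm::_"
  assumes A: "linear A"
  shows "\<bar>det (matrix A)\<bar> \<le> onorm A ^ CARD('m)"
proof -
  have bl: "bounded_linear A" using A by (simp add: linear_conv_bounded_linear)
  have "A ` ball 0 1 \<subseteq> cball 0 (onorm A)"
  proof clarsimp
    fix x :: "real ^ 'm::_" assume "norm x < 1"
    then show "norm (A x) \<le> onorm A"
      using onorm[OF bl, of x] onorm_pos_le[OF bl] mult_left_mono[of "norm x" 1 "onorm A"] by simp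
  qed
  then have "measure lebesgue (A ` ball 0 1) \<le> measure lebesgue (cball (0::real^'m::_) (onorm A))"
    by (intro measure_mono_fmeasurable) (use measurable_linear_image[OF A, of "ball 0 1"] in auto)
  also have "\<dots> = onorm A ^ CARD('m) * measure lebesgue (ball (0::real^'m::_) 1)"
    using content_cball[of "onorm A" "0::real^'m::_"] content_ball[of 1 "0::real^'m::_"] onorm_pos_le[OF bl]
    by (simp add: DIM_cart)
  finally have "\<bar>det (matrix A)\<bar> * measure lebesgue (ball (0::real^'m::_) 1)
      \<le> onorm A ^ CARD('m) * measure lebesgue (ball (0::real^'m::_) 1)"
    by (simp add: measure_linear_image[OF A])
  then show ?thesis
    using content_ball_gt_0_iff[of "0::real^'m::_" 1] by simp
qed

lemma abs_det_le_onorm_power: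
  fixes A :: "real ^ 'n \<Rightarrow> real ^ 'n"
  assumes A: "linear A"
  shows "\<bar>det (matrix A)\<bar> \<le> onorm A ^ CARD('n)"
proof -
  define B where "B = to_wo \<circ> A \<circ> of_wo"
  have bl: "bounded_linear A" using A by (simp add: linear_conv_bounded_linear)
  have B: "linear B" unfolding B_def using A by (intro linear_compose linear_to_wo linear_of_wo)
  have oB: "onorm B \<le> onorm A"
    using onorm[OF bl] onorm_pos_le[OF bl]
    by (intro onorm_bound) (auto simp: B_def, metis norm_of_wo)
  have "0 \<le> onorm B" using B by (simp add: linear_conv_bounded_linear onorm_pos_le)
  with oB have "onorm B ^ CARD('n) \<le> onorm A ^ CARD('n)" by (rule power_mono)
  moreover have "\<bar>det (matrix A)\<bar> \<le> onorm B ^ CARD('n)"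
    using abs_det_le_onorm_power_wellorder[OF B] by (simp add: CARD_wo det_wo B_def)
  ultimately show ?thesis by simp
qed

text \<open>One direction is stretched by \<open>norm (A h)\<close>, the remaining ones by at most
  \<open>onorm A\<close>. A diagonal rescaling along that direction turns the bound by the full
  power of the norm into this sharper one.\<close>

lemma abs_det_le_norm_times_onorm_power:
  fixes A :: "real ^ 'n \<Rightarrow> real ^ 'n"
  assumes A: "linear A" and h: "norm h = 1"
  shows "\<bar>det (matrix A)\<bar> \<le> norm (A h) * onorm A ^ (CARD('n) - 1)"
proof (cases "det (matrix A) = 0")
  case True
  then show ?thesis
    using onorm_pos_le[of A] A by (simp add: linear_conv_bounded_linear)
next
  case False
  define N where "N = onorm A"
  define a where "a = norm (A h)"
  have bl: "bounded_linear A" using A by (simp add: linear_conv_bounded_linear)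
  have "inj A"
    using False by (simp add: A det_nz_iff_inj)
  then have "A h \<noteq> 0" using h linear_injective_0[OF A] norm_eq_zero[of h] by auto
  then have a: "a > 0" by (simp add: a_def)
  have aN: "a \<le> N" using onorm[OF bl, of h] h by (simp add: a_def N_def)
  then have N: "N > 0" using a by simp
  obtain k :: 'n where True by simp
  define e :: "real ^ 'n" where "e = axis k 1"
  have e: "norm e = 1" by (simp add: e_def)
  have ek: "e \<bullet> v = v $ k" for v by (simp add: e_def inner_axis')
  obtain R where R: "orthogonal_transformation R" "R e = h"
    using orthogonal_transformation_exists_1[OF e h] by blast
  obtain R' where R': "orthogonal_transformation R'" "R' ((1/a) *\<^sub>R A h) = e"
    using orthogonal_transformation_exists_1[of "(1/a) *\<^sub>R A h" e] e a by (auto simp: a_def)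
  \<comment> \<open>\<open>R\<close> takes \<open>e\<close> to \<open>h\<close> and
    \<open>R'\<close> takes the direction of \<open>A h\<close> to \<open>e\<close>. After these
    isometries \<open>e\<close> is an eigenvector with eigenvalue \<open>a\<close>, and the
    determinant keeps its absolute value.\<close>
  define C where "C = R' \<circ> A \<circ> R"
  have linR: "linear R" "linear R'"
    using R R' by (auto intro: orthogonal_transformation_linear)
  have C: "linear C" unfolding C_def using A linR by (intro linear_compose)
  have Ce: "C e = a *\<^sub>R e"
  proof -
    have "R' (A h) = a *\<^sub>R R' ((1/a) *\<^sub>R A h)" using a by (simp add: linear_scale[OF linR(2)])
    then show ?thesis by (simp add: C_def R R')
  qed
  have detC: "\<bar>det (matrix C)\<bar> = \<bar>det (matrix A)\<bar>"
    using orthogonal_transformation_det[OF R(1)] orthogonal_transformation_det[OF R'(1)]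
    unfolding C_def
    by (simp add: matrix_compose A linR linear_compose det_mul abs_mult)
  have Cn: "norm (C x) \<le> N * norm x" for x
    using onorm[OF bl, of "R x"] R R' by (simp add: C_def N_def orthogonal_transformation_norm)
  define D where "D s = (\<lambda>y::real^'n. \<chi> i. (if i = k then s else 1) * y $ i)" for s :: real
  have D: "linear (D s)" for s
    by (auto simp: D_def vec_eq_iff algebra_simps intro!: linearI)
  have detD: "det (matrix (D s)) = s" for s
  proof -
    have ent: "matrix (D s) $ i $ j = (if i = j then (if i = k then s else 1) else 0)" for i j
      by (auto simp: matrix_def D_def axis_def)
    show ?thesis
      by (subst det_diagonal) (auto simp: ent prod.delta)
  qed
  text \<open>Scale the \<open>e\<close>-coordinate by \<open>t\<close> in the domain and by \<open>s\<close> in the range, where \<open>s * t * a = N\<close>: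
    the determinant is multiplied by \<open>N / a\<close>, while the norm stays below \<open>N * (1 + s)\<close>.\<close>
  have bound: "(N / a) * \<bar>det (matrix A)\<bar> \<le> (N * (1 + s)) ^ CARD('n)" if s: "s > 0" for s
  proof -
    define t where "t = N / (s * a)"
    define M where "M = D s \<circ> C \<circ> D t"
    have M: "linear M" unfolding M_def using C D by (intro linear_compose)
    have "\<bar>det (matrix M)\<bar> = s * \<bar>det (matrix A)\<bar> * t"
      using s a N detC unfolding M_def
      by (simp add: matrix_compose C D linear_compose det_mul abs_mult detD t_def)
    also have "\<dots> = (N / a) * \<bar>det (matrix A)\<bar>" using s by (simp add: t_def)
    finally have dM: "\<bar>det (matrix M)\<bar> = (N / a) * \<bar>det (matrix A)\<bar>" .
    have "norm (M x) \<le> N * (1 + s) * norm x" for x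
    proof -
      define x' where "x' = x - (x $ k) *\<^sub>R e"
      define y where "y = C x'"
      define z where "z = y - (y $ k) *\<^sub>R e"
      have orth: "orthogonal e z" "orthogonal e x'"
        by (simp_all add: orthogonal_def ek z_def x'_def) (simp_all add: e_def)
      have "D t x = (t * x $ k) *\<^sub>R e + x'"
        by (auto simp: D_def x'_def e_def vec_eq_iff axis_def)
      then have "C (D t x) = (t * x $ k * a) *\<^sub>R e + y"
        by (simp add: linear_add[OF C] linear_scale[OF C] Ce y_def)
      then have "M x = (s * t * a * x $ k) *\<^sub>R e + z + (s * y $ k) *\<^sub>R e"
        by (auto simp: M_def D_def z_def e_def vec_eq_iff axis_def algebra_simps)
      also have "s * t * a = N" using s a by (simp add: t_def)
      \<comment> \<open>The bracket is an orthogonal sum of norm at most \<open>N * norm x\<close>;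
        what remains carries the factor \<open>s\<close> and disappears as \<open>s\<close> tends to
        0.\<close>
      finally have Mx: "M x = ((N * x $ k) *\<^sub>R e + z) + (s * y $ k) *\<^sub>R e" .
      have nz: "norm z \<le> norm y"
      proof -
        have "y = (y $ k) *\<^sub>R e + z" by (simp add: z_def)
        then have "(norm y)\<^sup>2 = (norm ((y $ k) *\<^sub>R e))\<^sup>2 + (norm z)\<^sup>2"
          using norm_add_Pythagorean[of "(y $ k) *\<^sub>R e" z] orth(1) by (simp add: orthogonal_def)
        then have "(norm z)\<^sup>2 \<le> (norm y)\<^sup>2" by simp
        then show ?thesis by (rule power2_le_imp_le) simp
      qed
      have xx: "(norm x)\<^sup>2 = (x $ k)\<^sup>2 + (norm x')\<^sup>2"
      proof -
        have "x = (x $ k) *\<^sub>R e + x'" by (simp add: x'_def)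
        then have "(norm x)\<^sup>2 = (norm ((x $ k) *\<^sub>R e))\<^sup>2 + (norm x')\<^sup>2"
          using norm_add_Pythagorean[of "(x $ k) *\<^sub>R e" x'] orth(2) by (simp add: orthogonal_def)
        then show ?thesis by (simp add: e)
      qed
      have yx: "norm y \<le> N * norm x'" using Cn by (simp add: y_def)
      have "(norm ((N * x $ k) *\<^sub>R e + z))\<^sup>2 = (N * x $ k)\<^sup>2 + (norm z)\<^sup>2"
        using norm_add_Pythagorean[of "(N * x $ k) *\<^sub>R e" z] orth(1)
        by (simp add: orthogonal_def e power_mult_distrib)
      also have "\<dots> \<le> (N * x $ k)\<^sup>2 + (N * norm x')\<^sup>2"
        using nz yx by (intro add_left_mono power_mono) auto
      also have "\<dots> = (N * norm x)\<^sup>2"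
        by (simp add: power_mult_distrib xx algebra_simps)
      finally have A1: "norm ((N * x $ k) *\<^sub>R e + z) \<le> N * norm x"
        by (rule power2_le_imp_le) (use N in simp)
      have "norm x' \<le> norm x"
        by (rule power2_le_imp_le) (use xx in auto)
      then have "\<bar>y $ k\<bar> \<le> N * norm x"
        using component_le_norm_cart[of y k] yx mult_left_mono[of "norm x'" "norm x" N] N by linarith
      then have "norm ((s * y $ k) *\<^sub>R e) \<le> s * (N * norm x)"
        using s by (simp add: e abs_mult)
      with A1 have "norm (M x) \<le> N * norm x + s * (N * norm x)"
        unfolding Mx by (meson add_mono norm_triangle_le)
      then show ?thesis by (simp add: algebra_simps)
    qed
    then have "onorm M \<le> N * (1 + s)" using N s by (intro onorm_bound) auto
    moreover have "0 \<le> onorm M" using M by (simp add: linear_conv_bounded_linear onorm_pos_le)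
    ultimately have "onorm M ^ CARD('n) \<le> (N * (1 + s)) ^ CARD('n)" by (rule power_mono)
    then show ?thesis using abs_det_le_onorm_power[OF M] dM by simp
  qed
  have "(N / a) * \<bar>det (matrix A)\<bar> \<le> (N * (1 + 0)) ^ CARD('n)"
  proof (rule tendsto_lowerbound)
    show "((\<lambda>s. (N * (1 + s)) ^ CARD('n)) \<longlongrightarrow> (N * (1 + 0)) ^ CARD('n)) (at_right 0)"
      by (intro tendsto_intros)
    show "\<forall>\<^sub>F s in at_right 0. (N / a) * \<bar>det (matrix A)\<bar> \<le> (N * (1 + s)) ^ CARD('n)"
      using bound eventually_at_right_less by (rule eventually_mono[rotated])
  qed simp
  also have "(N * (1 + 0)) ^ CARD('n) = N * N ^ (CARD('n) - 1)"
    by (simp flip: power_Suc)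
  finally have "\<bar>det (matrix A)\<bar> \<le> a * N ^ (CARD('n) - 1)"
    using a N by (simp add: field_simps)
  then show ?thesis by (simp add: a_def N_def)
qed

text \<open>The classical inequality between inner and outer dilatation, with \<open>B\<close> the
  inverse of \<open>A\<close> and \<open>J\<close> the absolute determinant. For
  \<open>h = B y / norm (B y)\<close> one has \<open>norm (A h) = norm y / norm (B y)\<close>, so
  the preceding lemma bounds \<open>onorm B\<close> by \<open>onorm A ^ (n - 1) / J\<close>. The
  n-th power of this, multiplied by \<open>J\<close>, is the claim.\<close>

lemma inner_dilatation_le_outer:
  fixes A B :: "real ^ 'n \<Rightarrow> real ^ 'n"
  assumes A: "linear A" and B: "linear B" and AB: "\<And>y. A (B y) = y"
    and J: "det (matrix A) \<noteq> 0"
  shows "onorm B ^ CARD('n) * \<bar>det (matrix A)\<bar>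
           \<le> (onorm A ^ CARD('n) / \<bar>det (matrix A)\<bar>) ^ (CARD('n) - 1)"
proof -
  define N J where "N = onorm A" and "J = \<bar>det (matrix A)\<bar>"
  define n where "n = CARD('n)"
  have n: "n > 0" by (simp add: n_def)
  have J: "J > 0" using J by (simp add: J_def)
  have N: "N \<ge> 0" using A by (simp add: N_def linear_conv_bounded_linear onorm_pos_le)
  have "norm (B y) \<le> (N ^ (n - 1) / J) * norm y" for y
  proof (cases "B y = 0")
    case False
    define h where "h = (1 / norm (B y)) *\<^sub>R B y"
    have "J \<le> norm (A h) * N ^ (n - 1)"
      using abs_det_le_norm_times_onorm_power[OF A, of h] False by (simp add: h_def J_def N_def n_def)
    also have "A h = (1 / norm (B y)) *\<^sub>R y"
      by (simp add: h_def linear_scale[OF A] AB)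
    finally show ?thesis using False J by (simp add: field_simps)
  qed (use N J in simp)
  then have oB: "onorm B \<le> N ^ (n - 1) / J"
    using N J by (intro onorm_bound) auto
  have "0 \<le> onorm B" using B by (simp add: linear_conv_bounded_linear onorm_pos_le)
  with oB have "onorm B ^ n \<le> (N ^ (n - 1) / J) ^ n" by (rule power_mono)
  then have "onorm B ^ n * J \<le> (N ^ (n - 1) / J) ^ n * J" using J by (intro mult_right_mono) auto
  also have "\<dots> = (N ^ (n - 1)) ^ n / J ^ (n - 1)"
    using J n by (cases n) (simp_all add: power_divide)
  also have "\<dots> = (N ^ n / J) ^ (n - 1)"
    by (simp add: power_divide power_mult[symmetric] mult.commute)
  finally show ?thesis by (simp add: N_def J_def n_def)
qed

section \<open>Arc length and line integrals\<close>

text \<open>A form of the polygonal sum in \<open>curve_length\<close> that supports induction on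
  the partition.\<close>

fun chord_sum :: "(real \<Rightarrow> real ^ 'n) \<Rightarrow> real list \<Rightarrow> ennreal" where
  "chord_sum \<gamma> (x # y # zs) = ennreal (dist (\<gamma> x) (\<gamma> y)) + chord_sum \<gamma> (y # zs)"
| "chord_sum \<gamma> _ = 0"

lemma chord_sum_eq:
  "chord_sum \<gamma> ts = (\<Sum>i<length ts - 1. ennreal (dist (\<gamma> (ts ! i)) (\<gamma> (ts ! Suc i))))"
proof (induction \<gamma> ts rule: chord_sum.induct)
  case (1 \<gamma> x y zs)
  then show ?case by (simp add: sum.lessThan_Suc_shift del: sum.lessThan_Suc)
qed auto

lemma curve_length_eq:
  "curve_length \<gamma> a b = (SUP ts\<in>{ts. sorted ts \<and> set ts \<subseteq> {a..b}}. chord_sum \<gamma> ts)"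
  by (simp add: curve_length_def chord_sum_eq)

lemma chord_sum_le_curve_length:
  "sorted ts \<Longrightarrow> set ts \<subseteq> {a..b} \<Longrightarrow> chord_sum \<gamma> ts \<le> curve_length \<gamma> a b"
  unfolding curve_length_eq by (rule SUP_upper) simp

lemma curve_length_least:
  "(\<And>ts. sorted ts \<Longrightarrow> set ts \<subseteq> {a..b} \<Longrightarrow> chord_sum \<gamma> ts \<le> C) \<Longrightarrow> curve_length \<gamma> a b \<le> C"
  unfolding curve_length_eq by (rule SUP_least) simp

lemma dist_le_curve_length:
  "a \<le> s \<Longrightarrow> s \<le> t \<Longrightarrow> t \<le> b \<Longrightarrow> ennreal (dist (\<gamma> s) (\<gamma> t)) \<le> curve_length \<gamma> a b"
  using chord_sum_le_curve_length[of "[s, t]" a b \<gamma>] by simp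

lemma chord_sum_append_le: "chord_sum \<gamma> ts + chord_sum \<gamma> us \<le> chord_sum \<gamma> (ts @ us)"
proof (induction \<gamma> ts rule: chord_sum.induct)
  case (1 \<gamma> x y zs)
  then show ?case by (simp add: add.assoc add_left_mono)
next
  case ("2_2" \<gamma> v)
  then show ?case by (cases us) simp_all
qed simp

lemma chord_sum_Cons_le: "chord_sum \<gamma> (x # us) \<le> ennreal (dist (\<gamma> x) (\<gamma> y)) + chord_sum \<gamma> (y # us)"
proof (cases us)
  case (Cons z zs)
  have "ennreal (dist (\<gamma> x) (\<gamma> z)) \<le> ennreal (dist (\<gamma> x) (\<gamma> y)) + ennreal (dist (\<gamma> y) (\<gamma> z))"
    by (simp flip: ennreal_plus add: dist_triangle)
  then show ?thesis by (simp add: Cons add_right_mono flip: add.assoc)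
qed simp

lemma chord_sum_insert_le: "chord_sum \<gamma> (ts @ us) \<le> chord_sum \<gamma> (ts @ [b]) + chord_sum \<gamma> (b # us)"
proof (induction \<gamma> ts rule: chord_sum.induct)
  case (1 \<gamma> x y zs)
  then show ?case by (simp add: add.assoc add_left_mono)
next
  case ("2_1" \<gamma>)
  then show ?case by (cases us) simp_all
next
  case ("2_2" \<gamma> v)
  then show ?case using chord_sum_Cons_le[of \<gamma> v us b] by simp
qed

lemma sorted_filter_append:
  fixes p :: "'a :: linorder"
  shows "sorted ts \<Longrightarrow> filter (\<lambda>x. x \<le> p) ts @ filter (\<lambda>x. p < x) ts = ts"
proof (induction ts)
  case (Cons a ts)
  show ?case
  proof (cases "a \<le> p")
    case False
    then have "filter (\<lambda>x. x \<le> p) ts = []" "filter (\<lambda>x. p < x) ts = ts"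
      using Cons.prems by (auto simp: filter_empty_conv filter_id_conv)
    with False show ?thesis by simp
  qed (use Cons in simp)
qed simp

lemma curve_length_add_le:
  assumes "a \<le> b" "b \<le> c"
  shows "curve_length \<gamma> a b + curve_length \<gamma> b c \<le> curve_length \<gamma> a c"
proof -
  have ne: "{ts. sorted ts \<and> set ts \<subseteq> {x..y}} \<noteq> {}" for x y :: real
    by (rule ccontr) (auto dest: spec[of _ "[]"])
  have *: "chord_sum \<gamma> ts + curve_length \<gamma> b c \<le> curve_length \<gamma> a c"
    if ts: "sorted ts" "set ts \<subseteq> {a..b}" for ts
  proof -
    have "chord_sum \<gamma> ts + chord_sum \<gamma> us \<le> curve_length \<gamma> a c"
      if us: "sorted us" "set us \<subseteq> {b..c}" for us
    proof -
      have "sorted (ts @ us)" using ts us by (force simp: sorted_append)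
      moreover have "set (ts @ us) \<subseteq> {a..c}" using ts us assms by fastforce
      ultimately show ?thesis
        using order_trans[OF chord_sum_append_le chord_sum_le_curve_length] by blast
    qed
    then have "(SUP us\<in>{us. sorted us \<and> set us \<subseteq> {b..c}}. chord_sum \<gamma> ts + chord_sum \<gamma> us) \<le> curve_length \<gamma> a c"
      by (intro SUP_least) auto
    then show ?thesis
      unfolding curve_length_eq[of \<gamma> b c] ennreal_SUP_add_right[OF ne] by simp
  qed
  have "(SUP ts\<in>{ts. sorted ts \<and> set ts \<subseteq> {a..b}}. chord_sum \<gamma> ts + curve_length \<gamma> b c) \<le> curve_length \<gamma> a c"
    using * by (intro SUP_least) auto
  then show ?thesis
    unfolding curve_length_eq[of \<gamma> a b] ennreal_SUP_add_left[OF ne] by simp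
qed

text \<open>A partition without points strictly between \<open>p\<close> and \<open>q\<close> spends
  at most one chord on that stretch, as seen by inserting both points. The case \<open>p = q\<close>
  gives subadditivity of arc length, the general case its continuity.\<close>

lemma chord_sum_le_gap:
  assumes ts: "sorted ts" "set ts \<subseteq> {a..b}" and pq: "a \<le> p" "p \<le> q" "q \<le> b"
    and gap: "\<And>t. t \<in> set ts \<Longrightarrow> t \<le> p \<or> q \<le> t"
  shows "chord_sum \<gamma> ts \<le> curve_length \<gamma> a p + ennreal (dist (\<gamma> p) (\<gamma> q)) + curve_length \<gamma> q b"
proof -
  define us vs where "us = filter (\<lambda>x. x \<le> p) ts" and "vs = filter (\<lambda>x. p < x) ts"
  have "chord_sum \<gamma> ts = chord_sum \<gamma> (us @ vs)"
    using ts(1) by (simp add: us_def vs_def sorted_filter_append)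
  also have "\<dots> \<le> chord_sum \<gamma> (us @ [p]) + chord_sum \<gamma> (p # vs)" by (rule chord_sum_insert_le)
  also have "\<dots> \<le> chord_sum \<gamma> (us @ [p]) + (ennreal (dist (\<gamma> p) (\<gamma> q)) + chord_sum \<gamma> (q # vs))"
    by (intro add_left_mono chord_sum_Cons_le)
  also have "\<dots> \<le> curve_length \<gamma> a p + (ennreal (dist (\<gamma> p) (\<gamma> q)) + curve_length \<gamma> q b)"
  proof (intro add_mono order_refl chord_sum_le_curve_length)
    show "sorted (us @ [p])" "set (us @ [p]) \<subseteq> {a..p}"
      using ts pq by (auto simp: us_def sorted_append sorted_wrt_filter)
    show "sorted (q # vs)" "set (q # vs) \<subseteq> {q..b}"
      using ts pq gap by (fastforce simp: vs_def sorted_wrt_filter)+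
  qed
  finally show ?thesis by (simp add: add.assoc)
qed

section \<open>Continuity of arc length and parametrisation by arc length\<close>

context
  fixes \<gamma> :: "real \<Rightarrow> real ^ 'n"
  assumes path: "path \<gamma>" and rect: "curve_length \<gamma> 0 1 < \<infinity>"
begin

lemma curve_length_finite:
  assumes "0 \<le> a" "b \<le> 1"
  shows "curve_length \<gamma> a b < \<infinity>"
proof -
  have "curve_length \<gamma> a b \<le> curve_length \<gamma> 0 1"
    using assms by (intro curve_length_least chord_sum_le_curve_length) auto
  with rect show ?thesis by order
qed

text \<open>A partition whose polygon comes within \<open>e / 2\<close> of the full length has no
  points strictly between \<open>x\<close> and a nearby \<open>t\<close>. It counts at most one
  chord there, which is short by continuity of \<open>\<gamma>\<close>, so the arc can exceed that
  chord by no more than \<open>e / 2\<close>.\<close>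

lemma curve_length_small:
  assumes x: "x \<in> {0..1}" and e: "e > 0"
  shows "\<exists>d>0. \<forall>t\<in>{0..1}. \<bar>t - x\<bar> < d \<longrightarrow> curve_length \<gamma> (min x t) (max x t) \<le> ennreal e"
proof -
  \<comment> \<open>A length of 0 admits no strictly smaller value; the empty partition then
    serves.\<close>
  have "curve_length \<gamma> 0 1 - ennreal (e / 2) < curve_length \<gamma> 0 1 \<or> curve_length \<gamma> 0 1 = 0"
    using rect e ennreal_between[of "ennreal (e / 2)" "curve_length \<gamma> 0 1"]
    by (cases "curve_length \<gamma> 0 1 = 0") (auto simp: zero_less_iff_neq_zero)
  then obtain ts where ts: "sorted ts" "set ts \<subseteq> {0..1}" and V: "curve_length \<gamma> 0 1 \<le> chord_sum \<gamma> ts + ennreal (e/2)"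
  proof
    assume "curve_length \<gamma> 0 1 - ennreal (e / 2) < curve_length \<gamma> 0 1"
    then obtain ts where "sorted ts" "set ts \<subseteq> {0..1}" "curve_length \<gamma> 0 1 - ennreal (e / 2) < chord_sum \<gamma> ts"
      unfolding curve_length_eq less_SUP_iff by auto
    then have "curve_length \<gamma> 0 1 - ennreal (e / 2) \<le> chord_sum \<gamma> ts" by simp
    then have "curve_length \<gamma> 0 1 \<le> chord_sum \<gamma> ts + ennreal (e / 2)"
      by (simp add: ennreal_minus_le_iff add.commute)
    then show ?thesis using that[of ts] \<open>sorted ts\<close> \<open>set ts \<subseteq> {0..1}\<close> by simp
  next
    assume "curve_length \<gamma> 0 1 = 0"
    then show ?thesis using that[of "[]"] by simp
  qed
  have "continuous_on {0..1} \<gamma>" using path by (simp add: path_def)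
  then obtain d1 where d1: "d1 > 0" "\<And>t. t \<in> {0..1} \<Longrightarrow> dist t x < d1 \<Longrightarrow> dist (\<gamma> t) (\<gamma> x) < e / 2"
    using x e unfolding continuous_on_iff by (metis half_gt_zero)
  obtain d2 where d2: "d2 > 0" "\<And>t. t \<in> set ts \<Longrightarrow> t \<noteq> x \<Longrightarrow> d2 \<le> dist x t"
    using finite_set_avoid[of "set ts" x] by auto
  show ?thesis
  proof (intro exI[of _ "min d1 d2"] conjI ballI impI)
    show "min d1 d2 > 0" using d1 d2 by simp
    fix t :: real assume t: "t \<in> {0..1}" "\<bar>t - x\<bar> < min d1 d2"
    define p q where "p = min x t" and "q = max x t"
    have pq: "0 \<le> p" "p \<le> q" "q \<le> 1" using x t by (auto simp: p_def q_def)
    have gap: "u \<le> p \<or> q \<le> u" if "u \<in> set ts" for u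
      using d2(2)[OF that] t(2) unfolding p_def q_def dist_real_def 
        by (cases "u = x") (auto simp: min_def max_def abs_if split: if_splits)
    have "dist (\<gamma> t) (\<gamma> x) < e / 2" using d1(2)[OF t(1)] t(2) by (simp add: dist_real_def)
    then have dd: "dist (\<gamma> p) (\<gamma> q) \<le> e / 2"
      by (auto simp: p_def q_def min_def max_def dist_commute)
    have fin: "curve_length \<gamma> 0 p < \<infinity>" "curve_length \<gamma> q 1 < \<infinity>"
      using pq curve_length_finite[of 0 p] curve_length_finite[of q 1] by auto
    have "curve_length \<gamma> 0 p + curve_length \<gamma> p q + curve_length \<gamma> q 1 \<le> curve_length \<gamma> 0 1"
      using curve_length_add_le[of 0 p q \<gamma>] curve_length_add_le[of 0 q 1 \<gamma>] pq
      by (meson add_right_mono order_trans)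
    also have "\<dots> \<le> (curve_length \<gamma> 0 p + ennreal (dist (\<gamma> p) (\<gamma> q)) + curve_length \<gamma> q 1) + ennreal (e / 2)"
      using chord_sum_le_gap[OF ts pq gap] V by (meson add_right_mono order_trans)
    finally have "(curve_length \<gamma> 0 p + curve_length \<gamma> q 1) + curve_length \<gamma> p q
        \<le> (curve_length \<gamma> 0 p + curve_length \<gamma> q 1) + (ennreal (dist (\<gamma> p) (\<gamma> q)) + ennreal (e / 2))"
      by (simp add: ac_simps)
    then have "curve_length \<gamma> p q \<le> ennreal (dist (\<gamma> p) (\<gamma> q)) + ennreal (e / 2)"
      using fin by (subst (asm) ennreal_add_left_cancel_le) auto
    also have "\<dots> \<le> ennreal e"
      using dd e by (simp flip: ennreal_plus)
    finally show "curve_length \<gamma> (min x t) (max x t) \<le> ennreal e" by (simp add: p_def q_def)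
  qed
qed

lemma curve_length_split:
  assumes "0 \<le> a" "a \<le> b" "b \<le> c" "c \<le> 1"
  shows "curve_length \<gamma> a c = curve_length \<gamma> a b + curve_length \<gamma> b c"
proof (rule antisym)
  show "curve_length \<gamma> a c \<le> curve_length \<gamma> a b + curve_length \<gamma> b c"
  proof (rule curve_length_least)
    fix ts assume "sorted ts" "set ts \<subseteq> {a..c}"
    then show "chord_sum \<gamma> ts \<le> curve_length \<gamma> a b + curve_length \<gamma> b c"
      using chord_sum_le_gap[of ts a c b b \<gamma>] assms by (simp add: linear)
  qed
qed (use assms in \<open>auto intro: curve_length_add_le\<close>)

text \<open>The arc length measured from 0 is continuous, with values 0 and the full length at the
  two ends. The intermediate value theorem therefore makes the choice in
  \<open>arclength_param\<close> well founded.\<close>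

lemma arclength_param_exists:
  assumes s: "0 \<le> s" "ennreal s \<le> curve_length \<gamma> 0 1"
  obtains t where "t \<in> {0..1}" "curve_length \<gamma> 0 t = ennreal s" "arclength_param \<gamma> s = \<gamma> t"
proof -
  define L where "L t = enn2real (curve_length \<gamma> 0 t)" for t
  have L: "curve_length \<gamma> 0 t = ennreal (L t)" if "t \<in> {0..1}" for t
    using curve_length_finite[of 0 t] that by (simp add: L_def less_top)
  have L0: "L 0 = 0"
  proof -
    have "chord_sum \<gamma> ts \<le> 0" if "set ts \<subseteq> {0}" for ts
      using that by (induction \<gamma> ts rule: chord_sum.induct) auto
    then have "curve_length \<gamma> 0 0 \<le> 0" by (intro curve_length_least) auto
    then show ?thesis by (simp add: L_def)
  qed
  have "continuous_on {0..1} L"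
    unfolding continuous_on_iff
  proof (intro ballI allI impI)
    fix x e :: real assume x: "x \<in> {0..1}" and e: "0 < e"
    obtain d where d: "d > 0" and
      dd: "\<And>t. t\<in>{0..1} \<Longrightarrow> \<bar>t - x\<bar> < d \<Longrightarrow> curve_length \<gamma> (min x t) (max x t) \<le> ennreal (e/2)"
      using curve_length_small[OF x, of "e/2"] e by auto
    have "dist (L t) (L x) < e" if t: "t \<in> {0..1}" "dist t x < d" for t
    proof -
      define p q where "p = min x t" and "q = max x t"
      have pq: "0 \<le> p" "p \<le> q" "q \<le> 1" using x t by (auto simp: p_def q_def)
      have "curve_length \<gamma> p q \<le> ennreal (e / 2)"
        using dd[OF t(1)] t(2) by (simp add: p_def q_def dist_real_def)
      then have "ennreal (L q) \<le> ennreal (L p) + ennreal (e / 2)"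
        using curve_length_split[of 0 p q] pq L[of p] L[of q] by (simp add: add_left_mono)
      then have "ennreal (L q) \<le> ennreal (L p + e / 2)" using e by (simp add: L_def)
      then have "L q \<le> L p + e / 2"
        using e by (subst (asm) ennreal_le_iff) (auto simp: L_def)
      moreover have "L p \<le> L q"
      proof -
        have "ennreal (L p) \<le> ennreal (L q)"
          using curve_length_split[of 0 p q] pq L[of p] L[of q] by simp
        then show ?thesis by (simp add: L_def)
      qed
      ultimately show ?thesis
        using e by (auto simp: p_def q_def dist_real_def min_def max_def split: if_splits)
    qed
    with d show "\<exists>d>0. \<forall>x'\<in>{0..1}. dist x' x < d \<longrightarrow> dist (L x') (L x) < e" by auto
  qed
  moreover have "s \<le> L 1"
  proof -
    have "ennreal s \<le> ennreal (L 1)" using s(2) L[of 1] by simp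
    then show ?thesis by (subst (asm) ennreal_le_iff) (simp_all add: L_def)
  qed
  ultimately obtain t where t: "0 \<le> t" "t \<le> 1" "L t = s"
    using IVT'[of L 0 s 1] L0 s by auto
  then have "\<exists>t. t \<in> {0..1} \<and> curve_length \<gamma> 0 t = ennreal s" using L[of t] by auto
  then have "let t = (SOME t. t \<in> {0..1} \<and> curve_length \<gamma> 0 t = ennreal s)
      in t \<in> {0..1} \<and> curve_length \<gamma> 0 t = ennreal s"
    unfolding Let_def by (rule someI_ex)
  then show ?thesis
    using that[of "SOME t. t \<in> {0..1} \<and> curve_length \<gamma> 0 t = ennreal s"]
    by (simp add: Let_def arclength_param_def)
qed

text \<open>For \<open>s1 = s2\<close> the two points coincide: parameters of equal arc length have
  the same image. This identifies the end point in \<open>arclength_param_length\<close>.\<close>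

lemma dist_le_curve_length_diff:
  assumes t: "0 \<le> t1" "t1 \<le> t2" "t2 \<le> 1"
    and L: "curve_length \<gamma> 0 t1 = ennreal s1" "curve_length \<gamma> 0 t2 = ennreal s2" "0 \<le> s1" "0 \<le> s2"
  shows "s1 \<le> s2" "dist (\<gamma> t1) (\<gamma> t2) \<le> s2 - s1"
proof -
  have "ennreal s1 + ennreal (dist (\<gamma> t1) (\<gamma> t2)) \<le> ennreal s2"
    using curve_length_split[of 0 t1 t2] dist_le_curve_length[of t1 t1 t2 t2 \<gamma>] t L
    by (simp add: add_left_mono)
  then have "ennreal (s1 + dist (\<gamma> t1) (\<gamma> t2)) \<le> ennreal s2"
    using L by simp
  then have "s1 + dist (\<gamma> t1) (\<gamma> t2) \<le> s2"
    using L by (subst (asm) ennreal_le_iff) auto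
  then show "s1 \<le> s2" "dist (\<gamma> t1) (\<gamma> t2) \<le> s2 - s1"
    using zero_le_dist[of "\<gamma> t1" "\<gamma> t2"] by linarith+
qed

lemma arclength_param_lipschitz:
  assumes s: "0 \<le> s" "0 \<le> s'" "ennreal s \<le> curve_length \<gamma> 0 1" "ennreal s' \<le> curve_length \<gamma> 0 1"
  shows "dist (arclength_param \<gamma> s) (arclength_param \<gamma> s') \<le> \<bar>s - s'\<bar>"
proof -
  obtain t where t: "t \<in> {0..1}" "curve_length \<gamma> 0 t = ennreal s" "arclength_param \<gamma> s = \<gamma> t"
    using arclength_param_exists[OF s(1,3)] by blast
  obtain t' where t': "t' \<in> {0..1}" "curve_length \<gamma> 0 t' = ennreal s'" "arclength_param \<gamma> s' = \<gamma> t'"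
    using arclength_param_exists[OF s(2,4)] by blast
  show ?thesis
    using dist_le_curve_length_diff[of t t' s s'] dist_le_curve_length_diff[of t' t s' s] t t' s
    by (cases "t \<le> t'") (auto simp: dist_commute abs_if)
qed

lemma arclength_param_0: "arclength_param \<gamma> 0 = \<gamma> 0"
proof -
  obtain t where t: "t \<in> {0..1}" "curve_length \<gamma> 0 t = ennreal 0" "arclength_param \<gamma> 0 = \<gamma> t"
    using arclength_param_exists[of 0] by auto
  then have "ennreal (dist (\<gamma> 0) (\<gamma> t)) \<le> 0"
    using dist_le_curve_length[of 0 0 t t \<gamma>] by simp
  with t show ?thesis by simp
qed

lemma arclength_param_length: "arclength_param \<gamma> (enn2real (curve_length \<gamma> 0 1)) = \<gamma> 1"
proof -
  define l where "l = enn2real (curve_length \<gamma> 0 1)"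
  have l: "curve_length \<gamma> 0 1 = ennreal l" "0 \<le> l" using rect unfolding l_def by (simp_all add: less_top)
  obtain t where t: "t \<in> {0..1}" "curve_length \<gamma> 0 t = ennreal l" "arclength_param \<gamma> l = \<gamma> t"
    using arclength_param_exists[of l] l by auto
  then show ?thesis
    using dist_le_curve_length_diff(2)[of t 1 l l] l unfolding l_def[symmetric] by auto
qed

end

text \<open>A fine tagged division of a gauge integral turns the pointwise bound on the difference quotients
  into a bound for the total increment; no absolute continuity of \<open>u\<close> has to be established first.\<close>

lemma increment_le_integral:
  fixes u \<mu> :: "real \<Rightarrow> real"
  assumes ab: "a \<le> b" and int: "\<mu> integrable_on {a..b}"
    and bd: "\<And>s e. s \<in> {a..b} \<Longrightarrow> e > 0 \<Longrightarrow>
       \<exists>d>0. \<forall>t\<in>{a..b}. \<bar>t - s\<bar> < d \<longrightarrow> \<bar>u t - u s\<bar> \<le> (\<mu> s + e) * \<bar>t - s\<bar>"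
  shows "u b - u a \<le> integral {a..b} \<mu>"
proof (rule field_le_epsilon)
  fix \<epsilon> :: real assume \<epsilon>: "\<epsilon> > 0"
  \<comment> \<open>The summand 1 keeps the denominator positive when \<open>a = b\<close>.\<close>
  define e where "e = \<epsilon> / (2 * (b - a + 1))"
  have e: "e > 0" and eb: "e * (b - a) \<le> \<epsilon> / 2"
    using \<epsilon> ab by (auto simp: e_def field_simps)
  obtain d where d: "\<And>s. s \<in> {a..b} \<Longrightarrow> d s > 0"
    "\<And>s t. s \<in> {a..b} \<Longrightarrow> t \<in> {a..b} \<Longrightarrow> \<bar>t - s\<bar> < d s \<Longrightarrow> \<bar>u t - u s\<bar> \<le> (\<mu> s + e) * \<bar>t - s\<bar>"
    using bd[OF _ e] by metis
  have "(\<mu> has_integral integral {a..b} \<mu>) (cbox a b)" using int by (simp add: integrable_integral)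
  then obtain g where g: "gauge g"
    "\<And>p. p tagged_division_of cbox a b \<Longrightarrow> g fine p \<Longrightarrow>
      norm ((\<Sum>(x,k)\<in>p. measure lborel k *\<^sub>R \<mu> x) - integral {a..b} \<mu>) < \<epsilon> / 2"
    using \<epsilon> unfolding has_integral by (metis half_gt_zero)
  \<comment> \<open>All tags lie in \<open>{a..b}\<close>; elsewhere the radius 1 merely completes
    the gauge.\<close>
  define G where "G s = g s \<inter> ball s (if s \<in> {a..b} then d s else 1)" for s
  have "gauge G" unfolding G_def using d g(1) by (intro gauge_Int) (auto simp: gauge_def)
  then obtain p where p: "p tagged_division_of {a..b}" "G fine p"
    using fine_division_exists_real by blast
  have fin: "finite p" using p(1) by (rule tagged_division_of_finite)
  \<comment> \<open>The tag splits \<open>K\<close> in two, and the hypothesis bounds the increments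
    on both sides of it with the same factor \<open>\<mu> x + e\<close>.\<close>
  have each: "u (Sup K) - u (Inf K) \<le> measure lborel K * \<mu> x + e * measure lborel K" if xK: "(x, K) \<in> p" for x K
  proof -
    obtain \<alpha> \<beta> where K: "K = {\<alpha>..\<beta>}" "x \<in> K" "K \<subseteq> {a..b}"
      using tagged_division_ofD[OF p(1)] xK by (metis box_real(2))
    have "K \<subseteq> G x" using p(2) xK by (auto simp: fine_def)
    then have Kd: "K \<subseteq> ball x (d x)" using K by (auto simp: G_def)
    have x: "\<alpha> \<le> x" "x \<le> \<beta>" "x \<in> {a..b}" using K by auto
    have "\<bar>u \<beta> - u x\<bar> \<le> (\<mu> x + e) * \<bar>\<beta> - x\<bar>" "\<bar>u \<alpha> - u x\<bar> \<le> (\<mu> x + e) * \<bar>\<alpha> - x\<bar>"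
    proof -
      have "\<beta> \<in> ball x (d x)" "\<alpha> \<in> ball x (d x)" "\<beta> \<in> {a..b}" "\<alpha> \<in> {a..b}"
        using subsetD[OF Kd, of \<alpha>] subsetD[OF Kd, of \<beta>] K x by auto
      then show "\<bar>u \<beta> - u x\<bar> \<le> (\<mu> x + e) * \<bar>\<beta> - x\<bar>" "\<bar>u \<alpha> - u x\<bar> \<le> (\<mu> x + e) * \<bar>\<alpha> - x\<bar>"
        using d(2)[OF x(3), of \<beta>] d(2)[OF x(3), of \<alpha>] by (auto simp: dist_real_def abs_minus_commute)
    qed
    then have "u \<beta> - u \<alpha> \<le> (\<mu> x + e) * (\<beta> - x) + (\<mu> x + e) * (x - \<alpha>)"
      using x by auto
    then show ?thesis using x by (simp add: K algebra_simps)
  qed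
  have "u b - u a = (\<Sum>(x,K)\<in>p. u (Sup K) - u (Inf K))"
    using additive_tagged_division_1[OF ab p(1), of u] by simp
  also have "\<dots> \<le> (\<Sum>(x,K)\<in>p. measure lborel K * \<mu> x + e * measure lborel K)"
    using each by (intro sum_mono) auto
  also have "\<dots> = (\<Sum>(x,K)\<in>p. measure lborel K *\<^sub>R \<mu> x) + e * (\<Sum>(x,K)\<in>p. measure lborel K)"
    by (simp add: sum.distrib sum_distrib_left case_prod_unfold)
  also have "(\<Sum>(x,K)\<in>p. measure lborel K) = b - a"
    using additive_content_tagged_division[of p a b] p(1) ab by simp
  also have "(\<Sum>(x,K)\<in>p. measure lborel K *\<^sub>R \<mu> x) \<le> integral {a..b} \<mu> + \<epsilon> / 2"
  proof -
    have "g fine p" using p(2) by (force simp: G_def fine_def)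
    then have "\<bar>(\<Sum>(x,K)\<in>p. measure lborel K *\<^sub>R \<mu> x) - integral {a..b} \<mu>\<bar> < \<epsilon> / 2"
      using g(2)[of p] p(1) by simp
    then have "(\<Sum>(x,K)\<in>p. measure lborel K *\<^sub>R \<mu> x) - integral {a..b} \<mu> < \<epsilon> / 2"
      by (rule le_less_trans[OF abs_ge_self])
    then show ?thesis by linarith
  qed
  finally show "u b - u a \<le> integral {a..b} \<mu> + \<epsilon>" using eb by linarith
qed

text \<open>The parametrisation by arc length is 1-Lipschitz, so a bound \<open>\<rho>\<close> for
  the local slopes of \<open>v\<close> on the path also bounds the slopes of \<open>v\<close> along
  the parametrisation. When the line integral is infinite there is nothing to prove; when it is
  finite, the real integrand is integrable.\<close>

lemma line_integral_ge_increment: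
  fixes \<gamma> :: "real \<Rightarrow> real ^ 'n" and \<rho> :: "real ^ 'n \<Rightarrow> ennreal" and v :: "real ^ 'n \<Rightarrow> real"
  assumes path: "path \<gamma>" and \<rho>: "\<rho> \<in> borel_measurable borel"
    and fin: "\<And>y. y \<in> path_image \<gamma> \<Longrightarrow> \<rho> y < \<infinity>"
    and bd: "\<And>y e. y \<in> path_image \<gamma> \<Longrightarrow> e > 0 \<Longrightarrow>
       \<exists>d>0. \<forall>z\<in>path_image \<gamma>. norm (z - y) < d \<longrightarrow> \<bar>v z - v y\<bar> \<le> (enn2real (\<rho> y) + e) * norm (z - y)"
  shows "ennreal (v (pathfinish \<gamma>) - v (pathstart \<gamma>)) \<le> line_integral \<rho> \<gamma>"
proof (cases "line_integral \<rho> \<gamma> = \<infinity>")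
  case False
  then have rect: "curve_length \<gamma> 0 1 < \<infinity>" by (auto simp: line_integral_def split: if_splits)
  define l where "l = enn2real (curve_length \<gamma> 0 1)"
  have l: "curve_length \<gamma> 0 1 = ennreal l" "0 \<le> l" using rect by (auto simp: l_def less_top)
  define \<alpha> where "\<alpha> = arclength_param \<gamma>"
  have lip: "dist (\<alpha> s) (\<alpha> s') \<le> \<bar>s - s'\<bar>" if "s \<in> {0..l}" "s' \<in> {0..l}" for s s'
    using arclength_param_lipschitz[OF path rect, of s s'] that l by (simp add: \<alpha>_def ennreal_leI)
  have im: "\<alpha> s \<in> path_image \<gamma>" if s: "s \<in> {0..l}" for s
    using arclength_param_exists[OF path rect, of s] s l
    by (metis \<alpha>_def atLeastAtMost_iff ennreal_leI imageI path_image_def)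
  define \<mu> where "\<mu> s = enn2real (\<rho> (\<alpha> s))" for s
  have "continuous_on {0..l} \<alpha>"
    using lip unfolding continuous_on_iff by (metis dist_real_def dist_commute le_less_trans)
  then have "\<alpha> \<in> borel_measurable (restrict_space borel {0..l})"
    by (rule borel_measurable_continuous_on_restrict)
  then have "(\<lambda>s. \<rho> (\<alpha> s)) \<in> borel_measurable (restrict_space borel {0..l})"
    by (rule measurable_compose[OF _ \<rho>])
  then have lm: "\<mu> \<in> borel_measurable (restrict_space borel {0..l})"
    unfolding \<mu>_def by measurable
  then have lm': "(\<lambda>s. indicator {0..l} s *\<^sub>R \<mu> s) \<in> borel_measurable borel"
    by (subst (asm) borel_measurable_restrict_space_iff) auto
  have li: "line_integral \<rho> \<gamma> = (\<integral>\<^sup>+ s. ennreal (indicator {0..l} s *\<^sub>R \<mu> s) \<partial>lebesgue)"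
  proof -
    have "line_integral \<rho> \<gamma> = (\<integral>\<^sup>+ s\<in>{0..l}. \<rho> (\<alpha> s) \<partial>lebesgue)"
      using rect by (simp add: line_integral_def l_def \<alpha>_def)
    also have "\<dots> = (\<integral>\<^sup>+ s. ennreal (indicator {0..l} s *\<^sub>R \<mu> s) \<partial>lebesgue)"
    proof (rule nn_integral_cong)
      fix s
      have "s \<in> {0..l} \<Longrightarrow> \<rho> (\<alpha> s) = ennreal (\<mu> s)"
        using fin[OF im[of s]] by (simp add: \<mu>_def less_top)
      then show "\<rho> (\<alpha> s) * indicator {0..l} s = ennreal (indicator {0..l} s *\<^sub>R \<mu> s)"
        by (auto simp: indicator_def)
    qed
    finally show ?thesis .
  qed
  have nn: "0 \<le> indicator {0..l} s *\<^sub>R \<mu> s" for s by (simp add: \<mu>_def)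
  have "integrable lebesgue (\<lambda>s. indicator {0..l} s *\<^sub>R \<mu> s)"
  proof (rule integrableI_nonneg)
    show "(\<lambda>s. indicator {0..l} s *\<^sub>R \<mu> s) \<in> borel_measurable lebesgue"
      using lm' by (intro measurable_completion) simp
    show "(\<integral>\<^sup>+ s. ennreal (indicator {0..l} s *\<^sub>R \<mu> s) \<partial>lebesgue) < \<infinity>"
      using False li by (simp add: less_top)
  qed (use nn in simp)
  then have ai: "\<mu> absolutely_integrable_on {0..l}"
    by (simp add: set_integrable_def)
  have "v (\<alpha> l) - v (\<alpha> 0) \<le> integral {0..l} \<mu>"
  proof (rule increment_le_integral[where u = "\<lambda>s. v (\<alpha> s)"])
    show "\<mu> integrable_on {0..l}" using ai set_lebesgue_integral_eq_integral(1) by blast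
    fix s e :: real assume s: "s \<in> {0..l}" and e: "e > 0"
    obtain d where d: "d > 0" "\<And>z. z \<in> path_image \<gamma> \<Longrightarrow> norm (z - \<alpha> s) < d \<Longrightarrow>
        \<bar>v z - v (\<alpha> s)\<bar> \<le> (\<mu> s + e) * norm (z - \<alpha> s)"
      using bd[OF im[OF s] e] by (auto simp: \<mu>_def)
    show "\<exists>d>0. \<forall>t\<in>{0..l}. \<bar>t - s\<bar> < d \<longrightarrow> \<bar>v (\<alpha> t) - v (\<alpha> s)\<bar> \<le> (\<mu> s + e) * \<bar>t - s\<bar>"
    proof (intro exI conjI ballI impI, rule d(1))
      fix t assume t: "t \<in> {0..l}" "\<bar>t - s\<bar> < d"
      have n: "norm (\<alpha> t - \<alpha> s) \<le> \<bar>t - s\<bar>" using lip[OF t(1) s] by (simp add: dist_norm)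
      have "\<bar>v (\<alpha> t) - v (\<alpha> s)\<bar> \<le> (\<mu> s + e) * norm (\<alpha> t - \<alpha> s)"
        using n t im by (intro d(2)) auto
      also have "\<dots> \<le> (\<mu> s + e) * \<bar>t - s\<bar>"
        using n e by (intro mult_left_mono) (auto simp: \<mu>_def)
      finally show "\<bar>v (\<alpha> t) - v (\<alpha> s)\<bar> \<le> (\<mu> s + e) * \<bar>t - s\<bar>" .
    qed
  qed (use l in simp)
  then have "ennreal (v (\<gamma> 1) - v (\<gamma> 0)) \<le> ennreal (integral {0..l} \<mu>)"
    using arclength_param_0[OF path rect] arclength_param_length[OF path rect]
    by (simp add: \<alpha>_def l_def ennreal_leI)
  also have "ennreal (integral {0..l} \<mu>) = line_integral \<rho> \<gamma>"
    unfolding li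
    using ai nn set_lebesgue_integral_eq_integral(2)[OF ai]
    unfolding set_integrable_def set_lebesgue_integral_def
    by (subst nn_integral_eq_integral) auto
  finally show ?thesis by (simp add: pathfinish_def pathstart_def)
qed simp

section \<open>Pointwise stretch and measurability of derivatives\<close>

text \<open>On an open set this is the pointwise Lipschitz constant \<open>upper_stretch\<close>.
  Writing it as a countable infimum over scales displays its measurability, and values in
  \<open>ennreal\<close> fit into the densities.\<close>

definition stretch :: "(real ^ 'n) set \<Rightarrow> (real ^ 'n \<Rightarrow> real ^ 'n) \<Rightarrow> real ^ 'n \<Rightarrow> ennreal" where
  "stretch D f x = (INF m::nat. SUP z\<in>{z \<in> D. 0 < norm (z - x) \<and> norm (z - x) < 1 / (real m + 1)}.
      ennreal (norm (f z - f x) / norm (z - x)))"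

text \<open>For fixed \<open>z\<close> the quotient is continuous in \<open>x\<close> away from
  \<open>z\<close>. At a fixed scale a superlevel set of the supremum is thus a union of open sets,
  and there are only countably many scales.\<close>

lemma borel_measurable_stretch:
  assumes D: "open D" and f: "continuous_on D f"
  shows "(\<lambda>x. stretch D f x * indicator D x) \<in> borel_measurable borel"
proof -
  define U where "U m x = (SUP z\<in>{z \<in> D. 0 < norm (z - x) \<and> norm (z - x) < 1 / (real m + 1)}.
      ennreal (norm (f z - f x) / norm (z - x)))" for m :: nat and x
  have "(\<lambda>x. U m x * indicator D x) \<in> borel_measurable borel" for m
  proof (rule borel_measurableI_greater)
    fix y :: ennreal
    define W where "W z = (\<lambda>x. ennreal (norm (f z - f x) / norm (z - x))) -` {y<..} \<inter>
        (D \<inter> ball z (1 / (real m + 1)) - {z})" for z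
    have "open (W z)" for z
      unfolding W_def
    proof (subst Int_commute, rule continuous_open_preimage)
      show "continuous_on (D \<inter> ball z (1 / (real m + 1)) - {z}) (\<lambda>x. ennreal (norm (f z - f x) / norm (z - x)))"
      proof -
        have "continuous_on (D \<inter> ball z (1 / (real m + 1)) - {z}) f"
          by (rule continuous_on_subset[OF f]) auto
        then show ?thesis
          by (intro continuous_on_ennreal continuous_on_divide continuous_on_norm continuous_on_diff
              continuous_on_const continuous_on_id) auto
      qed
      show "open (D \<inter> ball z (1 / (real m + 1)) - {z})" using D by (intro open_Diff open_Int open_ball) simp_all
    qed simp
    then have "open (\<Union>z\<in>D. W z)" by auto
    moreover have "{x \<in> space borel. y < U m x * indicator D x} = (\<Union>z\<in>D. W z)"
      by (auto simp: U_def W_def less_SUP_iff indicator_def dist_norm split: if_splits)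
    ultimately show "{x \<in> space borel. y < U m x * indicator D x} \<in> sets borel" by simp
  qed
  then have "(\<lambda>x. INF m. U m x * indicator D x) \<in> borel_measurable borel"
    by (intro borel_measurable_INF) auto
  moreover have "(INF m. U m x * indicator D x) = stretch D f x * indicator D x" for x
    by (auto simp: stretch_def U_def indicator_def)
  ultimately show ?thesis by simp
qed

lemma stretch_lessD:
  assumes "stretch D f x < ennreal c"
  shows "\<exists>d>0. \<forall>z\<in>D. norm (z - x) < d \<longrightarrow> norm (f z - f x) \<le> c * norm (z - x)"
proof -
  obtain m :: nat where m: "(SUP z\<in>{z \<in> D. 0 < norm (z - x) \<and> norm (z - x) < 1 / (real m + 1)}.
      ennreal (norm (f z - f x) / norm (z - x))) < ennreal c"
    using assms unfolding stretch_def INF_less_iff by blast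
  show ?thesis
  proof (intro exI[of _ "1 / (real m + 1)"] conjI ballI impI)
    fix z assume z: "z \<in> D" "norm (z - x) < 1 / (real m + 1)"
    show "norm (f z - f x) \<le> c * norm (z - x)"
    proof (cases "z = x")
      case False
      then have "ennreal (norm (f z - f x) / norm (z - x)) < ennreal c"
        using SUP_lessD[OF m, of z] z by simp
      then have "norm (f z - f x) / norm (z - x) < c" by (simp add: ennreal_less_iff)
      with False show ?thesis by (simp add: field_simps)
    qed simp
  qed simp
qed

lemma stretch_le:
  assumes d: "d > 0" and "\<And>z. z \<in> D \<Longrightarrow> norm (z - x) < d \<Longrightarrow> norm (f z - f x) \<le> c * norm (z - x)"
  shows "stretch D f x \<le> ennreal c"
proof -
  obtain m :: nat where m: "1 / (real m + 1) < d"
    using d by (metis add.commute nat_approx_posE of_nat_Suc)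
  show ?thesis
    unfolding stretch_def
  proof (rule INF_lower2[of m], simp, rule SUP_least)
    fix z assume z: "z \<in> {z \<in> D. 0 < norm (z - x) \<and> norm (z - x) < 1 / (real m + 1)}"
    then have "norm (f z - f x) \<le> c * norm (z - x)" using m by (intro assms) auto
    with z show "ennreal (norm (f z - f x) / norm (z - x)) \<le> ennreal c"
      by (intro ennreal_leI) (simp add: field_simps)
  qed
qed

section \<open>Stretch and operator norm at a point of differentiability\<close>

lemma stretch_le_onorm:
  assumes "(f has_derivative A) (at x)"
  shows "stretch D f x \<le> ennreal (onorm A)"
proof (rule ennreal_le_epsilon)
  have A: "bounded_linear A" using assms by (rule has_derivative_bounded_linear)
  fix e :: real assume e: "0 < e"
  obtain d where d: "d > 0" "\<And>z. norm (z - x) < d \<Longrightarrow> norm (f z - f x - A (z - x)) \<le> e * norm (z - x)"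
    using assms e unfolding has_derivative_at_alt by blast
  have "stretch D f x \<le> ennreal (onorm A + e)"
  proof (rule stretch_le[OF d(1)])
    fix z assume z: "norm (z - x) < d"
    have "norm (f z - f x) \<le> norm (A (z - x)) + norm (f z - f x - A (z - x))"
      by (rule norm_triangle_sub)
    also have "\<dots> \<le> onorm A * norm (z - x) + e * norm (z - x)"
      using onorm[OF A] d(2)[OF z] by (intro add_mono)
    finally show "norm (f z - f x) \<le> (onorm A + e) * norm (z - x)" by (simp add: algebra_simps)
  qed
  also have "\<dots> = ennreal (onorm A) + ennreal e" using onorm_pos_le[OF A] e by simp
  finally show "stretch D f x \<le> ennreal (onorm A) + ennreal e" .
qed

lemma small_scale_in_open:
  fixes x h :: "'a :: real_normed_vector"
  assumes "open D" "x \<in> D" "d > 0"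
  obtains t :: real where "t > 0" "x + t *\<^sub>R h \<in> D" "norm (t *\<^sub>R h) < d"
proof -
  obtain e where e: "e > 0" "ball x e \<subseteq> D" using assms by (meson open_contains_ball)
  define t where "t = min d e / (norm h + 1)"
  have p: "norm h + 1 > 0" using norm_ge_zero[of h] by linarith
  then have t: "t > 0" using e assms by (simp add: t_def)
  have "norm (t *\<^sub>R h) = min d e * (norm h / (norm h + 1))" using e assms p by (simp add: t_def)
  also have "\<dots> < min d e * 1"
    using e assms p by (intro mult_strict_left_mono) (simp_all add: divide_less_eq)
  finally have "norm (t *\<^sub>R h) < min d e" by simp
  then show ?thesis using t e by (intro that[of t]) (auto simp: dist_norm)
qed

lemma onorm_le_stretch:
  assumes A: "(f has_derivative A) (at x)" and D: "open D" "x \<in> D"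
  shows "ennreal (onorm A) \<le> stretch D f x"
proof (rule ccontr)
  assume "\<not> ennreal (onorm A) \<le> stretch D f x"
  then have less: "stretch D f x < ennreal (onorm A)" by simp
  then obtain c where c: "stretch D f x < ennreal c" "ennreal c < ennreal (onorm A)" "0 \<le> c"
    by (metis dense ennreal_cases less_top_ennreal not_less_iff_gr_or_eq top.extremum_strict)
  have bl: "bounded_linear A" using A by (rule has_derivative_bounded_linear)
  obtain d where d: "d > 0" "\<And>z. z \<in> D \<Longrightarrow> norm (z - x) < d \<Longrightarrow> norm (f z - f x) \<le> c * norm (z - x)"
    using stretch_lessD[OF c(1)] by blast
  have "norm (A h) \<le> c * norm h" for h
  proof (rule field_le_epsilon)
    fix e :: real assume e: "e > 0"
    define e' where "e' = e / (norm h + 1)"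
    have p: "norm h + 1 > 0" using norm_ge_zero[of h] by linarith
    then have e': "e' > 0" using e by (simp add: e'_def)
    have "e' * norm h \<le> e' * (norm h + 1)" using e' by simp
    also have "\<dots> = e" using p by (simp add: e'_def)
    finally have e'': "e' * norm h \<le> e" .
    obtain d' where d': "d' > 0" "\<And>z. norm (z - x) < d' \<Longrightarrow> norm (f z - f x - A (z - x)) \<le> e' * norm (z - x)"
      using A e' unfolding has_derivative_at_alt by blast
    obtain t :: real where t: "t > 0" "x + t *\<^sub>R h \<in> D" "norm (t *\<^sub>R h) < min d d'"
      using small_scale_in_open[OF D, of "min d d'"] d d' by (metis min_less_iff_conj)
    have "norm (A (t *\<^sub>R h)) \<le> norm (f (x + t *\<^sub>R h) - f x) + norm (f (x + t *\<^sub>R h) - f x - A (t *\<^sub>R h))"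
      by (metis norm_minus_commute norm_triangle_sub)
    also have "\<dots> \<le> c * norm (t *\<^sub>R h) + e' * norm (t *\<^sub>R h)"
      using d(2)[OF t(2)] d'(2)[of "x + t *\<^sub>R h"] t by (intro add_mono) auto
    finally have "t * norm (A h) \<le> t * (c * norm h + e' * norm h)"
      using t by (simp add: linear_simps[OF bl] algebra_simps)
    then have "norm (A h) \<le> c * norm h + e' * norm h" using t by simp
    with e'' show "norm (A h) \<le> c * norm h + e" by linarith
  qed
  then have "onorm A \<le> c" using c by (intro onorm_bound) auto
  with c show False by (simp add: ennreal_less_iff)
qed

lemma stretch_eq_onorm:
  assumes "(f has_derivative A) (at x)" "open D" "x \<in> D"
  shows "stretch D f x = ennreal (onorm A)"
  using stretch_le_onorm onorm_le_stretch assms by (metis antisym)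

text \<open>Once the dense set is countable, this describes differentiability by countably many
  Borel conditions: matrices of that set approximate \<open>f\<close> with arbitrarily small slope
  of the error. For the converse, such matrices converge pointwise, and their limit is the
  derivative.\<close>

lemma differentiable_iff_stretch:
  fixes f :: "real ^ 'n \<Rightarrow> real ^ 'n" and \<A> :: "(real ^ 'n ^ 'n) set"
  assumes D: "open D" "x \<in> D" and dense: "closure \<A> = UNIV"
  shows "f differentiable (at x) \<longleftrightarrow>
    (\<forall>m::nat. \<exists>A\<in>\<A>. stretch D (\<lambda>y. f y - A *v y) x < ennreal (1 / (real m + 1)))"
proof
  assume "f differentiable (at x)"
  then obtain f' where f': "(f has_derivative f') (at x)" by (auto simp: differentiable_def)
  have lin: "linear f'" using has_derivative_linear[OF f'] .
  show "\<forall>m::nat. \<exists>A\<in>\<A>. stretch D (\<lambda>y. f y - A *v y) x < ennreal (1 / (real m + 1))"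
  proof
    fix m :: nat
    \<comment> \<open>The operator norm is at most \<open>N\<close> times a bound for the entries;
      the factor 2 in \<open>e\<close> leaves room for a strict inequality.\<close>
    define N where "N = real CARD('n) * real CARD('n)"
    define e where "e = 1 / (real m + 1) / (2 * N)"
    have N: "N > 0" by (simp add: N_def)
    have e: "e > 0" using N by (simp add: e_def)
    have "matrix f' \<in> closure \<A>" using dense by simp
    then obtain A where A: "A \<in> \<A>" "dist A (matrix f') < e"
      using e unfolding closure_approachable by blast
    have comp: "\<bar>(matrix f' - A) $ i $ j\<bar> \<le> e" for i j
    proof -
      have "\<bar>(matrix f' - A) $ i $ j\<bar> \<le> norm ((matrix f' - A) $ i)" by (rule component_le_norm_cart)
      also have "\<dots> \<le> norm (matrix f' - A)" by (rule Finite_Cartesian_Product.norm_nth_le)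
      finally show ?thesis using A by (simp add: dist_norm norm_minus_commute)
    qed
    have der: "((\<lambda>y. f y - A *v y) has_derivative (\<lambda>h. f' h - A *v h)) (at x)"
      by (intro has_derivative_diff f' bounded_linear_imp_has_derivative matrix_vector_mul_bounded_linear)
    have "(\<lambda>h. f' h - A *v h) = (*v) (matrix f' - A)"
      by (simp add: fun_eq_iff matrix_vector_mult_diff_rdistrib matrix_works[OF lin[folded linear_matrix_vector_mul_eq]])
    then have "onorm (\<lambda>h. f' h - A *v h) \<le> N * e"
      using onorm_le_matrix_component[OF comp] by (simp add: N_def)
    also have "N * e = 1 / (real m + 1) / 2" using N by (simp add: e_def)
    also have "\<dots> < 1 / (real m + 1)" proof -
      have "q / 2 < q" if "0 < q" for q :: real using that by simp
      from this[of "1 / (real m + 1)"] show ?thesis by simp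
    qed
    finally have "ennreal (onorm (\<lambda>h. f' h - A *v h)) < ennreal (1 / (real m + 1))"
      by (simp add: ennreal_lessI)
    then show "\<exists>A\<in>\<A>. stretch D (\<lambda>y. f y - A *v y) x < ennreal (1 / (real m + 1))"
      using stretch_le_onorm[OF der, of D] A(1) by (meson le_less_trans)
  qed
next
  assume "\<forall>m::nat. \<exists>A\<in>\<A>. stretch D (\<lambda>y. f y - A *v y) x < ennreal (1 / (real m + 1))"
  then obtain A where A: "\<And>m::nat. stretch D (\<lambda>y. f y - A m *v y) x < ennreal (1 / (real m + 1))"
    by metis
  have "\<exists>d>0. \<forall>z\<in>D. norm (z - x) < d \<longrightarrow>
      norm (f z - f x - A m *v (z - x)) \<le> 1 / (real m + 1) * norm (z - x)" for m
    using stretch_lessD[OF A[of m]] by (simp add: matrix_vector_mult_diff_distrib algebra_simps)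
  then obtain d where d: "\<And>m. d m > 0" "\<And>m z. z \<in> D \<Longrightarrow> norm (z - x) < d m \<Longrightarrow>
      norm (f z - f x - A m *v (z - x)) \<le> 1 / (real m + 1) * norm (z - x)"
    by metis
  \<comment> \<open>Both approximations are tested on one increment \<open>t *\<^sub>R h\<close>
    lying within the two radii; linearity then removes \<open>t\<close>.\<close>
  have close: "norm (A m *v h - A l *v h) \<le> (1 / (real m + 1) + 1 / (real l + 1)) * norm h" for m l h
  proof -
    obtain t :: real where t: "t > 0" "x + t *\<^sub>R h \<in> D" "norm (t *\<^sub>R h) < min (d m) (d l)"
      using small_scale_in_open[OF D, of "min (d m) (d l)"] d(1) by (metis min_less_iff_conj)
    have "norm (A m *v (t *\<^sub>R h) - A l *v (t *\<^sub>R h))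
        \<le> norm (f (x + t *\<^sub>R h) - f x - A l *v (t *\<^sub>R h)) + norm (f (x + t *\<^sub>R h) - f x - A m *v (t *\<^sub>R h))"
      by (rule order_trans[OF _ norm_triangle_ineq4]) simp
    also have "\<dots> \<le> 1 / (real l + 1) * norm (t *\<^sub>R h) + 1 / (real m + 1) * norm (t *\<^sub>R h)"
      using d(2)[OF t(2), of l] d(2)[OF t(2), of m] t(3) by (intro add_mono) auto
    also have "A m *v (t *\<^sub>R h) - A l *v (t *\<^sub>R h) = t *\<^sub>R (A m *v h - A l *v h)"
      by (simp add: matrix_vector_mult_scaleR scaleR_diff_right)
    finally have "t * norm (A m *v h - A l *v h) \<le> t * ((1 / (real m + 1) + 1 / (real l + 1)) * norm h)"
      unfolding norm_scaleR abs_of_pos[OF t(1)] by (simp add: algebra_simps)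
    then show ?thesis using t(1) by (simp only: mult_le_cancel_left_pos)
  qed
  have inv0: "(\<lambda>m. 1 / (real m + 1)) \<longlonglongrightarrow> 0"
    using LIMSEQ_inverse_real_of_nat by (simp add: inverse_eq_divide add.commute)
  have "convergent (\<lambda>m. A m *v h)" for h
  proof -
    have "Cauchy (\<lambda>m. A m *v h)"
    proof (rule metric_CauchyI)
      fix e :: real assume e: "e > 0"
      have "(\<lambda>m. 1 / (real m + 1) * (2 * norm h)) \<longlonglongrightarrow> 0 * (2 * norm h)"
        by (intro tendsto_mult inv0 tendsto_const)
      then obtain M where M: "\<And>m. m \<ge> M \<Longrightarrow> 1 / (real m + 1) * (2 * norm h) < e"
        using e order_tendstoD(2)[of _ "0 * (2 * norm h)" sequentially e]
        unfolding eventually_sequentially by auto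
      have "dist (A m *v h) (A l *v h) < e" if "m \<ge> M" "l \<ge> M" for m l
      proof -
        have "norm (A m *v h - A l *v h) \<le> 1 / (real m + 1) * norm h + 1 / (real l + 1) * norm h"
          using close[of m h l] by (simp only: distrib_right)
        moreover have "2 * (1 / (real m + 1) * norm h) < e" "2 * (1 / (real l + 1) * norm h) < e"
          using M[OF that(1)] M[OF that(2)] by (simp_all only: mult.left_commute)
        ultimately show ?thesis unfolding dist_norm by linarith
      qed
      then show "\<exists>M. \<forall>m\<ge>M. \<forall>n\<ge>M. dist (A m *v h) (A n *v h) < e" by blast
    qed
    then show ?thesis by (rule Cauchy_convergent)
  qed
  then obtain F where F: "\<And>h. (\<lambda>m. A m *v h) \<longlonglongrightarrow> F h"
    unfolding convergent_def by metis
  have linF: "linear F"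
  proof (rule linearI)
    fix h k :: "real ^ 'n" and c :: real
    have "(\<lambda>m. A m *v (h + k)) \<longlonglongrightarrow> F h + F k"
      using tendsto_add[OF F[of h] F[of k]] by (simp add: matrix_vector_right_distrib)
    then show "F (h + k) = F h + F k" using F LIMSEQ_unique by blast
    have "(\<lambda>m. A m *v (c *\<^sub>R h)) \<longlonglongrightarrow> c *\<^sub>R F h"
      using tendsto_scaleR[OF tendsto_const F[of h]] by (simp add: matrix_vector_mult_scaleR)
    then show "F (c *\<^sub>R h) = c *\<^sub>R F h" using F LIMSEQ_unique by blast
  qed
  have AF: "norm (A m *v h - F h) \<le> 1 / (real m + 1) * norm h" for m h
  proof (rule tendsto_le[OF _ _ _ always_eventually])
    show "(\<lambda>l. norm (A m *v h - A l *v h)) \<longlonglongrightarrow> norm (A m *v h - F h)"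
      by (intro tendsto_intros F)
    have "(\<lambda>l. (1 / (real m + 1) + 1 / (real l + 1)) * norm h) \<longlonglongrightarrow> (1 / (real m + 1) + 0) * norm h"
      by (intro tendsto_intros inv0)
    then show "(\<lambda>l. (1 / (real m + 1) + 1 / (real l + 1)) * norm h) \<longlonglongrightarrow> 1 / (real m + 1) * norm h"
      by simp
  qed (use close in auto)
  have "(f has_derivative F) (at x)"
    unfolding has_derivative_at_alt
  proof (intro conjI allI impI)
    show "bounded_linear F" using linF by (simp add: linear_conv_bounded_linear)
    fix e :: real assume e: "e > 0"
    obtain m :: nat where m: "1 / (real m + 1) < e / 2"
      using e by (metis add.commute half_gt_zero nat_approx_posE of_nat_Suc)
    obtain r where r: "r > 0" "ball x r \<subseteq> D" using D by (meson open_contains_ball)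
    show "\<exists>d>0. \<forall>y. norm (y - x) < d \<longrightarrow> norm (f y - f x - F (y - x)) \<le> e * norm (y - x)"
    proof (intro exI[of _ "min r (d m)"] conjI allI impI)
      show "min r (d m) > 0" using r d(1) by simp
      fix y assume y: "norm (y - x) < min r (d m)"
      then have "y \<in> D" using r by (auto simp: dist_norm norm_minus_commute)
      have "norm (f y - f x - F (y - x)) \<le> norm (f y - f x - A m *v (y - x)) + norm (A m *v (y - x) - F (y - x))"
      proof -
        have "f y - f x - F (y - x) = (f y - f x - A m *v (y - x)) + (A m *v (y - x) - F (y - x))"
          by simp
        then show ?thesis using norm_triangle_ineq by metis
      qed
      also have "\<dots> \<le> 1 / (real m + 1) * norm (y - x) + 1 / (real m + 1) * norm (y - x)"
        using d(2)[OF \<open>y \<in> D\<close>] AF y by (intro add_mono) auto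
      also have "\<dots> = (2 * (1 / (real m + 1))) * norm (y - x)" by simp
      also have "\<dots> \<le> e * norm (y - x)" using m by (intro mult_right_mono) auto
      finally show "norm (f y - f x - F (y - x)) \<le> e * norm (y - x)" .
    qed
  qed
  then show "f differentiable (at x)" by (auto simp: differentiable_def)
qed

lemma borel_differentiable_set:
  fixes f :: "real ^ 'n \<Rightarrow> real ^ 'n"
  assumes D: "open D" and f: "continuous_on D f"
  shows "{x \<in> D. f differentiable (at x)} \<in> sets borel"
proof -
  obtain \<A> :: "(real ^ 'n ^ 'n) set" where \<A>: "countable \<A>" "closure \<A> = UNIV"
  proof -
    obtain B :: "(real ^ 'n ^ 'n) set" where B: "countable B"
      "\<And>X. open X \<Longrightarrow> X \<noteq> {} \<Longrightarrow> \<exists>d\<in>B. d \<in> X"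
      using countable_dense_setE by blast
    have "x \<in> closure B" for x
      unfolding closure_approachable
    proof (intro allI impI)
      fix e :: real assume "e > 0"
      then have "\<exists>d\<in>B. d \<in> ball x e" by (intro B(2)) auto
      then show "\<exists>y\<in>B. dist y x < e" by (auto simp: dist_commute)
    qed
    then show ?thesis using that B(1) by blast
  qed
  have meas: "{x \<in> D. stretch D (\<lambda>y. f y - A *v y) x < ennreal c} \<in> sets borel" for A :: "real ^ 'n ^ 'n" and c
  proof -
    have "(\<lambda>x. stretch D (\<lambda>y. f y - A *v y) x * indicator D x) \<in> borel_measurable borel"
      by (intro borel_measurable_stretch D continuous_on_diff f
          linear_continuous_on matrix_vector_mul_bounded_linear)
    then have "{x \<in> space borel. stretch D (\<lambda>y. f y - A *v y) x * indicator D x < ennreal c} \<in> sets borel"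
      by measurable
    moreover have "{x \<in> D. stretch D (\<lambda>y. f y - A *v y) x < ennreal c}
        = D \<inter> {x \<in> space borel. stretch D (\<lambda>y. f y - A *v y) x * indicator D x < ennreal c}"
      by auto
    ultimately show ?thesis using D by auto
  qed
  have "{x \<in> D. f differentiable (at x)}
      = D \<inter> (\<Inter>m::nat. \<Union>A\<in>\<A>. {x \<in> D. stretch D (\<lambda>y. f y - A *v y) x < ennreal (1 / (real m + 1))})"
    using differentiable_iff_stretch[OF D _ \<A>(2)] by auto
  also have "\<dots> \<in> sets borel"
    using \<A>(1) meas D by (intro sets.Int sets.countable_INT sets.countable_UN') auto
  finally show ?thesis .
qed

text \<open>Each entry is a limit of difference quotients with increments \<open>1 / (m + 1)\<close>
  along an axis. Since \<open>f'\<close> is arbitrary off \<open>S\<close>, the indicator is carried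
  along in every entry.\<close>

lemma borel_measurable_Jacobian:
  fixes f :: "real ^ 'n \<Rightarrow> real ^ 'n"
  assumes D: "open D" and f: "continuous_on D f" and S: "S \<in> sets borel" "S \<subseteq> D"
    and der: "\<And>x. x \<in> S \<Longrightarrow> (f has_derivative f' x) (at x)"
  shows "(\<lambda>x. indicator S x * det (matrix (f' x))) \<in> borel_measurable borel"
proof -
  \<comment> \<open>Extension by 0 makes the quotients Borel on the whole space; at a point of
    \<open>D\<close> and for large \<open>m\<close> they only involve values of
    \<open>f\<close>.\<close>
  define F where "F x = indicator D x *\<^sub>R f x" for x
  have F: "F \<in> borel_measurable borel"
    using borel_measurable_continuous_on_restrict[OF f] D
    unfolding F_def by (subst borel_measurable_restrict_space_iff[symmetric]) auto
  have entry: "(\<lambda>x. indicator S x * matrix (f' x) $ i $ j) \<in> borel_measurable borel" for i j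
  proof (rule borel_measurable_LIMSEQ_real)
    fix x :: "real ^ 'n"
    show "(\<lambda>m. indicator S x * ((real m + 1) * (F (x + axis j (1 / (real m + 1))) - F x) $ i))
        \<longlonglongrightarrow> indicator S x * matrix (f' x) $ i $ j"
    proof (cases "x \<in> S")
      case True
      then have xD: "x \<in> D" using S by blast
      have lin: "bounded_linear (f' x)" using der[OF True] by (rule has_derivative_bounded_linear)
      have "(\<lambda>m. (real m + 1) *\<^sub>R (F (x + axis j (1 / (real m + 1))) - F x)) \<longlonglongrightarrow> f' x (axis j 1)"
      proof (rule LIMSEQ_I)
        fix r :: real assume r: "r > 0"
        obtain d where d: "d > 0" "\<And>z. norm (z - x) < d \<Longrightarrow> norm (f z - f x - f' x (z - x)) \<le> (r/2) * norm (z - x)"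
          using der[OF True] r unfolding has_derivative_at_alt by (metis half_gt_zero)
        obtain e where e: "e > 0" "ball x e \<subseteq> D" using D xD by (meson open_contains_ball)
        obtain M :: nat where M: "1 / (real M + 1) < min d e"
          using d e by (metis add.commute min_less_iff_conj nat_approx_posE of_nat_Suc)
        have "norm ((real m + 1) *\<^sub>R (F (x + axis j (1 / (real m + 1))) - F x) - f' x (axis j 1)) < r"
          if m: "m \<ge> M" for m
        proof -
          define t where "t = 1 / (real m + 1)"
          have t: "t > 0" "t < min d e"
          proof -
            have "t \<le> 1 / (real M + 1)" using m by (simp add: t_def frac_le)
            then show "t < min d e" using M by simp
          qed (simp add: t_def)
          have ax: "axis j t = t *\<^sub>R (axis j 1 :: real ^ 'n)" by (simp add: axis_def vec_eq_iff)
          have nt: "norm (axis j t :: real ^ 'n) = t" using t by (simp add: ax)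
          have "x + axis j t \<in> D" using e t nt by (auto simp: dist_norm)
          then have "F (x + axis j t) - F x = f (x + axis j t) - f x" using xD by (simp add: F_def)
          moreover have "norm (f (x + axis j t) - f x - t *\<^sub>R f' x (axis j 1)) \<le> (r/2) * t"
            using d(2)[of "x + axis j t"] nt t by (simp add: ax linear_simps[OF lin])
          ultimately have "norm (F (x + axis j t) - F x - t *\<^sub>R f' x (axis j 1)) \<le> (r/2) * t"
            by simp
          then have "(1/t) * norm (F (x + axis j t) - F x - t *\<^sub>R f' x (axis j 1)) \<le> (1/t) * ((r/2) * t)"
            using t by (intro mult_left_mono) auto
          then have "norm ((1/t) *\<^sub>R (F (x + axis j t) - F x - t *\<^sub>R f' x (axis j 1))) \<le> r / 2"
            using t by simp
          then have "norm ((1/t) *\<^sub>R (F (x + axis j t) - F x) - f' x (axis j 1)) \<le> r / 2"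
            using t by (simp add: scaleR_diff_right)
          then show ?thesis using r by (simp add: t_def)
        qed
        then show "\<exists>M. \<forall>m\<ge>M. norm ((real m + 1) *\<^sub>R (F (x + axis j (1 / (real m + 1))) - F x) - f' x (axis j 1)) < r"
          by blast
      qed
      from tendsto_vec_nth[OF this, of i] show ?thesis
        using True by (simp add: matrix_def)
    qed simp
  next
    fix m :: nat
    have sh: "(\<lambda>x. F (x + axis j (1 / (real m + 1)))) \<in> borel_measurable borel"
      by (rule measurable_compose[OF _ F]) measurable
    have "(\<lambda>x. (F (x + axis j (1 / (real m + 1))) - F x) $ i) \<in> borel_measurable borel"
      by (rule borel_measurable_continuous_on[OF _ borel_measurable_diff[OF sh F]])
        (intro continuous_intros)
    then show "(\<lambda>x. indicator S x * ((real m + 1) * (F (x + axis j (1 / (real m + 1))) - F x) $ i)) \<in> borel_measurable borel"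
      using S by measurable
  qed
  have "(\<lambda>x. indicator S x * det (\<chi> i j. indicator S x * matrix (f' x) $ i $ j)) \<in> borel_measurable borel"
    unfolding det_def using S entry by (intro borel_measurable_times borel_measurable_sum borel_measurable_prod) auto
  moreover have "indicator S x * det (\<chi> i j. indicator S x * matrix (f' x) $ i $ j)
      = indicator S x * det (matrix (f' x))" for x
    by (cases "x \<in> S") (simp_all add: vec_nth_inverse)
  ultimately show ?thesis by simp
qed

section \<open>The modulus inequality\<close>

lemma finitely_bi_Lipschitz_bounds:
  fixes f :: "real ^ 'n \<Rightarrow> real ^ 'n"
  assumes f: "finitely_bi_Lipschitz D D' f" and x: "x \<in> D"
  shows "\<exists>B d. d > 0 \<and> (\<forall>z\<in>D. norm (z - x) < d \<longrightarrow> norm (f z - f x) \<le> B * norm (z - x))"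
    and "\<exists>c d. c > 0 \<and> d > 0 \<and> (\<forall>z\<in>D. norm (z - x) < d \<longrightarrow> c * norm (z - x) \<le> norm (f z - f x))"
proof -
  have up: "upper_stretch D f x < \<infinity>" and low: "0 < lower_stretch D f x"
    using f x by (auto simp: finitely_bi_Lipschitz_def)
  obtain B :: real where "upper_stretch D f x < ereal B"
    using up by (metis ereal_dense2 less_PInf_Ex_of_nat)
  then have "\<forall>\<^sub>F y in at x within D. ereal (norm (f x - f y) / norm (x - y)) < ereal B"
    unfolding upper_stretch_def by (rule Limsup_lessD)
  then obtain d where d: "d > 0" "\<And>z. z \<in> D \<Longrightarrow> z \<noteq> x \<Longrightarrow> dist z x < d \<Longrightarrow> norm (f x - f z) / norm (x - z) < B"
    unfolding eventually_at by auto
  have "norm (f z - f x) \<le> B * norm (z - x)" if "z \<in> D" "norm (z - x) < d" for z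
  proof (cases "z = x")
    case False
    then have "norm (f x - f z) / norm (x - z) < B" using d(2) that by (simp add: dist_norm)
    then have "norm (f x - f z) \<le> B * norm (x - z)" using False by (simp add: field_simps)
    then show ?thesis by (simp add: norm_minus_commute)
  qed simp
  with d(1) show "\<exists>B d. d > 0 \<and> (\<forall>z\<in>D. norm (z - x) < d \<longrightarrow> norm (f z - f x) \<le> B * norm (z - x))" by blast
  obtain c :: real where c: "0 < c" "ereal c < lower_stretch D f x"
    using ereal_dense2[OF low] by (auto simp: zero_ereal_def)
  then have "\<forall>\<^sub>F y in at x within D. ereal c < ereal (norm (f x - f y) / norm (x - y))"
    unfolding lower_stretch_def by (intro less_LiminfD)
  then obtain d where d: "d > 0" "\<And>z. z \<in> D \<Longrightarrow> z \<noteq> x \<Longrightarrow> dist z x < d \<Longrightarrow> c < norm (f x - f z) / norm (x - z)"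
    unfolding eventually_at by auto
  have "c * norm (z - x) \<le> norm (f z - f x)" if "z \<in> D" "norm (z - x) < d" for z
  proof (cases "z = x")
    case False
    then have "c < norm (f x - f z) / norm (x - z)" using d(2) that by (simp add: dist_norm)
    then have "c * norm (x - z) \<le> norm (f x - f z)" using False by (simp add: field_simps)
    then show ?thesis by (simp add: norm_minus_commute)
  qed simp
  with c(1) d(1)
  show "\<exists>c d. c > 0 \<and> d > 0 \<and> (\<forall>z\<in>D. norm (z - x) < d \<longrightarrow> c * norm (z - x) \<le> norm (f z - f x))" by blast
qed

text \<open>A positive lower slope of \<open>f\<close> at \<open>g y\<close> is a finite upper slope
  of \<open>g\<close> at \<open>y\<close>; continuity of \<open>g\<close> supplies the
  neighbourhood.\<close>

lemma stretch_inverse_finite: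
  assumes h: "homeomorphism D D' f g" and y: "y \<in> D'"
    and low: "\<exists>c d. c > 0 \<and> d > 0 \<and> (\<forall>z\<in>D. norm (z - g y) < d \<longrightarrow> c * norm (z - g y) \<le> norm (f z - f (g y)))"
  shows "stretch D' g y < \<infinity>"
proof -
  obtain c d where c: "c > 0" "d > 0" "\<And>z. z \<in> D \<Longrightarrow> norm (z - g y) < d \<Longrightarrow> c * norm (z - g y) \<le> norm (f z - f (g y))"
    using low by blast
  have "continuous_on D' g" using h by (simp add: homeomorphism_def)
  then obtain d' where d': "d' > 0" "\<And>w. w \<in> D' \<Longrightarrow> dist w y < d' \<Longrightarrow> dist (g w) (g y) < d"
    using y c(2) unfolding continuous_on_iff by metis
  have "stretch D' g y \<le> ennreal (1 / c)"
  proof (rule stretch_le[OF d'(1)])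
    fix w assume w: "w \<in> D'" "norm (w - y) < d'"
    have "g w \<in> D" "f (g w) = w" "f (g y) = y" using h w y by (auto simp: homeomorphism_def)
    then have "c * norm (g w - g y) \<le> norm (w - y)"
      using c(3)[of "g w"] d'(2)[of w] w by (simp add: dist_norm)
    then show "norm (g w - g y) \<le> 1 / c * norm (w - y)" using c(1) by (simp add: field_simps)
  qed
  then show ?thesis using le_less_trans ennreal_less_top by (metis infinity_ennreal_def)
qed

text \<open>Here \<open>\<sigma>\<close> is an upper gradient of \<open>v\<close>; the density \<open>(\<sigma> \<circ> g) \<cdot> stretch D' g\<close> is admissible for the
  image family.\<close>

lemma modulus_image_le:
  fixes f g :: "real ^ 'n \<Rightarrow> real ^ 'n" and v \<sigma> :: "real ^ 'n \<Rightarrow> real"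
  assumes D: "open D" "open D'" and h: "homeomorphism D D' f g"
    and up: "\<And>x. x \<in> D \<Longrightarrow> \<exists>B d. d > 0 \<and> (\<forall>z\<in>D. norm (z - x) < d \<longrightarrow> norm (f z - f x) \<le> B * norm (z - x))"
    and low: "\<And>x. x \<in> D \<Longrightarrow> \<exists>c d. c > 0 \<and> d > 0 \<and> (\<forall>z\<in>D. norm (z - x) < d \<longrightarrow> c * norm (z - x) \<le> norm (f z - f x))"
    and reg: "negligible {x \<in> D. \<not> (f differentiable (at x) \<and> det (matrix (frechet_derivative f (at x))) \<noteq> 0)}"
    and \<sigma>: "\<sigma> \<in> borel_measurable borel" "\<And>x. 0 \<le> \<sigma> x"
    and v: "\<And>x e. x \<in> D \<Longrightarrow> e > 0 \<Longrightarrow>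
      \<exists>d>0. \<forall>z\<in>D. norm (z - x) < d \<longrightarrow> \<bar>v z - v x\<bar> \<le> (\<sigma> x + e) * norm (z - x)"
    and EF: "E \<subseteq> D" "F \<subseteq> D" "\<And>a b. a \<in> E \<Longrightarrow> b \<in> F \<Longrightarrow> v b - v a \<ge> 1"
  shows "modulus (joining_paths (f ` E) (f ` F) D')
    \<le> (\<integral>\<^sup>+ x\<in>D. ennreal (\<sigma> x) ^ CARD('n) * outer_dilatation f x ^ (CARD('n) - 1) \<partial>lebesgue)"
proof -
  define n where "n = CARD('n)"
  \<comment> \<open>The indicators extend the density by 0 off \<open>D'\<close> and make it Borel
    on the whole space.\<close>
  define \<rho> where "\<rho> y = ennreal (indicator D' y * \<sigma> (g y)) * (stretch D' g y * indicator D' y)" for y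
  have contf: "continuous_on D f" and contg: "continuous_on D' g"
    and gf: "\<And>x. x \<in> D \<Longrightarrow> g (f x) = x" and fg: "\<And>y. y \<in> D' \<Longrightarrow> f (g y) = y"
    and fD: "f ` D = D'" and gD: "g ` D' = D"
    using h by (auto simp: homeomorphism_def)
  have sg: "(\<lambda>y. indicator D' y * \<sigma> (g y)) \<in> borel_measurable borel"
  proof -
    have "(\<lambda>y. \<sigma> (g y)) \<in> borel_measurable (restrict_space borel D')"
      by (rule measurable_compose[OF borel_measurable_continuous_on_restrict[OF contg] \<sigma>(1)])
    then show ?thesis using D(2) by (subst (asm) borel_measurable_restrict_space_iff) auto
  qed
  have \<rho>m: "\<rho> \<in> borel_measurable borel"
    unfolding \<rho>_def
    by (intro borel_measurable_times_ennreal measurable_compose[OF sg] measurable_ennreal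
        borel_measurable_stretch D contg)
  have fin: "stretch D' g y < \<infinity>" if "y \<in> D'" for y
    using stretch_inverse_finite[OF h that low] that gD by blast
  have \<rho>fin: "\<rho> y < \<infinity>" if "y \<in> D'" for y
    using fin[OF that] that by (simp add: \<rho>_def ennreal_mult_less_top)
  have adm: "1 \<le> line_integral \<rho> \<gamma>" if \<gamma>: "\<gamma> \<in> joining_paths (f ` E) (f ` F) D'" for \<gamma>
  proof -
    have path: "path \<gamma>" and st: "\<gamma> 0 \<in> f ` E" "\<gamma> 1 \<in> f ` F" and mid: "\<And>t. t \<in> {0<..<1} \<Longrightarrow> \<gamma> t \<in> D'"
      using \<gamma> by (auto simp: joining_paths_def pathstart_def pathfinish_def)
    have im: "path_image \<gamma> \<subseteq> D'"
    proof
      fix y assume "y \<in> path_image \<gamma>"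
      then obtain t where t: "0 \<le> t" "t \<le> 1" "y = \<gamma> t" by (auto simp: path_image_def)
      consider "t = 0" | "t = 1" | "t \<in> {0<..<1}" using t by fastforce
      then show "y \<in> D'" using t st mid EF fD by cases auto
    qed
    have "ennreal (v (g (pathfinish \<gamma>)) - v (g (pathstart \<gamma>))) \<le> line_integral \<rho> \<gamma>"
    proof (rule line_integral_ge_increment[OF path \<rho>m, where v = "\<lambda>y. v (g y)"])
      fix y assume "y \<in> path_image \<gamma>"
      with im have y: "y \<in> D'" by blast
      then show "\<rho> y < \<infinity>" by (rule \<rho>fin)
      fix e :: real assume e: "e > 0"
      define s L where "s = \<sigma> (g y)" and "L = enn2real (stretch D' g y)"
      have s: "s \<ge> 0" "L \<ge> 0" using \<sigma> by (auto simp: s_def L_def)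
      have Ls: "stretch D' g y = ennreal L" using fin[OF y] by (simp add: L_def less_top)
      have \<rho>y: "enn2real (\<rho> y) = s * L"
        using y s by (simp add: \<rho>_def enn2real_mult L_def s_def)
      \<comment> \<open>Chosen so that enlarging both \<open>s\<close> and \<open>L\<close> by
        \<open>e1\<close> enlarges their product by no more than \<open>e\<close>.\<close>
      define e1 where "e1 = min 1 (e / (s + L + 1))"
      have e1: "e1 > 0" "e1 \<le> 1" using e s by (auto simp: e1_def)
      have prod: "(s + e1) * (L + e1) \<le> s * L + e"
      proof -
        have "(s + e1) * (L + e1) = s * L + e1 * (s + L + e1)" by (simp add: algebra_simps)
        also have "\<dots> \<le> s * L + e1 * (s + L + 1)" using e1 by (intro add_left_mono mult_left_mono) auto
        also have "e1 * (s + L + 1) \<le> e / (s + L + 1) * (s + L + 1)"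
          using s by (intro mult_right_mono) (auto simp: e1_def)
        finally show ?thesis using s by simp
      qed
      have "stretch D' g y < ennreal (L + e1)" using Ls s e1 by (simp add: ennreal_less_iff)
      then obtain d2 where d2: "d2 > 0" "\<And>z. z \<in> D' \<Longrightarrow> norm (z - y) < d2 \<Longrightarrow> norm (g z - g y) \<le> (L + e1) * norm (z - y)"
        using stretch_lessD by blast
      have gy: "g y \<in> D" using y gD by blast
      obtain d1 where d1: "d1 > 0" "\<And>z. z \<in> D \<Longrightarrow> norm (z - g y) < d1 \<Longrightarrow> \<bar>v z - v (g y)\<bar> \<le> (s + e1) * norm (z - g y)"
        using v[OF gy e1(1)] by (auto simp: s_def)
      show "\<exists>d>0. \<forall>z\<in>path_image \<gamma>. norm (z - y) < d \<longrightarrow>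
          \<bar>v (g z) - v (g y)\<bar> \<le> (enn2real (\<rho> y) + e) * norm (z - y)"
      \<comment> \<open>Within the distance \<open>d1 / (L + e1)\<close> the point
        \<open>g z\<close> stays in the \<open>d1\<close>-neighbourhood of \<open>g y\<close>, where
        the bound for \<open>v\<close> holds.\<close>
      proof (intro exI[of _ "min d2 (d1 / (L + e1))"] conjI ballI impI)
        show "min d2 (d1 / (L + e1)) > 0" using d1 d2 s e1 by simp
        fix z assume z: "z \<in> path_image \<gamma>" "norm (z - y) < min d2 (d1 / (L + e1))"
        then have zD: "z \<in> D'" "g z \<in> D" using im gD by blast+
        have 1: "norm (g z - g y) \<le> (L + e1) * norm (z - y)" using d2(2)[OF zD(1)] z by simp
        also have "\<dots> < d1" using z s e1 by (simp add: field_simps)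
        finally have "\<bar>v (g z) - v (g y)\<bar> \<le> (s + e1) * norm (g z - g y)" using d1(2)[OF zD(2)] by simp
        also have "\<dots> \<le> (s + e1) * ((L + e1) * norm (z - y))" using 1 s e1 by (intro mult_left_mono) auto
        also have "\<dots> \<le> (s * L + e) * norm (z - y)"
          unfolding mult.assoc[symmetric] by (intro mult_right_mono prod) simp
        finally show "\<bar>v (g z) - v (g y)\<bar> \<le> (enn2real (\<rho> y) + e) * norm (z - y)" by (simp add: \<rho>y)
      qed
    qed
    moreover have "v (g (pathfinish \<gamma>)) - v (g (pathstart \<gamma>)) \<ge> 1"
    proof -
      obtain a b where ab: "a \<in> E" "b \<in> F" "\<gamma> 0 = f a" "\<gamma> 1 = f b" using st by blast
      then have "g (\<gamma> 0) = a" "g (\<gamma> 1) = b" using gf EF(1,2) by auto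
      then show ?thesis
        using EF(3)[OF ab(1,2)] by (simp add: pathfinish_def pathstart_def)
    qed
    ultimately show ?thesis by (metis ennreal_1 ennreal_leI order_trans)
  qed
  have "modulus (joining_paths (f ` E) (f ` F) D') \<le> (\<integral>\<^sup>+ y. \<rho> y ^ n \<partial>lebesgue)"
    unfolding modulus_def n_def using \<rho>m adm by (intro INF_lower) auto
  also have "\<dots> \<le> (\<integral>\<^sup>+ x\<in>D. ennreal (\<sigma> x) ^ n * outer_dilatation f x ^ (n - 1) \<partial>lebesgue)"
  proof -
    define A where "A x = frechet_derivative f (at x)" for x
    define Df where "Df = {x \<in> D. f differentiable (at x)}"
    define S where "S = {x \<in> Df. det (matrix (A x)) \<noteq> 0}"
    have Df: "Df \<in> sets borel" unfolding Df_def by (rule borel_differentiable_set[OF D(1) contf])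
    have derA: "(f has_derivative A x) (at x)" if "x \<in> Df" for x
      using that by (simp add: Df_def A_def frechet_derivative_works)
    have JD: "(\<lambda>x. indicator Df x * det (matrix (A x))) \<in> borel_measurable borel"
      by (rule borel_measurable_Jacobian[OF D(1) contf Df _ derA]) (auto simp: Df_def)
    have "S = {x \<in> space borel. indicator Df x * det (matrix (A x)) \<noteq> 0}"
      by (auto simp: S_def indicator_def)
    also have "\<dots> \<in> sets borel" using JD by measurable
    finally have S: "S \<in> sets borel" .
    have SD: "S \<subseteq> Df" "S \<subseteq> D" by (auto simp: S_def Df_def)
    have J: "(\<lambda>x. indicator S x * det (matrix (A x))) \<in> borel_measurable borel"
      by (rule borel_measurable_Jacobian[OF D(1) contf S SD(2) derA]) (use SD in auto)
    have fS: "f ` S \<in> sets borel"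
    proof -
      have "f ` S = g -` S \<inter> D'"
      proof (intro set_eqI iffI)
        fix y assume "y \<in> g -` S \<inter> D'"
        then have "y = f (g y)" "g y \<in> S" using fg by auto
        then show "y \<in> f ` S" by (rule image_eqI)
      next
        fix y assume "y \<in> f ` S"
        then show "y \<in> g -` S \<inter> D'" using SD gf fD by auto
      qed
      moreover have "g -` S \<inter> space (restrict_space borel D') \<in> sets (restrict_space borel D')"
        by (rule measurable_sets[OF borel_measurable_continuous_on_restrict[OF contg] S])
      ultimately show ?thesis using D(2)
        by (simp add: sets_restrict_space_iff space_restrict_space)
    qed
    \<comment> \<open>Pointwise Lipschitz maps take null sets to null sets. The image of the
      irregular set can therefore be dropped, and what remains is the injective differentiable part
      covered by the change of variables.\<close>
    have neg: "negligible (f ` (D - S))"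
    proof (rule negligible_locally_Lipschitz_image[of "D - S" f, simplified])
      have "D - S = {x \<in> D. \<not> (f differentiable (at x) \<and> det (matrix (frechet_derivative f (at x))) \<noteq> 0)}"
        by (auto simp: S_def Df_def A_def)
      with reg show "negligible (D - S)" by simp
      fix x assume x: "x \<in> D \<and> x \<notin> S"
      then obtain B d where "d > 0" "\<And>z. z \<in> D \<Longrightarrow> norm (z - x) < d \<Longrightarrow> norm (f z - f x) \<le> B * norm (z - x)"
        using up[of x] by blast
      then show "\<exists>T. open T \<and> x \<in> T \<and> (\<exists>B. \<forall>y\<in>(D - S) \<inter> T. norm (f y - f x) \<le> B * norm (y - x))"
        by (intro exI[of _ "ball x d"] conjI exI[of _ B]) (auto simp: dist_norm norm_minus_commute)
    qed
    \<comment> \<open>The change of variables is stated for real integrands; \<open>\<rho>\<close>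
      is finite on \<open>D'\<close>, so nothing is lost.\<close>
    define hh where "hh y = enn2real (\<rho> y) ^ n" for y
    have hm: "hh \<in> borel_measurable borel" unfolding hh_def using \<rho>m by measurable
    have \<rho>h: "\<rho> y ^ n = ennreal (hh y)" if "y \<in> D'" for y
      using \<rho>fin[OF that] by (simp add: hh_def less_top flip: ennreal_power)
    have n0: "n > 0" by (simp add: n_def)
    have "(\<integral>\<^sup>+ y. \<rho> y ^ n \<partial>lebesgue) \<le> (\<integral>\<^sup>+ y\<in>f ` S. ennreal (hh y) \<partial>lebesgue)"
    proof (rule nn_integral_mono_AE)
      have "AE y in lebesgue. y \<notin> f ` (D - S)"
        using neg by (intro AE_not_in) (simp add: negligible_iff_null_sets)
      then show "AE y in lebesgue. \<rho> y ^ n \<le> ennreal (hh y) * indicator (f ` S) y"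
      proof (eventually_elim)
        case (elim y)
        show ?case
        proof (cases "y \<in> D'")
          case True
          then have "y \<in> f ` S" using elim fD by blast
          then show ?thesis using \<rho>h[OF True] by simp
        next
          case False
          then show ?thesis using n0 by (simp add: \<rho>_def power_0_left)
        qed
      qed
    qed
    also have "\<dots> \<le> (\<integral>\<^sup>+ x\<in>S. ennreal (hh (f x) * \<bar>det (matrix (A x))\<bar>) \<partial>lebesgue)"
    proof (rule nn_integral_change_of_variables_le[OF S fS _ _ hm _ J])
      show "(f has_derivative A x) (at x within S)" if "x \<in> S" for x
        using derA SD that by (blast intro: has_derivative_at_withinI)
      show "inj_on f S" using gf SD by (intro inj_on_inverseI[of _ g]) auto
    qed (simp add: hh_def)
    also have "\<dots> \<le> (\<integral>\<^sup>+ x\<in>D. ennreal (\<sigma> x) ^ n * outer_dilatation f x ^ (n - 1) \<partial>lebesgue)"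
    proof (rule nn_integral_mono)
      fix x
      show "ennreal (hh (f x) * \<bar>det (matrix (A x))\<bar>) * indicator S x
          \<le> ennreal (\<sigma> x) ^ n * outer_dilatation f x ^ (n - 1) * indicator D x"
      proof (cases "x \<in> S")
        case True
        then have x: "x \<in> D" "x \<in> Df" "det (matrix (A x)) \<noteq> 0" using SD by (auto simp: S_def)
        have fx: "f x \<in> D'" using x fD by blast
        have linA: "linear (A x)" using has_derivative_linear[OF derA[OF x(2)]] .
        have "inj (A x)" using x(3) by (simp add: det_nz_iff_inj linA)
        then obtain B where B: "linear B" "\<And>h. B (A x h) = h" "\<And>h. A x (B h) = h"
          using linear_injective_isomorphism[OF linA] by blast
        \<comment> \<open>At the image of a regular point the inverse is differentiable, so the
          stretch of \<open>g\<close> in the density is at most the operator norm of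
          \<open>B\<close>, to which the inequality between the dilatations applies.\<close>
        have "(g has_derivative B) (at (f x))"
        proof (rule has_derivative_inverse_basic)
          show "(f has_derivative A x) (at (g (f x)))" using derA[OF x(2)] gf[OF x(1)] by simp
          show "bounded_linear B" using B(1) by (simp add: linear_conv_bounded_linear)
          show "B \<circ> A x = id" using B(2) by (simp add: fun_eq_iff)
          show "continuous (at (f x)) g"
            using contg D(2) fx by (simp add: continuous_on_eq_continuous_at)
          show "open D'" "f x \<in> D'" by fact+
          show "\<And>z. z \<in> D' \<Longrightarrow> f (g z) = z" by (rule fg)
        qed
        then have "stretch D' g (f x) \<le> ennreal (onorm B)" by (rule stretch_le_onorm)
        then have L: "enn2real (stretch D' g (f x)) \<le> onorm B"
          using enn2real_mono[of "stretch D' g (f x)" "ennreal (onorm B)"] B(1)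
          by (simp add: onorm_pos_le linear_conv_bounded_linear)
        have "hh (f x) = \<sigma> x ^ n * enn2real (stretch D' g (f x)) ^ n"
          using fx gf[OF x(1)] \<sigma>(2) by (simp add: hh_def \<rho>_def enn2real_mult power_mult_distrib)
        also have "\<dots> \<le> \<sigma> x ^ n * onorm B ^ n"
          using L \<sigma>(2) by (intro mult_left_mono power_mono) auto
        finally have "hh (f x) * \<bar>det (matrix (A x))\<bar> \<le> \<sigma> x ^ n * onorm B ^ n * \<bar>det (matrix (A x))\<bar>"
          by (intro mult_right_mono) auto
        also have "\<dots> \<le> \<sigma> x ^ n * (onorm (A x) ^ n / \<bar>det (matrix (A x))\<bar>) ^ (n - 1)"
          unfolding mult.assoc n_def
          using inner_dilatation_le_outer[OF linA B(1) B(3) x(3)] \<sigma>(2) by (intro mult_left_mono) auto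
        finally have "ennreal (hh (f x) * \<bar>det (matrix (A x))\<bar>)
            \<le> ennreal (\<sigma> x ^ n * (onorm (A x) ^ n / \<bar>det (matrix (A x))\<bar>) ^ (n - 1))"
          by (rule ennreal_leI)
        also have "\<dots> = ennreal (\<sigma> x) ^ n * ennreal (onorm (A x) ^ n / \<bar>det (matrix (A x))\<bar>) ^ (n - 1)"
          using \<sigma>(2) linA
          by (simp add: ennreal_mult ennreal_power onorm_pos_le linear_conv_bounded_linear)
        also have "ennreal (onorm (A x) ^ n / \<bar>det (matrix (A x))\<bar>) = outer_dilatation f x"
          using x by (simp add: outer_dilatation_def Let_def A_def n_def Df_def)
        finally show ?thesis using True x by simp
      qed simp
    qed
    finally show ?thesis .
  qed
  finally show ?thesis by (simp add: n_def)
qed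

text \<open>The special case of the identity, whose outer dilatation is 1.\<close>

lemma modulus_le:
  fixes v \<sigma> :: "real ^ 'n \<Rightarrow> real"
  assumes D: "open D"
    and \<sigma>: "\<sigma> \<in> borel_measurable borel" "\<And>x. 0 \<le> \<sigma> x"
    and v: "\<And>x e. x \<in> D \<Longrightarrow> e > 0 \<Longrightarrow>
      \<exists>d>0. \<forall>z\<in>D. norm (z - x) < d \<longrightarrow> \<bar>v z - v x\<bar> \<le> (\<sigma> x + e) * norm (z - x)"
    and EF: "E \<subseteq> D" "F \<subseteq> D" "\<And>a b. a \<in> E \<Longrightarrow> b \<in> F \<Longrightarrow> v b - v a \<ge> 1"
  shows "modulus (joining_paths E F D) \<le> (\<integral>\<^sup>+ x\<in>D. ennreal (\<sigma> x) ^ CARD('n) \<partial>lebesgue)"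
proof -
  let ?i = "\<lambda>x::real^'n. x"
  have fd: "frechet_derivative ?i (at x) = ?i" for x
    by (rule frechet_derivative_at[symmetric]) (rule has_derivative_ident)
  have det1: "det (matrix ?i) = 1"
    using matrix_id by (simp add: id_def)
  have od: "outer_dilatation ?i x = 1" for x
    by (simp add: outer_dilatation_def Let_def fd det1 onorm_id)
  have "modulus (joining_paths (?i ` E) (?i ` F) D)
    \<le> (\<integral>\<^sup>+ x\<in>D. ennreal (\<sigma> x) ^ CARD('n) * outer_dilatation ?i x ^ (CARD('n) - 1) \<partial>lebesgue)"
  proof (rule modulus_image_le[OF D D _ _ _ _ \<sigma> v EF])
    show "homeomorphism D D ?i ?i" by (auto simp: homeomorphism_def)
    show "negligible {x \<in> D. \<not> (?i differentiable (at x) \<and> det (matrix (frechet_derivative ?i (at x))) \<noteq> 0)}"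
      by (simp add: fd det1)
    fix x :: "real ^ 'n"
    show "\<exists>B d. d > 0 \<and> (\<forall>z\<in>D. norm (z - x) < d \<longrightarrow> norm (z - x) \<le> B * norm (z - x))"
      by (intro exI[of _ 1]) auto
    show "\<exists>c d. c > 0 \<and> d > 0 \<and> (\<forall>z\<in>D. norm (z - x) < d \<longrightarrow> c * norm (z - x) \<le> norm (z - x))"
      by (intro exI[of _ 1]) auto
  qed auto
  then show ?thesis by (simp add: od)
qed

section \<open>Weakly flat boundaries and extension to closures\<close>

text \<open>A connected set that meets \<open>V\<close> and leaves the larger set \<open>U\<close>
  crosses both frontiers. In this form only the membership of single points has to be checked for
  the continua constructed later.\<close>

lemma weakly_flat_boundaryE:
  assumes "weakly_flat_boundary D" "x0 \<in> frontier D" "open U" "x0 \<in> U" "0 < (P::real)"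
  obtains V where "open V" "x0 \<in> V" "V \<subseteq> U"
    "\<And>E F. compact E \<Longrightarrow> connected E \<Longrightarrow> E \<subseteq> D \<Longrightarrow> E \<inter> V \<noteq> {} \<Longrightarrow> E - U \<noteq> {} \<Longrightarrow>
      compact F \<Longrightarrow> connected F \<Longrightarrow> F \<subseteq> D \<Longrightarrow> F \<inter> V \<noteq> {} \<Longrightarrow> F - U \<noteq> {} \<Longrightarrow>
      ennreal P \<le> modulus (joining_paths E F D)"
proof -
  obtain V where V: "open V" "x0 \<in> V" "V \<subseteq> U"
    "\<And>E F. compact E \<and> connected E \<and> E \<subseteq> D \<and> compact F \<and> connected F \<and> F \<subseteq> D \<and>
       E \<inter> frontier U \<noteq> {} \<and> E \<inter> frontier V \<noteq> {} \<and> F \<inter> frontier U \<noteq> {} \<and> F \<inter> frontier V \<noteq> {} \<Longrightarrow>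
       ennreal P \<le> modulus (joining_paths E F D)"
    using assms unfolding weakly_flat_boundary_def by meson
  have fr: "E \<inter> frontier U \<noteq> {} \<and> E \<inter> frontier V \<noteq> {}"
    if "connected E" "E \<inter> V \<noteq> {}" "E - U \<noteq> {}" for E
  proof
    show "E \<inter> frontier U \<noteq> {}" using that V(3) by (intro connected_Int_frontier) auto
    show "E \<inter> frontier V \<noteq> {}" using that V(3) by (intro connected_Int_frontier) auto
  qed
  show ?thesis by (rule that[OF V(1-3)]) (use V(4) fr in simp)
qed

text \<open>A path in \<open>D\<close> between different components of \<open>D \<inter> ball x0 r\<close> has to leave that ball, so that
  the family of such paths issuing from \<open>ball x0 (r / 2)\<close> has bounded modulus.\<close>

lemma weakly_flat_locally_connected:
  fixes D :: "(real ^ 'n) set"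
  assumes D: "is_domain D" "bounded D" "weakly_flat_boundary D" and x0: "x0 \<in> frontier D" and r: "r > 0"
  obtains V where "open V" "x0 \<in> V"
    "\<And>x y. x \<in> V \<inter> D \<Longrightarrow> y \<in> V \<inter> D \<Longrightarrow>
       \<exists>p. path p \<and> path_image p \<subseteq> D \<inter> ball x0 r \<and> pathstart p = x \<and> pathfinish p = y"
proof (cases "D \<subseteq> ball x0 r")
  case True
  have "path_connected D" using D(1) by (simp add: is_domain_def connected_open_path_connected)
  then show ?thesis using True by (intro that[of UNIV]) (auto simp: path_connected_def Int_absorb2)
next
  case False
  then obtain q where q: "q \<in> D" "q \<notin> ball x0 r" by blast
  define W where "W = D \<inter> ball x0 r"
  define U where "U = ball x0 (r / 2)"
  have opD: "open D" and pcD: "path_connected D"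
    using D(1) by (auto simp: is_domain_def connected_open_path_connected)
  have W: "open W" using opD by (simp add: W_def open_Int)
  \<comment> \<open>The density will be the constant \<open>2 / r\<close>, whose n-th power has a
    finite integral because \<open>D\<close> is bounded.\<close>
  define I where "I = (\<integral>\<^sup>+ x\<in>D. ennreal (2 / r) ^ CARD('n) \<partial>lebesgue)"
  have "D \<in> lmeasurable" using D(2) opD by (simp add: lmeasurable_open)
  then have fin: "emeasure lebesgue D \<noteq> top" by (rule fmeasurableD2)
  then have "I < \<infinity>"
    using fmeasurableD[OF \<open>D \<in> lmeasurable\<close>] fin r unfolding I_def
    by (subst nn_integral_cmult_indicator) (auto simp: ennreal_mult_eq_top_iff ennreal_power less_top[symmetric])
  then obtain P where P: "I < ennreal P" "P > 0"
    by (metis ennreal_Ex_less_of_nat infinity_ennreal_def ennreal_of_nat_eq_real_of_nat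
        gr_zeroI not_less_zero of_nat_0 of_nat_0_less_iff)
  have "open U" "x0 \<in> U" using r by (auto simp: U_def)
  then obtain V where V: "open V" "x0 \<in> V" "V \<subseteq> U"
    and Vmod: "\<And>E F. compact E \<Longrightarrow> connected E \<Longrightarrow> E \<subseteq> D \<Longrightarrow> E \<inter> V \<noteq> {} \<Longrightarrow> E - U \<noteq> {} \<Longrightarrow>
      compact F \<Longrightarrow> connected F \<Longrightarrow> F \<subseteq> D \<Longrightarrow> F \<inter> V \<noteq> {} \<Longrightarrow> F - U \<noteq> {} \<Longrightarrow>
      ennreal P \<le> modulus (joining_paths E F D)"
    using weakly_flat_boundaryE[OF D(3) x0 _ _ P(2), of U] by metis
  \<comment> \<open>The part of a path from \<open>x\<close> to \<open>q\<close> up to its first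
    exit from \<open>U\<close> is a continuum that reaches the frontier of \<open>U\<close> and
    stays inside \<open>ball x0 r\<close>.\<close>
  have cont: "\<exists>E. compact E \<and> path_connected E \<and> x \<in> E \<and> E - U \<noteq> {} \<and> E \<subseteq> D \<inter> cball x0 (r / 2)"
    if x: "x \<in> V \<inter> D" for x
  proof -
    obtain p where p: "path p" "path_image p \<subseteq> D" "pathstart p = x" "pathfinish p = q"
      using pcD[unfolded path_connected_def] x q(1) by (meson IntD2)
    have "pathstart p \<in> closure U" "pathfinish p \<notin> U"
      using x p V q r closure_subset[of U] by (auto simp: U_def)
    then obtain u where u: "0 \<le> u" "u \<le> 1" "p u \<in> frontier U" "path_image (subpath 0 u p) - {p u} \<subseteq> interior U"
      using subpath_to_frontier[OF p(1)] by metis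
    define E where "E = path_image (subpath 0 u p)"
    have pu: "dist x0 (p u) = r / 2" using u(3) r by (simp add: U_def frontier_ball)
    have sub: "path (subpath 0 u p)" using p(1) u by (simp add: path_subpath)
    have "E \<subseteq> path_image p" using u by (simp add: E_def path_image_subpath_subset)
    moreover have "E \<subseteq> cball x0 (r / 2)"
      using u(4) pu by (auto simp: E_def U_def subset_iff)
    moreover have "p u \<in> E" using pathfinish_in_path_image[of "subpath 0 u p"] by (simp add: E_def)
    moreover have "x \<in> E" using pathstart_in_path_image[of "subpath 0 u p"] p(3)[unfolded pathstart_def] by (simp add: E_def)
    moreover have "compact E" "path_connected E"
      using sub by (simp_all add: E_def compact_path_image path_connected_path_image)
    moreover have "p u \<notin> U" using pu by (simp add: U_def)
    ultimately show ?thesis using p(2) by (intro exI[of _ E]) auto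
  qed
  have "\<exists>p. path p \<and> path_image p \<subseteq> D \<inter> ball x0 r \<and> pathstart p = x \<and> pathfinish p = y"
    if x: "x \<in> V \<inter> D" and y: "y \<in> V \<inter> D" for x y
  proof (rule ccontr)
    assume "\<not> ?thesis"
    then have npc: "\<not> path_component W x y" by (auto simp: path_component_def W_def)
    define K where "K = path_component_set W x"
    obtain E where E: "compact E" "path_connected E" "x \<in> E" "E - U \<noteq> {}" "E \<subseteq> D \<inter> cball x0 (r / 2)"
      using cont[OF x] by blast
    obtain F where F: "compact F" "path_connected F" "y \<in> F" "F - U \<noteq> {}" "F \<subseteq> D \<inter> cball x0 (r / 2)"
      using cont[OF y] by blast
    have cb: "D \<inter> cball x0 (r / 2) \<subseteq> W" using r by (auto simp: W_def)
    have EK: "E \<subseteq> K" unfolding K_def using E cb by (intro path_component_maximal) auto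
    have FK: "F \<inter> K = {}"
    proof -
      have "F \<subseteq> path_component_set W y" using F cb by (intro path_component_maximal) auto
      moreover have "path_component_set W y \<inter> K = {}"
        unfolding K_def using npc by (auto dest: path_component_sym path_component_trans)
      ultimately show ?thesis by blast
    qed
    \<comment> \<open>\<open>\<phi>\<close> rises from 0 to 1 between the radii \<open>r / 2\<close>
      and \<open>r\<close>; setting \<open>v = 1\<close> off \<open>K\<close> then separates
      \<open>E\<close> from \<open>F\<close>.\<close>
    define \<phi> where "\<phi> z = min 1 (max 0 ((dist z x0 - r / 2) * (2 / r)))" for z
    define v where "v z = (if z \<in> K then \<phi> z else 1)" for z
    have lip: "\<bar>\<phi> z - \<phi> x\<bar> \<le> (2 / r) * norm (z - x)" for z x
    proof -
      have "\<bar>\<phi> z - \<phi> x\<bar> \<le> \<bar>(dist z x0 - r / 2) * (2 / r) - (dist x x0 - r / 2) * (2 / r)\<bar>"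
        unfolding \<phi>_def by linarith
      also have "\<dots> = (2 / r) * \<bar>dist z x0 - dist x x0\<bar>"
      proof -
        have "(dist z x0 - r / 2) * (2 / r) - (dist x x0 - r / 2) * (2 / r) = (2 / r) * (dist z x0 - dist x x0)"
          by (simp add: algebra_simps)
        then show ?thesis using r by (simp only: abs_mult) simp
      qed
      also have "\<dots> \<le> (2 / r) * norm (z - x)"
        using r norm_triangle_ineq3[of "z - x0" "x - x0"] by (intro mult_left_mono) (auto simp: dist_norm)
      finally show ?thesis .
    qed
    have "modulus (joining_paths E F D) \<le> I"
      unfolding I_def
    proof (rule modulus_le[OF opD, where v = v])
      fix a e :: real and z assume z: "z \<in> D" and e: "e > 0"
      have lip': "\<bar>\<phi> w - \<phi> z\<bar> \<le> (2 / r + e) * norm (w - z)" for w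
        using lip[of w z] mult_right_mono[of "2 / r" "2 / r + e" "norm (w - z)"] e by simp
      \<comment> \<open>\<open>v\<close> could jump only where \<open>K\<close> ends. The components
        of \<open>W\<close> are open, so inside \<open>D\<close> this can only happen at points
        outside \<open>W\<close>, and there \<open>\<phi>\<close> already equals 1.\<close>
      consider "z \<in> K" | "z \<in> W" "z \<notin> K" | "z \<notin> W" by blast
      then show "\<exists>d>0. \<forall>w\<in>D. norm (w - z) < d \<longrightarrow> \<bar>v w - v z\<bar> \<le> (2 / r + e) * norm (w - z)"
      proof cases
        case 1
        have "open K" unfolding K_def using W by (rule open_path_component)
        then obtain d where "d > 0" "ball z d \<subseteq> K" using 1 by (meson open_contains_ball)
        then show ?thesis using lip' 1
          by (intro exI[of _ d]) (auto simp: v_def subset_iff dist_norm norm_minus_commute)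
      next
        case 2
        have "open (path_component_set W z)" using W by (rule open_path_component)
        moreover have "z \<in> path_component_set W z" using 2 by (simp add: path_component_refl)
        ultimately obtain d where d: "d > 0" "ball z d \<subseteq> path_component_set W z" by (meson open_contains_ball)
        moreover have "path_component_set W z \<inter> K = {}"
          unfolding K_def using 2 by (auto simp: K_def dest: path_component_sym path_component_trans)
        ultimately have "ball z d \<inter> K = {}" by blast
        moreover have "w \<in> ball z d" if "norm (w - z) < d" for w
          using that by (simp add: dist_norm norm_minus_commute)
        ultimately have "w \<notin> K" if "norm (w - z) < d" for w using that by blast
        then show ?thesis using 2 d(1) e r by (intro exI[of _ d]) (auto simp: v_def)
      next
        case 3
        then have "dist z x0 \<ge> r" using z by (simp add: W_def dist_commute)
        then have "(dist z x0 - r / 2) * (2 / r) \<ge> 1" using r by (simp add: field_simps)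
        then have "\<phi> z = 1" by (simp add: \<phi>_def)
        moreover have "z \<notin> K" using 3 path_component_subset[of W x] by (auto simp: K_def)
        ultimately show ?thesis using lip' e r by (intro exI[of _ 1]) (auto simp: v_def)
      qed
    next
      fix a b assume ab: "a \<in> E" "b \<in> F"
      have "dist a x0 \<le> r / 2" using ab E by (auto simp: dist_commute)
      then have "(dist a x0 - r / 2) * (2 / r) \<le> 0" using r by (intro mult_nonpos_nonneg) auto
      then have "\<phi> a = 0" unfolding \<phi>_def max_absorb1[OF \<open>_ \<le> 0\<close>] by simp
      then show "1 \<le> v b - v a" using ab EK FK by (auto simp: v_def)
    qed (use r E F in auto)
    also have "I < ennreal P" by (rule P)
    also have "ennreal P \<le> modulus (joining_paths E F D)"
      using E F x y by (intro Vmod) (auto intro: path_connected_imp_connected)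
    finally show False by simp
  qed
  with V that show ?thesis by blast
qed

text \<open>If uniform continuity failed, there would be pairs of points with distance tending to 0
  and images at least \<open>e\<close> apart. By compactness a subsequence converges to a common
  \<open>x0\<close> with two distinct cluster values. Continuity excludes this for \<open>x0\<close>
  in \<open>D\<close>, the hypothesis for all other \<open>x0\<close>.\<close>

lemma uniformly_continuous_on_cluster:
  fixes f :: "'a::heine_borel \<Rightarrow> 'b::heine_borel"
  assumes "bounded D" "bounded (f ` D)" and f: "continuous_on D f"
    and cl: "\<And>x0 a b y1 y2. x0 \<in> closure D - D \<Longrightarrow> (\<And>n::nat. a n \<in> D) \<Longrightarrow> (\<And>n. b n \<in> D) \<Longrightarrow> a \<longlonglongrightarrow> x0 \<Longrightarrow> b \<longlonglongrightarrow> x0 \<Longrightarrow>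
      (\<lambda>n. f (a n)) \<longlonglongrightarrow> y1 \<Longrightarrow> (\<lambda>n. f (b n)) \<longlonglongrightarrow> y2 \<Longrightarrow> y1 = y2"
  shows "uniformly_continuous_on D f"
proof (rule ccontr)
  assume "\<not> uniformly_continuous_on D f"
  then obtain e where e: "e > 0" and "\<forall>d>0. \<exists>x\<in>D. \<exists>x'\<in>D. dist x' x < d \<and> \<not> dist (f x') (f x) < e"
    unfolding uniformly_continuous_on_def by blast
  then have ex: "\<exists>x\<in>D. \<exists>x'\<in>D. dist x' x < d \<and> \<not> dist (f x') (f x) < e" if "d > 0" for d
    using that by blast
  have "\<exists>x x'. x \<in> D \<and> x' \<in> D \<and> dist x' x < 1 / (real n + 1) \<and> e \<le> dist (f x') (f x)" for n
    using ex[of "1 / (real n + 1)"] by (auto simp: not_less)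
  then obtain a b where ab: "\<And>n. a n \<in> D" "\<And>n. b n \<in> D" "\<And>n::nat. dist (b n) (a n) < 1 / (real n + 1)"
    "\<And>n. e \<le> dist (f (b n)) (f (a n))" by metis
  define K where "K = closure D \<times> closure (f ` D) \<times> closure (f ` D)"
  have "compact K" using assms(1,2) by (simp add: K_def compact_Times compact_closure)
  moreover have "\<forall>n. (a n, f (a n), f (b n)) \<in> K"
    using ab closure_subset by (auto simp: K_def intro!: subsetD[OF closure_subset])
  ultimately obtain l and s :: "nat \<Rightarrow> nat" where l: "l \<in> K" "strict_mono s" "((\<lambda>n. (a n, f (a n), f (b n))) \<circ> s) \<longlonglongrightarrow> l"
    unfolding compact_def by meson
  obtain x0 y1 y2 where xy: "l = (x0, y1, y2)" by (cases l) auto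
  have lim: "(\<lambda>n. a (s n)) \<longlonglongrightarrow> x0" "(\<lambda>n. f (a (s n))) \<longlonglongrightarrow> y1" "(\<lambda>n. f (b (s n))) \<longlonglongrightarrow> y2"
    using tendsto_fst[OF l(3)] tendsto_fst[OF tendsto_snd[OF l(3)]] tendsto_snd[OF tendsto_snd[OF l(3)]]
    by (simp_all add: xy o_def)
  have limb: "(\<lambda>n. b (s n)) \<longlonglongrightarrow> x0"
  proof -
    have "(\<lambda>n. dist (b n) (a n)) \<longlonglongrightarrow> 0"
    proof (rule tendsto_sandwich[where f = "\<lambda>_. 0" and h = "\<lambda>n. 1 / (real n + 1)"])
      show "(\<lambda>n. 1 / (real n + 1)) \<longlonglongrightarrow> 0"
        using LIMSEQ_inverse_real_of_nat by (simp add: inverse_eq_divide add.commute)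
      show "\<forall>\<^sub>F n in sequentially. dist (b n) (a n) \<le> 1 / (real n + 1)"
        by (rule always_eventually) (metis ab(3) less_imp_le)
    qed simp_all
    then have "(\<lambda>n. dist (b (s n)) (a (s n))) \<longlonglongrightarrow> 0"
      using LIMSEQ_subseq_LIMSEQ[OF _ l(2), of "\<lambda>n. dist (b n) (a n)" 0] by (simp add: o_def)
    from tendsto_add[OF this lim(1)[unfolded tendsto_dist_iff[of _ x0]]]
    have sum: "(\<lambda>n. dist (b (s n)) (a (s n)) + dist (a (s n)) x0) \<longlonglongrightarrow> 0" by simp
    show ?thesis
      unfolding tendsto_dist_iff[of _ x0]
    proof (rule tendsto_sandwich[OF _ _ _ sum, where f = "\<lambda>_. 0"])
      show "\<forall>\<^sub>F n in sequentially. dist (b (s n)) x0 \<le> dist (b (s n)) (a (s n)) + dist (a (s n)) x0"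
        by (rule always_eventually) (simp add: dist_triangle)
    qed simp_all
  qed
  have "y1 = y2"
  proof (cases "x0 \<in> D")
    case True
    then have "(\<lambda>n. f (a (s n))) \<longlonglongrightarrow> f x0" "(\<lambda>n. f (b (s n))) \<longlonglongrightarrow> f x0"
      using f lim(1) limb ab(1,2) by (auto simp: continuous_on_sequentially o_def)
    then show ?thesis using lim LIMSEQ_unique by metis
  next
    case False
    then show ?thesis using l(1) xy ab lim limb cl[of x0 "\<lambda>n. a (s n)" "\<lambda>n. b (s n)" y1 y2] by (simp add: K_def)
  qed
  moreover have "(\<lambda>n. dist (f (b (s n))) (f (a (s n)))) \<longlonglongrightarrow> dist y2 y1" by (intro tendsto_intros lim)
  ultimately have "(\<lambda>n. dist (f (b (s n))) (f (a (s n)))) \<longlonglongrightarrow> 0" by simp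
  then have "e \<le> 0" by (rule tendsto_lowerbound) (use ab(4) in simp_all)
  with e show False by simp
qed

text \<open>If \<open>y\<close> were in \<open>D'\<close>, continuity of \<open>g\<close> at
  \<open>y\<close> would give \<open>x0 = g y\<close>, a point of \<open>D\<close>.\<close>

lemma homeomorphism_boundary_limit:
  fixes f :: "'a::metric_space \<Rightarrow> 'b::metric_space"
  assumes h: "homeomorphism D D' f g" and D: "open D'" and x0: "x0 \<notin> D"
    and a: "\<And>n. a n \<in> D" "a \<longlonglongrightarrow> x0" "(\<lambda>n::nat. f (a n)) \<longlonglongrightarrow> y"
  shows "y \<in> frontier D'"
proof -
  have fa: "f (a n) \<in> D'" for n using h a(1) by (auto simp: homeomorphism_def)
  then have cl: "y \<in> closure D'" using a(3)
    unfolding closure_sequential by (intro exI[of _ "\<lambda>n. f (a n)"]) simp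
  have "y \<notin> D'"
  proof
    assume y: "y \<in> D'"
    have "continuous_on D' g" using h by (simp add: homeomorphism_def)
    then have "(\<lambda>n. g (f (a n))) \<longlonglongrightarrow> g y"
      using y fa a(3) unfolding continuous_on_sequentially o_def by simp
    moreover have "(\<lambda>n. g (f (a n))) = a" using h a(1) by (auto simp: homeomorphism_def)
    ultimately have "x0 = g y" using LIMSEQ_unique[OF a(2)] by simp
    with y h x0 show False by (auto simp: homeomorphism_def)
  qed
  with cl D show ?thesis by (simp add: frontier_def interior_open)
qed

text \<open>Both compositions of the continuous extensions agree with the identity on a dense
  subset, hence on the closures.\<close>

lemma homeomorphism_extend_closure:
  fixes f :: "'a::complete_space \<Rightarrow> 'b::complete_space"
  assumes h: "homeomorphism D D' f g"
    and f: "uniformly_continuous_on D f" and g: "uniformly_continuous_on D' g"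
  shows "\<exists>F G. homeomorphism (closure D) (closure D') F G \<and> (\<forall>x\<in>D. F x = f x)"
proof -
  obtain F where F: "uniformly_continuous_on (closure D) F" "\<And>x. x \<in> D \<Longrightarrow> f x = F x"
    using uniformly_continuous_on_extension_on_closure[OF f] by metis
  obtain G where G: "uniformly_continuous_on (closure D') G" "\<And>x. x \<in> D' \<Longrightarrow> g x = G x"
    using uniformly_continuous_on_extension_on_closure[OF g] by metis
  have cF: "continuous_on (closure D) F" and cG: "continuous_on (closure D') G"
    using F(1) G(1) by (simp_all add: uniformly_continuous_imp_continuous)
  have fD: "f ` D = D'" "g ` D' = D" and gf: "\<And>x. x \<in> D \<Longrightarrow> g (f x) = x" "\<And>y. y \<in> D' \<Longrightarrow> f (g y) = y"
    using h by (auto simp: homeomorphism_def)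
  have FD: "F ` closure D \<subseteq> closure D'"
    using F(2) fD closure_subset[of D'] by (intro image_closure_subset cF closed_closure) auto
  have GD: "G ` closure D' \<subseteq> closure D"
    using G(2) fD closure_subset[of D] by (intro image_closure_subset cG closed_closure) auto
  have ident: "H x = x" if H: "continuous_on (closure S) H" "\<And>x. x \<in> S \<Longrightarrow> H x = x" and x: "x \<in> closure S"
    for S :: "'c::complete_space set" and H x
  proof -
    obtain s where s: "\<And>n::nat. s n \<in> S" "s \<longlonglongrightarrow> x" using x unfolding closure_sequential by blast
    have "s n \<in> closure S" for n using s(1) closure_subset by blast
    with s have "(\<lambda>n. H (s n)) \<longlonglongrightarrow> H x"
      using H(1) x by (auto simp: continuous_on_sequentially o_def)
    then show ?thesis using s H(2) LIMSEQ_unique[of s x "H x"] by simp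
  qed
  have GF: "G (F x) = x" if "x \<in> closure D" for x
  proof (rule ident[OF _ _ that])
    show "continuous_on (closure D) (\<lambda>x. G (F x))"
      using continuous_on_compose2[OF cG cF FD] .
    show "G (F x) = x" if "x \<in> D" for x
    proof -
      have "f x \<in> D'" using that fD by blast
      then show ?thesis using F(2)[OF that] G(2)[of "f x"] gf(1)[OF that] by simp
    qed
  qed
  have FG: "F (G y) = y" if "y \<in> closure D'" for y
  proof (rule ident[OF _ _ that])
    show "continuous_on (closure D') (\<lambda>x. F (G x))"
      using continuous_on_compose2[OF cF cG GD] .
    show "F (G y) = y" if "y \<in> D'" for y
    proof -
      have "g y \<in> D" using that fD by blast
      then show ?thesis using G(2)[OF that] F(2)[of "g y"] gf(2)[OF that] by simp
    qed
  qed
  have "homeomorphism (closure D) (closure D') F G"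
    by (rule homeomorphismI[OF cF cG FD GD GF FG])
  with F(2) show ?thesis by metis
qed

text \<open>Superlevel sets are closed upwards, and in a complete linear order such a set is a ray
  starting at its infimum.\<close>

lemma borel_measurable_mono_complete:
  fixes f :: "'a::{complete_linorder,linorder_topology} \<Rightarrow> 'b::{linorder_topology,second_countable_topology}"
  assumes "mono f"
  shows "f \<in> borel_measurable borel"
proof (rule borel_measurableI_greater)
  fix y
  define U where "U = {x. y < f x}"
  have up: "x' \<in> U" if "x \<in> U" "x \<le> x'" for x x'
    using that monoD[OF assms, of x x'] by (auto simp: U_def)
  have "U = {Inf U..} \<or> U = {Inf U<..}"
  proof (cases "Inf U \<in> U")
    case True
    then have "U = {Inf U..}" using up by (auto intro: Inf_lower)
    then show ?thesis ..
  next
    case False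
    have "U = {Inf U<..}"
    proof (intro set_eqI iffI)
      fix x assume "x \<in> U"
      then show "x \<in> {Inf U<..}" using False Inf_lower[of x U] by (auto simp: order.order_iff_strict)
    next
      fix x assume "x \<in> {Inf U<..}"
      then obtain z where "z \<in> U" "z < x" by (auto simp: Inf_less_iff)
      then show "x \<in> U" using up by auto
    qed
    then show ?thesis ..
  qed
  then have "U \<in> sets borel" by (metis atLeast_borel greaterThan_borel)
  then show "{x \<in> space borel. y < f x} \<in> sets borel" by (simp add: U_def)
qed

section \<open>Boundary behaviour under a divergent sequence of weights\<close>

text \<open>Excludes the branch of \<open>outer_dilatation\<close> for a vanishing derivative: with
  derivative 0 the increments of \<open>f\<close> near \<open>x\<close> would be at most
  \<open>c / 2\<close> times the distance.\<close>

lemma derivative_nonzero: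
  fixes f :: "real ^ 'n \<Rightarrow> real ^ 'n"
  assumes D: "open D" "x \<in> D"
    and low: "\<exists>c d. c > 0 \<and> d > 0 \<and> (\<forall>z\<in>D. norm (z - x) < d \<longrightarrow> c * norm (z - x) \<le> norm (f z - f x))"
  shows "\<not> (f has_derivative (\<lambda>h. 0)) (at x)"
proof
  assume der: "(f has_derivative (\<lambda>h. 0)) (at x)"
  obtain c d where c: "c > 0" "d > 0" "\<And>z. z \<in> D \<Longrightarrow> norm (z - x) < d \<Longrightarrow> c * norm (z - x) \<le> norm (f z - f x)"
    using low by blast
  have "c / 2 > 0" using c by simp
  then obtain d' where d': "d' > 0" "\<And>z. norm (z - x) < d' \<Longrightarrow> norm (f z - f x - 0) \<le> (c / 2) * norm (z - x)"
    using der unfolding has_derivative_at_alt by blast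
  obtain h :: "real ^ 'n" where h: "norm h = 1" by (meson vector_choose_size zero_le_one)
  have "min d d' > 0" using c d' by simp
  then obtain t :: real where t: "t > 0" "x + t *\<^sub>R h \<in> D" "norm (t *\<^sub>R h) < min d d'"
    using small_scale_in_open[OF D] by blast
  have "c * t \<le> norm (f (x + t *\<^sub>R h) - f x)" using c(3)[OF t(2)] t h by simp
  also have "\<dots> \<le> (c / 2) * t" using d'(2)[of "x + t *\<^sub>R h"] t h by simp
  finally show False using c t by simp
qed

text \<open>The interface between the geometry and the growth of \<open>\<Phi>\<close>: of the
  integral conditions only a divergent sequence \<open>w\<close> subject to \<open>weight\<close> is
  retained. The map enters through Lipschitz bounds from above and below whose constants depend on
  the point.\<close>

locale weighted_bi_Lipschitz =
  fixes D D' :: "(real ^ 'n) set" and f g :: "real ^ 'n \<Rightarrow> real ^ 'n"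
    and \<Phi> :: "ennreal \<Rightarrow> ennreal" and w :: "nat \<Rightarrow> real"
  assumes card: "2 \<le> CARD('n)"
    and D: "is_domain D" "bounded D" "weakly_flat_boundary D"
    and D': "is_domain D'" "bounded D'" "weakly_flat_boundary D'"
    and h: "homeomorphism D D' f g"
    and up: "\<And>x. x \<in> D \<Longrightarrow> \<exists>B d. d > 0 \<and> (\<forall>z\<in>D. norm (z - x) < d \<longrightarrow> norm (f z - f x) \<le> B * norm (z - x))"
    and low: "\<And>x. x \<in> D \<Longrightarrow> \<exists>c d. c > 0 \<and> d > 0 \<and> (\<forall>z\<in>D. norm (z - x) < d \<longrightarrow> c * norm (z - x) \<le> norm (f z - f x))"
    and mono: "mono \<Phi>"
    and int: "(\<integral>\<^sup>+ x\<in>D. \<Phi> (outer_dilatation f x ^ (CARD('n) - 1)) \<partial>lebesgue) < \<infinity>"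
    and w0: "\<And>k. 0 \<le> w k"
    and div: "\<not> summable w"
    and weight: "\<And>k s. s * ennreal (w k ^ (CARD('n) - 1)) \<le> 1 + \<Phi> s * ennreal (exp (- real k))"
begin

definition Q :: "real ^ 'n \<Rightarrow> ennreal" where
  "Q x = outer_dilatation f x ^ (CARD('n) - 1)"

section \<open>Measurability and integrability of the dilatation\<close>

lemma open_D: "open D" and open_D': "open D'"
  using D(1) D'(1) by (auto simp: is_domain_def)

lemma continuous_f: "continuous_on D f" and continuous_g: "continuous_on D' g"
  using h by (auto simp: homeomorphism_def)

lemma outer_dilatation_top:
  assumes x: "x \<in> D" "\<not> (f differentiable (at x) \<and> det (matrix (frechet_derivative f (at x))) \<noteq> 0)"
  shows "outer_dilatation f x = \<infinity>"
proof -
  have "\<not> (f differentiable (at x) \<and> frechet_derivative f (at x) = (\<lambda>h. 0))"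
  proof
    assume "f differentiable (at x) \<and> frechet_derivative f (at x) = (\<lambda>h. 0)"
    then have "(f has_derivative (\<lambda>h. 0)) (at x)" by (metis frechet_derivative_works)
    with derivative_nonzero[OF open_D x(1) low[OF x(1)]] show False by blast
  qed
  then show ?thesis using x(2) by (auto simp: outer_dilatation_def Let_def)
qed

text \<open>On the regular set the operator norm is the stretch and the Jacobian a limit of
  difference quotients, both Borel; elsewhere in \<open>D\<close> the value is infinite.\<close>

lemma borel_measurable_outer_dilatation:
  "(\<lambda>x. outer_dilatation f x * indicator D x) \<in> borel_measurable borel"
proof -
  define A where "A x = frechet_derivative f (at x)" for x
  define Df where "Df = {x \<in> D. f differentiable (at x)}"
  define S where "S = {x \<in> Df. det (matrix (A x)) \<noteq> 0}"
  have Df: "Df \<in> sets borel" unfolding Df_def by (rule borel_differentiable_set[OF open_D continuous_f])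
  have derA: "(f has_derivative A x) (at x)" if "x \<in> Df" for x
    using that by (simp add: Df_def A_def frechet_derivative_works)
  have JD: "(\<lambda>x. indicator Df x * det (matrix (A x))) \<in> borel_measurable borel"
    by (rule borel_measurable_Jacobian[OF open_D continuous_f Df _ derA]) (auto simp: Df_def)
  have "S = {x \<in> space borel. indicator Df x * det (matrix (A x)) \<noteq> 0}"
    by (auto simp: S_def indicator_def)
  also have "\<dots> \<in> sets borel" using JD by measurable
  finally have S: "S \<in> sets borel" .
  define st where "st x = stretch D f x * indicator D x" for x
  have st: "st \<in> borel_measurable borel"
    unfolding st_def by (rule borel_measurable_stretch[OF open_D continuous_f])
  define O' where "O' x = ennreal (enn2real (st x) ^ CARD('n) / \<bar>indicator Df x * det (matrix (A x))\<bar>) * indicator S x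
      + top * indicator (D - S) x" for x
  have "D - S \<in> sets borel" using open_D S by auto
  then have "O' \<in> borel_measurable borel" unfolding O'_def using S st JD by measurable
  moreover have "outer_dilatation f x * indicator D x = O' x" for x
  proof (cases "x \<in> S")
    case True
    then have x: "x \<in> D" "x \<in> Df" "det (matrix (A x)) \<noteq> 0" by (auto simp: S_def Df_def)
    have "st x = ennreal (onorm (A x))"
      using stretch_eq_onorm[OF derA[OF x(2)] open_D x(1)] x(1) by (simp add: st_def)
    moreover have "0 \<le> onorm (A x)" using derA[OF x(2)] by (simp add: onorm_pos_le has_derivative_bounded_linear)
    ultimately show ?thesis
      using x True by (simp add: outer_dilatation_def Let_def A_def[symmetric] Df_def O'_def)
  next
    case False
    then show ?thesis
      using outer_dilatation_top[of x] by (auto simp: O'_def S_def Df_def A_def indicator_def)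
  qed
  ultimately show ?thesis by simp
qed

lemma measurable_Phi: "\<Phi> \<in> borel_measurable borel"
  using mono by (rule borel_measurable_mono_complete)

lemma measurable_Q: "(\<lambda>x. Q x * indicator D x) \<in> borel_measurable borel"
proof -
  have [measurable]: "D \<in> sets borel" using open_D by simp
  have "(\<lambda>x. (outer_dilatation f x * indicator D x) ^ (CARD('n) - 1) * indicator D x) \<in> borel_measurable borel"
    using borel_measurable_outer_dilatation open_D by measurable
  moreover have "(outer_dilatation f x * indicator D x) ^ (CARD('n) - 1) * indicator D x = Q x * indicator D x" for x
    by (auto simp: Q_def indicator_def)
  ultimately show ?thesis by simp
qed

lemma measurable_Phi_Q: "(\<lambda>x. \<Phi> (Q x) * indicator D x) \<in> borel_measurable borel"
proof -
  have [measurable]: "D \<in> sets borel" using open_D by simp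
  have "(\<lambda>x. \<Phi> (Q x * indicator D x) * indicator D x) \<in> borel_measurable borel"
    using measurable_compose[OF measurable_Q measurable_Phi] open_D by measurable
  moreover have "\<Phi> (Q x * indicator D x) * indicator D x = \<Phi> (Q x) * indicator D x" for x
    by (auto simp: indicator_def)
  ultimately show ?thesis by simp
qed

definition C :: ennreal where "C = (\<integral>\<^sup>+ x\<in>D. \<Phi> (Q x) \<partial>lebesgue)"

lemma C_finite: "C < \<infinity>"
  using int by (simp add: C_def Q_def)

text \<open>A single index with \<open>w k > 0\<close>, which exists because the series diverges,
  bounds \<open>Q\<close> by a constant times \<open>1 + \<Phi> Q\<close>, and \<open>D\<close> has
  finite measure.\<close>

lemma Q_integrable: "(\<integral>\<^sup>+ x\<in>D. Q x \<partial>lebesgue) < \<infinity>"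
proof -
  obtain k where k: "w k > 0"
  proof (rule ccontr)
    assume "\<not> thesis"
    then have "w = (\<lambda>_. 0)" using that w0 by (metis ext order.order_iff_strict)
    with div show False by simp
  qed
  define c where "c = ennreal (w k ^ (CARD('n) - 1))"
  define e where "e = ennreal (exp (- real k))"
  have c: "c \<noteq> 0" using k by (simp add: c_def)
  have leb: "emeasure lebesgue D < \<infinity>"
    using fmeasurableD2[OF lmeasurable_open[OF D(2) open_D]] by (simp add: less_top)
  have m1: "(\<lambda>x. indicator D x :: ennreal) \<in> borel_measurable lebesgue"
    using open_D by (intro borel_measurable_indicator) auto
  have m2: "(\<lambda>x. \<Phi> (Q x) * indicator D x) \<in> borel_measurable lebesgue"
    using measurable_Phi_Q by (intro measurable_completion) simp
  have m3: "(\<lambda>x. Q x * indicator D x) \<in> borel_measurable lebesgue"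
    using measurable_Q by (intro measurable_completion) simp
  have "c * (\<integral>\<^sup>+ x\<in>D. Q x \<partial>lebesgue) = (\<integral>\<^sup>+ x. c * (Q x * indicator D x) \<partial>lebesgue)"
    using m3 by (rule nn_integral_cmult[symmetric])
  also have "\<dots> \<le> (\<integral>\<^sup>+ x. indicator D x + e * (\<Phi> (Q x) * indicator D x) \<partial>lebesgue)"
    using weight[of "Q _" k] by (intro nn_integral_mono) (auto simp: c_def e_def indicator_def mult.commute)
  also have "\<dots> = emeasure lebesgue D + e * C"
    using m1 m2 open_D by (subst nn_integral_add) (auto simp: nn_integral_cmult C_def)
  also have "\<dots> < \<infinity>" using leb C_finite by (simp add: e_def ennreal_mult_less_top)
  finally have "c * (\<integral>\<^sup>+ x\<in>D. Q x \<partial>lebesgue) < \<infinity>" .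
  then show ?thesis using c by (auto simp: ennreal_mult_less_top)
qed

lemma regular_ae:
  "negligible {x \<in> D. \<not> (f differentiable (at x) \<and> det (matrix (frechet_derivative f (at x))) \<noteq> 0)}"
proof -
  have m3: "(\<lambda>x. Q x * indicator D x) \<in> borel_measurable lebesgue"
    using measurable_Q by (intro measurable_completion) simp
  define Z where "Z = {x \<in> space lebesgue. Q x * indicator D x = \<infinity>}"
  have "Z \<in> sets lebesgue" unfolding Z_def using m3 by measurable
  moreover have "AE x in lebesgue. x \<notin> Z"
    using nn_integral_PInf_AE[OF m3] Q_integrable by (auto simp: Z_def)
  ultimately have "negligible Z" by (simp add: negligible_iff_null_sets AE_iff_null_sets)
  then show ?thesis
  proof (rule negligible_subset)
    show "{x \<in> D. \<not> (f differentiable (at x) \<and> det (matrix (frechet_derivative f (at x))) \<noteq> 0)} \<subseteq> Z"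
    proof
      fix x assume x: "x \<in> {x \<in> D. \<not> (f differentiable (at x) \<and> det (matrix (frechet_derivative f (at x))) \<noteq> 0)}"
      then have "outer_dilatation f x = \<infinity>" by (intro outer_dilatation_top) auto
      \<comment> \<open>The exponent \<open>n - 1\<close> is at least 1; a zeroth power would lose
        the infinite value.\<close>
      moreover have "(top :: ennreal) ^ Suc m = top" for m
        by (induction m) (simp_all add: ennreal_top_mult)
      from this[of "CARD('n) - 2"] have "(top :: ennreal) ^ (CARD('n) - 1) = top"
        using card by (simp add: Suc_diff_Suc numeral_2_eq_2)
      ultimately show "x \<in> Z" using x by (simp add: Z_def Q_def)
    qed
  qed
qed

section \<open>Modulus of image families across concentric rings\<close>

lemma modulus_image:
  fixes v \<sigma> :: "real ^ 'n \<Rightarrow> real"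
  assumes "\<sigma> \<in> borel_measurable borel" "\<And>x. 0 \<le> \<sigma> x"
    and "\<And>x e. x \<in> D \<Longrightarrow> e > 0 \<Longrightarrow>
      \<exists>d>0. \<forall>z\<in>D. norm (z - x) < d \<longrightarrow> \<bar>v z - v x\<bar> \<le> (\<sigma> x + e) * norm (z - x)"
    and "E \<subseteq> D" "F \<subseteq> D" "\<And>a b. a \<in> E \<Longrightarrow> b \<in> F \<Longrightarrow> v b - v a \<ge> 1"
  shows "modulus (joining_paths (f ` E) (f ` F) D') \<le> (\<integral>\<^sup>+ x\<in>D. ennreal (\<sigma> x) ^ CARD('n) * Q x \<partial>lebesgue)"
  unfolding Q_def by (rule modulus_image_le[OF open_D open_D' h up low regular_ae assms])

text \<open>Radii whose balls have \<open>exp (- k)\<close> times the volume of the unit ball, to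
  cancel the factor \<open>exp k\<close> that appears when \<open>weight\<close> is applied.\<close>

definition r :: "nat \<Rightarrow> real" where "r k = exp (- real k / real CARD('n))"

text \<open>The relative thickness of a ring, the same for all \<open>k\<close>:
  \<open>r k - r (Suc k) = \<kappa> * r k\<close>.\<close>

definition \<kappa> :: real where "\<kappa> = 1 - exp (- 1 / real CARD('n))"

lemma r_pos: "r k > 0" and r_Suc: "r (Suc k) = (1 - \<kappa>) * r k" and \<kappa>: "0 < \<kappa>"
  and r_power: "r k ^ CARD('n) = exp (- real k)"
proof -
  show "r k > 0" by (simp add: r_def)
  have "r (Suc k) = exp (- 1 / real CARD('n) + - real k / real CARD('n))"
    by (simp add: r_def add_divide_distrib diff_divide_distrib)
  then show "r (Suc k) = (1 - \<kappa>) * r k" unfolding exp_add by (simp add: \<kappa>_def r_def)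
  show "0 < \<kappa>" by (simp add: \<kappa>_def)
  show "r k ^ CARD('n) = exp (- real k)" by (simp add: r_def exp_of_nat_mult[symmetric])
qed

lemma r_mono: "i \<le> j \<Longrightarrow> r j \<le> r i"
  by (simp add: r_def divide_right_mono)

lemma r_tendsto_0: "r \<longlonglongrightarrow> 0"
proof -
  have "exp (- 1 / real CARD('n)) < 1" by simp
  then have "(\<lambda>k. exp (- 1 / real CARD('n)) ^ k) \<longlonglongrightarrow> 0" by (intro LIMSEQ_realpow_zero) auto
  moreover have "exp (- 1 / real CARD('n)) ^ k = r k" for k
    by (simp add: r_def exp_of_nat_mult[symmetric])
  ultimately show ?thesis by simp
qed

text \<open>The function \<open>v\<close> climbs by \<open>q * \<kappa> * w k\<close> across the
  k-th ring, so \<open>q = 1 / (\<kappa> * S)\<close> makes the total increment 1. The further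
  factor \<open>S\<close> sums the one power of \<open>w k\<close> per ring that
  \<open>weight\<close> does not consume.\<close>

lemma ring_modulus:
  assumes S: "(\<Sum>k\<in>{K0..<K}. w k) = S" "S > 0"
    and E: "E \<subseteq> D \<inter> ball x0 (r K)" and F: "F \<subseteq> D - ball x0 (r K0)"
  shows "modulus (joining_paths (f ` E) (f ` F) D')
    \<le> ennreal ((1 / (\<kappa> * S)) ^ CARD('n) * S) * (ennreal (unit_ball_vol (real CARD('n))) + C)"
proof -
  define n where "n = CARD('n)"
  have n: "n \<ge> 2" using card by (simp add: n_def)
  define I where "I = {K0..<K}"
  define q where "q = 1 / (\<kappa> * S)"
  have q: "q > 0" using \<kappa> S by (simp add: q_def)
  \<comment> \<open>The distance to \<open>x0\<close>, cut off so that it varies only in the k-th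
    ring, where it rises by \<open>\<kappa> * r k\<close>.\<close>
  define \<psi> where "\<psi> k x = max 0 (min (dist x x0) (r k) - r (Suc k))" for k x
  define v where "v x = q * (\<Sum>k\<in>I. w k / r k * \<psi> k x)" for x
  \<comment> \<open>The rings are closed so that the slope bound holds at every point, including the
    dividing spheres; neighbouring indicators overlap there, on a null set.\<close>
  define a where "a k x = (if r (Suc k) \<le> dist x x0 \<and> dist x x0 \<le> r k then 1 else (0::real))" for k x
  define \<sigma> where "\<sigma> x = q * (\<Sum>k\<in>I. w k / r k * a k x)" for x
  have wr: "0 \<le> w k / r k" for k using w0[of k] r_pos[of k] by simp
  have am: "a k \<in> borel_measurable borel" for k
    unfolding a_def by measurable
  have \<sigma>m: "\<sigma> \<in> borel_measurable borel"
    unfolding \<sigma>_def using am by measurable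
  have \<sigma>0: "0 \<le> \<sigma> x" for x
    unfolding \<sigma>_def using q wr by (intro mult_nonneg_nonneg sum_nonneg) (auto simp: a_def)
  have rS: "r (Suc k) < r k" for k using r_Suc[of k] \<kappa> r_pos[of k] by simp
  have near: "\<forall>\<^sub>F z in nhds x. \<bar>\<psi> k z - \<psi> k x\<bar> \<le> a k x * norm (z - x)" for k x
  proof -
    have cont: "((\<lambda>z. dist z x0) \<longlongrightarrow> dist x x0) (nhds x)" by (intro tendsto_intros filterlim_ident)
    consider "dist x x0 < r (Suc k)" | "dist x x0 > r k" | "r (Suc k) \<le> dist x x0" "dist x x0 \<le> r k"
      by linarith
    then show ?thesis
    proof cases
      case 1
      then have "\<forall>\<^sub>F z in nhds x. dist z x0 < r (Suc k)" using cont by (rule order_tendstoD(2)[rotated])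
      then show ?thesis by eventually_elim (use 1 rS[of k] in \<open>auto simp: \<psi>_def a_def\<close>)
    next
      case 2
      then have "\<forall>\<^sub>F z in nhds x. r k < dist z x0" using cont by (rule order_tendstoD(1)[rotated])
      then show ?thesis by eventually_elim (use 2 rS[of k] in \<open>auto simp: \<psi>_def a_def\<close>)
    next
      case 3
      have "\<bar>\<psi> k z - \<psi> k x\<bar> \<le> \<bar>dist z x0 - dist x x0\<bar>" for z unfolding \<psi>_def by linarith
      also have "\<bar>dist z x0 - dist x x0\<bar> \<le> norm (z - x)" for z
        using norm_triangle_ineq3[of "z - x0" "x - x0"] by (simp add: dist_norm)
      finally show ?thesis using 3 by (auto simp: a_def intro: always_eventually)
    qed
  qed
  have lip: "\<exists>d>0. \<forall>z\<in>D. norm (z - x) < d \<longrightarrow> \<bar>v z - v x\<bar> \<le> (\<sigma> x + e) * norm (z - x)" if "e > 0" for x e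
  proof -
    have "\<forall>\<^sub>F z in nhds x. \<forall>k\<in>I. \<bar>\<psi> k z - \<psi> k x\<bar> \<le> a k x * norm (z - x)"
      using near by (intro eventually_ball_finite) (auto simp: I_def)
    then obtain d where d: "d > 0" "\<And>z. dist z x < d \<Longrightarrow> \<forall>k\<in>I. \<bar>\<psi> k z - \<psi> k x\<bar> \<le> a k x * norm (z - x)"
      unfolding eventually_nhds_metric by blast
    have "\<bar>v z - v x\<bar> \<le> (\<sigma> x + e) * norm (z - x)" if z: "norm (z - x) < d" for z
    proof -
      have "v z - v x = q * (\<Sum>k\<in>I. w k / r k * (\<psi> k z - \<psi> k x))"
        by (simp add: v_def sum_subtractf right_diff_distrib)
      then have "\<bar>v z - v x\<bar> = q * \<bar>\<Sum>k\<in>I. w k / r k * (\<psi> k z - \<psi> k x)\<bar>"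
        using q by (simp add: abs_mult)
      also have "\<dots> \<le> q * (\<Sum>k\<in>I. \<bar>w k / r k * (\<psi> k z - \<psi> k x)\<bar>)"
        using q by (intro mult_left_mono sum_abs) auto
      also have "\<dots> \<le> q * (\<Sum>k\<in>I. w k / r k * (a k x * norm (z - x)))"
      proof (intro mult_left_mono sum_mono)
        fix k assume "k \<in> I"
        then have "\<bar>\<psi> k z - \<psi> k x\<bar> \<le> a k x * norm (z - x)" using d(2)[of z] z by (simp add: dist_norm)
        then have "w k / r k * \<bar>\<psi> k z - \<psi> k x\<bar> \<le> w k / r k * (a k x * norm (z - x))"
          using wr by (rule mult_left_mono)
        then show "\<bar>w k / r k * (\<psi> k z - \<psi> k x)\<bar> \<le> w k / r k * (a k x * norm (z - x))"
          unfolding abs_mult using wr[of k] by (simp only: abs_of_nonneg)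
      qed (use q in simp)
      also have "\<dots> = \<sigma> x * norm (z - x)"
        by (simp add: \<sigma>_def sum_distrib_right mult.assoc)
      also have "\<dots> \<le> (\<sigma> x + e) * norm (z - x)" using that \<open>e > 0\<close> by (intro mult_right_mono) auto
      finally show ?thesis .
    qed
    with d(1) show ?thesis by blast
  qed
  have vF: "v b = 1" if "b \<in> F" for b
  proof -
    have "\<psi> k b = \<kappa> * r k" if "k \<in> I" for k
    proof -
      have "dist b x0 \<ge> r K0" using \<open>b \<in> F\<close> F by (auto simp: dist_commute)
      moreover have "r k \<le> r K0" using that by (intro r_mono) (simp add: I_def)
      ultimately have "min (dist b x0) (r k) = r k" by simp
      moreover have "r k - r (Suc k) = \<kappa> * r k" by (simp add: r_Suc algebra_simps)
      moreover have "0 \<le> \<kappa> * r k" using \<kappa> r_pos[of k] by simp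
      ultimately show ?thesis by (simp add: \<psi>_def)
    qed
    then have "(\<Sum>k\<in>I. w k / r k * \<psi> k b) = (\<Sum>k\<in>I. w k * \<kappa>)"
      using r_pos by (intro sum.cong) (auto simp: less_imp_neq[symmetric])
    also have "\<dots> = S * \<kappa>" using S(1) by (simp add: I_def flip: sum_distrib_right)
    finally show ?thesis using \<kappa> S(2) by (simp add: v_def q_def)
  qed
  have vE: "v b = 0" if "b \<in> E" for b
  proof -
    have "\<psi> k b = 0" if "k \<in> I" for k
    proof -
      have "dist b x0 < r K" using \<open>b \<in> E\<close> E by (auto simp: dist_commute)
      moreover have "r K \<le> r (Suc k)" using that by (intro r_mono) (simp add: I_def)
      ultimately show ?thesis by (simp add: \<psi>_def)
    qed
    then show ?thesis by (simp add: v_def)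
  qed
  have "modulus (joining_paths (f ` E) (f ` F) D') \<le> (\<integral>\<^sup>+ x\<in>D. ennreal (\<sigma> x) ^ n * Q x \<partial>lebesgue)"
    unfolding n_def
    by (rule modulus_image[OF \<sigma>m \<sigma>0 lip]) (use E F vE vF in auto)
  also have "\<dots> \<le> (\<integral>\<^sup>+ x. ennreal (q ^ n) * (\<Sum>k\<in>I. ennreal (w k) *
      (ennreal (exp (real k)) * indicator (ball x0 (r k)) x + \<Phi> (Q x) * indicator D x)) \<partial>lebesgue)"
  proof (rule nn_integral_mono_AE)
    \<comment> \<open>Off the dividing spheres at most one ring is active, so the n-th power of the
      sum is the n-th power of a single term.\<close>
    have "AE x in lebesgue. \<forall>k. x \<notin> sphere x0 (r k)"
      unfolding AE_all_countable
      using negligible_sphere by (intro allI AE_not_in) (simp add: negligible_iff_null_sets)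
    then show "AE x in lebesgue. ennreal (\<sigma> x) ^ n * Q x * indicator D x \<le> ennreal (q ^ n) * (\<Sum>k\<in>I. ennreal (w k) *
      (ennreal (exp (real k)) * indicator (ball x0 (r k)) x + \<Phi> (Q x) * indicator D x))"
    proof eventually_elim
      case (elim x)
      have off: "dist x x0 \<noteq> r k" for k using elim by (auto simp: dist_commute)
      show ?case
      proof (cases "x \<in> D \<and> (\<exists>j\<in>I. a j x \<noteq> 0)")
        case True
        then obtain j where j: "j \<in> I" "a j x \<noteq> 0" and xD: "x \<in> D" by blast
        have tj: "r (Suc j) < dist x x0" "dist x x0 < r j"
          using j(2) off[of j] off[of "Suc j"] by (auto simp: a_def less_le split: if_splits)
        have other: "a k x = 0" if "k \<noteq> j" for k
        proof (cases "k < j")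
          case True
          then have "r j \<le> r (Suc k)" by (intro r_mono) simp
          then show ?thesis using tj by (simp add: a_def)
        next
          case False
          then have "r k \<le> r (Suc j)" using that by (intro r_mono) simp
          then show ?thesis using tj by (simp add: a_def)
        qed
        have "(\<Sum>k\<in>I. w k / r k * a k x) = w j / r j * a j x"
          using j(1) other by (intro sum.remove[THEN trans]) (auto simp: I_def intro!: sum.neutral)
        also have "a j x = 1" using j(2) by (auto simp: a_def split: if_splits)
        finally have "\<sigma> x = q * (w j / r j)" by (simp add: \<sigma>_def)
        then have "\<sigma> x ^ n = q ^ n * (w j ^ n * (1 / r j ^ n))"
          by (simp add: power_mult_distrib power_divide)
        also have "1 / r j ^ n = exp (real j)" using r_power[of j] by (simp add: n_def exp_minus inverse_eq_divide)
        also have "w j ^ n = w j * w j ^ (n - 1)" using n by (simp add: power_eq_if)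
        finally have "\<sigma> x ^ n = q ^ n * (w j * (exp (real j) * w j ^ (n - 1)))" by (simp add: mult_ac)
        then have "ennreal (\<sigma> x) ^ n * Q x
            = ennreal (q ^ n) * (ennreal (w j) * (ennreal (exp (real j)) * (Q x * ennreal (w j ^ (n - 1)))))"
          using \<sigma>0[of x] q w0[of j] by (simp add: ennreal_power ennreal_mult mult_ac)
        also have "\<dots> \<le> ennreal (q ^ n) * (ennreal (w j) * (ennreal (exp (real j)) * (1 + \<Phi> (Q x) * ennreal (exp (- real j)))))"
          using weight[of "Q x" j] by (intro mult_left_mono) (auto simp: n_def)
        also have "ennreal (exp (real j)) * (1 + \<Phi> (Q x) * ennreal (exp (- real j))) = ennreal (exp (real j)) + \<Phi> (Q x)"
        proof -
          have "ennreal (exp (real j)) * ennreal (exp (- real j)) = 1"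
            by (simp flip: ennreal_mult add: exp_minus)
          then show ?thesis by (metis distrib_left mult.commute mult.left_commute mult.right_neutral)
        qed
        also have "ennreal (w j) * (ennreal (exp (real j)) + \<Phi> (Q x))
            = ennreal (w j) * (ennreal (exp (real j)) * indicator (ball x0 (r j)) x + \<Phi> (Q x) * indicator D x)"
          using tj xD by (simp add: dist_commute)
        also have "\<dots> \<le> (\<Sum>k\<in>I. ennreal (w k) *
            (ennreal (exp (real k)) * indicator (ball x0 (r k)) x + \<Phi> (Q x) * indicator D x))"
          using j(1) by (intro member_le_sum) (auto simp: I_def)
        finally show ?thesis using xD by (simp add: mult_left_mono)
      next
        case False
        show ?thesis
        proof (cases "x \<in> D")
          case True
          with False have "\<sigma> x = 0" by (auto simp: \<sigma>_def intro!: sum.neutral)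
          then show ?thesis using n by (simp add: power_0_left)
        qed simp
      qed
    qed
  qed
  also have "\<dots> = ennreal (q ^ n) * (\<Sum>k\<in>I. ennreal (w k) *
      (ennreal (exp (real k)) * emeasure lebesgue (ball x0 (r k)) + C))"
  proof -
    have m2: "(\<lambda>x. \<Phi> (Q x) * indicator D x) \<in> borel_measurable lebesgue"
      using measurable_Phi_Q by (intro measurable_completion) simp
    have m1: "(\<lambda>x. indicator (ball x0 (r k)) x :: ennreal) \<in> borel_measurable lebesgue" for k
      by (intro borel_measurable_indicator) auto
    show ?thesis
      using m1 m2 by (simp add: nn_integral_cmult nn_integral_sum nn_integral_add C_def del: nn_integral_completion)
  qed
  also have "\<dots> = ennreal (q ^ n) * (\<Sum>k\<in>I. ennreal (w k) * (ennreal (unit_ball_vol (real CARD('n))) + C))"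
  proof -
    have "ennreal (exp (real k)) * emeasure lebesgue (ball x0 (r k)) = ennreal (unit_ball_vol (real CARD('n)))" for k
    proof -
      have "emeasure lebesgue (ball x0 (r k)) = ennreal (unit_ball_vol (real CARD('n)) * r k ^ CARD('n))"
        using emeasure_ball[of "r k" x0] r_pos[of k] by (simp add: less_imp_le)
      then show ?thesis by (simp add: r_power exp_minus flip: ennreal_mult')
    qed
    then show ?thesis by simp
  qed
  also have "\<dots> = ennreal (q ^ n * S) * (ennreal (unit_ball_vol (real CARD('n))) + C)"
    using S w0 q by (simp add: I_def ennreal_mult mult.assoc flip: sum_distrib_right)
  finally show ?thesis by (simp add: q_def n_def)
qed

text \<open>The bound of \<open>ring_modulus\<close> is
  \<open>c * (1 / \<kappa>) ^ n * S / S ^ n\<close>. Since the dimension is at least 2 and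
  \<open>S \<ge> 1\<close>, it is at most a constant divided by \<open>S\<close>, and divergence of
  the weights makes \<open>S\<close> as large as desired.\<close>

lemma small_ring_modulus:
  obtains K where "\<And>E F. E \<subseteq> D \<inter> ball x0 (r K) \<Longrightarrow> F \<subseteq> D - ball x0 (r K0) \<Longrightarrow>
    modulus (joining_paths (f ` E) (f ` F) D') < 1"
proof -
  define n where "n = CARD('n)"
  define c where "c = unit_ball_vol (real CARD('n)) + enn2real C"
  have C: "ennreal (unit_ball_vol (real CARD('n))) + C = ennreal c"
    using C_finite by (simp add: c_def less_top)
  have c: "c \<ge> 0" by (simp add: c_def)
  \<comment> \<open>\<open>S \<ge> 1\<close> gives \<open>S ^ 2 \<le> S ^ n\<close>; the other entry
    brings the modulus down to at most \<open>1 / 2\<close>.\<close>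
  define B where "B = max 1 (2 * c * (1 / \<kappa>) ^ n)"
  have "\<exists>K. (\<Sum>k\<in>{K0..<K}. w k) \<ge> B"
  proof (rule ccontr)
    assume "\<not> ?thesis"
    then have lt: "(\<Sum>k\<in>{K0..<K}. w k) \<le> B" for K by (meson less_imp_le not_less)
    have "(\<Sum>k<K. w k) \<le> (\<Sum>k<K0. w k) + B" for K
    proof -
      have "(\<Sum>k<K. w k) \<le> (\<Sum>k\<in>{..<K0} \<union> {K0..<K}. w k)"
        using w0 by (intro sum_mono2) auto
      also have "\<dots> = (\<Sum>k<K0. w k) + (\<Sum>k\<in>{K0..<K}. w k)" by (intro sum.union_disjoint) auto
      finally show ?thesis using lt[of K] by linarith
    qed
    then have "summable w" using w0 by (intro summableI_nonneg_bounded) auto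
    with div show False by simp
  qed
  then obtain K where K: "(\<Sum>k\<in>{K0..<K}. w k) \<ge> B" by blast
  define S where "S = (\<Sum>k\<in>{K0..<K}. w k)"
  have S: "S \<ge> 1" "S \<ge> 2 * c * (1 / \<kappa>) ^ n" using K by (auto simp: S_def B_def)
  have small: "(1 / (\<kappa> * S)) ^ n * S * c < 1"
  proof -
    have "S ^ 2 \<le> S ^ n" using S(1) card by (intro power_increasing) (auto simp: n_def)
    then have "(1 / (\<kappa> * S)) ^ n * S * c \<le> (1 / \<kappa>) ^ n * c * (S / S ^ 2)"
    proof -
      have "S / S ^ n \<le> S / S ^ 2" using S(1) \<open>S ^ 2 \<le> S ^ n\<close> by (intro divide_left_mono) auto
      then have "(1 / \<kappa>) ^ n * c * (S / S ^ n) \<le> (1 / \<kappa>) ^ n * c * (S / S ^ 2)"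
        using c \<kappa> by (intro mult_left_mono) auto
      then show ?thesis by (simp add: power_mult_distrib power_divide mult_ac)
    qed
    also have "\<dots> = ((1 / \<kappa>) ^ n * c) / S" using S(1) by (simp add: power2_eq_square)
    also have "\<dots> \<le> (S / 2) / S" 
    proof (rule divide_right_mono)
      have "2 * ((1 / \<kappa>) ^ n * c) \<le> S" using S(2) by (simp only: mult_ac)
      then show "(1 / \<kappa>) ^ n * c \<le> S / 2" by linarith
    qed (use S(1) in simp)
    also have "\<dots> = 1 / 2" using S(1) by simp
    finally show ?thesis by simp
  qed
  show ?thesis
  proof (rule that[of K])
    fix E F assume EF: "E \<subseteq> D \<inter> ball x0 (r K)" "F \<subseteq> D - ball x0 (r K0)"
    have "modulus (joining_paths (f ` E) (f ` F) D') \<le> ennreal ((1 / (\<kappa> * S)) ^ n * S) * ennreal c"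
      using ring_modulus[OF S_def[symmetric] _ EF] S(1) unfolding C n_def by simp
    also have "\<dots> = ennreal ((1 / (\<kappa> * S)) ^ n * S * c)" using S(1) \<kappa> c by (simp add: ennreal_mult)
    also have "\<dots> < 1" using small by (simp add: ennreal_less_one_iff)
    finally show "modulus (joining_paths (f ` E) (f ` F) D') < 1" .
  qed
qed

section \<open>Uniqueness of cluster values at the boundary\<close>

lemma path_image_continuum:
  assumes "path p" "path_image p \<subseteq> D"
  shows "compact (f ` path_image p)" "connected (f ` path_image p)" "f ` path_image p \<subseteq> D'"
proof -
  have "continuous_on (path_image p) f" by (rule continuous_on_subset[OF continuous_f assms(2)])
  then show "compact (f ` path_image p)" "connected (f ` path_image p)"
    using assms(1) by (simp_all add: compact_continuous_image compact_path_image
        connected_continuous_image connected_path_image)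
  show "f ` path_image p \<subseteq> D'" using assms(2) h by (auto simp: homeomorphism_def)
qed

lemma cluster_f:
  assumes x0: "x0 \<in> closure D - D" and a: "\<And>n::nat. a n \<in> D" "a \<longlonglongrightarrow> x0" and b: "\<And>n. b n \<in> D" "b \<longlonglongrightarrow> x0"
    and fa: "(\<lambda>n. f (a n)) \<longlonglongrightarrow> y1" and fb: "(\<lambda>n. f (b n)) \<longlonglongrightarrow> y2"
  shows "y1 = y2"
proof (rule ccontr)
  assume "y1 \<noteq> y2"
  \<comment> \<open>Half the distance: the balls of radius \<open>\<delta>\<close> about
    \<open>y1\<close> and \<open>y2\<close> are disjoint, so \<open>f (b n)\<close> is eventually
    outside \<open>U\<close>.\<close>
  define \<delta> where "\<delta> = dist y1 y2 / 2"
  have \<delta>: "\<delta> > 0" using \<open>y1 \<noteq> y2\<close> by (simp add: \<delta>_def)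
  have x0': "x0 \<notin> D" "x0 \<in> frontier D" using x0 open_D by (auto simp: frontier_def interior_open)
  have y1: "y1 \<in> frontier D'" by (rule homeomorphism_boundary_limit[OF h open_D' x0'(1) a fa])
  define U where "U = ball y1 \<delta>"
  have "open U" "y1 \<in> U" using \<delta> by (auto simp: U_def)
  then obtain V where V: "open V" "y1 \<in> V" "V \<subseteq> U"
    and Vmod: "\<And>E F. compact E \<Longrightarrow> connected E \<Longrightarrow> E \<subseteq> D' \<Longrightarrow> E \<inter> V \<noteq> {} \<Longrightarrow> E - U \<noteq> {} \<Longrightarrow>
      compact F \<Longrightarrow> connected F \<Longrightarrow> F \<subseteq> D' \<Longrightarrow> F \<inter> V \<noteq> {} \<Longrightarrow> F - U \<noteq> {} \<Longrightarrow>
      ennreal 1 \<le> modulus (joining_paths E F D')"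
    using weakly_flat_boundaryE[OF D'(3) y1, of U 1] by (metis zero_less_one)
  have evA: "\<forall>\<^sub>F n in sequentially. f (a n) \<in> V" by (rule topological_tendstoD[OF fa V(1,2)])
  have "\<forall>\<^sub>F n in sequentially. f (b n) \<in> ball y2 \<delta>"
    using \<delta> by (intro topological_tendstoD[OF fb]) auto
  then have evB: "\<forall>\<^sub>F n in sequentially. f (b n) \<notin> U"
  proof eventually_elim
    case (elim n)
    then have "dist y1 y2 < dist y1 (f (b n)) + \<delta>"
      using dist_triangle[of y1 y2 "f (b n)"] by (simp add: dist_commute)
    then show ?case by (simp add: U_def \<delta>_def)
  qed
  \<comment> \<open>The index \<open>N\<close> fixes the continuum \<open>F\<close> before the rings
    are chosen. Its image runs from \<open>V\<close> to the complement of \<open>U\<close>, and so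
    will the image of the later continuum \<open>E\<close> near \<open>x0\<close>.\<close>
  obtain N where N: "f (a N) \<in> V" "f (b N) \<notin> U"
    using eventually_happens'[OF sequentially_bot eventually_conj[OF evA evB]] by blast
  have "path_connected D" using D(1) by (simp add: is_domain_def connected_open_path_connected)
  then obtain p where p: "path p" "path_image p \<subseteq> D" "pathstart p = a N" "pathfinish p = b N"
    using a(1) b(1) unfolding path_connected_def by meson
  define F where "F = path_image p"
  have Fc: "closed F" using p(1) by (simp add: F_def closed_path_image)
  have aF: "a N \<in> F" "b N \<in> F" using pathstart_in_path_image[of p] pathfinish_in_path_image[of p] p by (auto simp: F_def)
  have "x0 \<in> - F" using x0' p(2) by (auto simp: F_def)
  then obtain \<rho> where \<rho>: "\<rho> > 0" "ball x0 \<rho> \<subseteq> - F" using Fc by (meson open_Compl open_contains_ball)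
  obtain K0 where K0: "r K0 < \<rho>"
    using order_tendstoD(2)[OF r_tendsto_0 \<rho>(1)] by (meson eventually_happens' sequentially_bot)
  obtain K where K: "\<And>E F. E \<subseteq> D \<inter> ball x0 (r K) \<Longrightarrow> F \<subseteq> D - ball x0 (r K0) \<Longrightarrow>
    modulus (joining_paths (f ` E) (f ` F) D') < 1"
    using small_ring_modulus[of x0 K0] by blast
  obtain W where W: "open W" "x0 \<in> W" "\<And>x y. x \<in> W \<inter> D \<Longrightarrow> y \<in> W \<inter> D \<Longrightarrow>
       \<exists>p. path p \<and> path_image p \<subseteq> D \<inter> ball x0 (r K) \<and> pathstart p = x \<and> pathfinish p = y"
    using weakly_flat_locally_connected[OF D x0'(2) r_pos[of K]] by blast
  have evW: "\<forall>\<^sub>F n in sequentially. a n \<in> W \<and> b n \<in> W"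
    by (rule eventually_conj) (rule topological_tendstoD[OF a(2) W(1,2)], rule topological_tendstoD[OF b(2) W(1,2)])
  obtain m where m: "f (a m) \<in> V" "f (b m) \<notin> U" "a m \<in> W" "b m \<in> W"
    using eventually_happens'[OF sequentially_bot eventually_conj[OF eventually_conj[OF evA evB] evW]] by blast
  obtain p' where p': "path p'" "path_image p' \<subseteq> D \<inter> ball x0 (r K)" "pathstart p' = a m" "pathfinish p' = b m"
    using W(3)[of "a m" "b m"] m a(1) b(1) by blast
  define E where "E = path_image p'"
  have aE: "a m \<in> E" "b m \<in> E" using pathstart_in_path_image[of p'] pathfinish_in_path_image[of p'] p' by (auto simp: E_def)
  have "path_image p' \<subseteq> D" using p'(2) by blast
  then have "ennreal 1 \<le> modulus (joining_paths (f ` E) (f ` F) D')"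
    using path_image_continuum[OF p'(1)] path_image_continuum[OF p(1,2)] aE aF m N
    by (intro Vmod) (auto simp: E_def F_def)
  moreover have "modulus (joining_paths (f ` E) (f ` F) D') < 1"
  proof (rule K)
    show "E \<subseteq> D \<inter> ball x0 (r K)" using p'(2) by (simp add: E_def)
    show "F \<subseteq> D - ball x0 (r K0)" 
      using p(2) \<rho>(2) subset_ball[of "r K0" \<rho> x0] K0 unfolding F_def by force
  qed
  ultimately show False by simp
qed

lemma cluster_g:
  assumes y0: "y0 \<in> closure D' - D'" and a: "\<And>n::nat. a n \<in> D'" "a \<longlonglongrightarrow> y0" and b: "\<And>n. b n \<in> D'" "b \<longlonglongrightarrow> y0"
    and ga: "(\<lambda>n. g (a n)) \<longlonglongrightarrow> x1" and gb: "(\<lambda>n. g (b n)) \<longlonglongrightarrow> x2"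
  shows "x1 = x2"
proof (rule ccontr)
  assume "x1 \<noteq> x2"
  \<comment> \<open>A quarter of the distance: between points of the balls of radius
    \<open>\<delta>\<close> about \<open>x1\<close> and \<open>x2\<close> the distance to
    \<open>x1\<close> increases by at least \<open>2 * \<delta>\<close>, which the factor
    \<open>c\<close> turns into 1.\<close>
  define \<delta> where "\<delta> = dist x1 x2 / 4"
  have \<delta>: "\<delta> > 0" "dist x1 x2 = 4 * \<delta>" using \<open>x1 \<noteq> x2\<close> by (simp_all add: \<delta>_def)
  have y0': "y0 \<notin> D'" "y0 \<in> frontier D'" using y0 open_D' by (auto simp: frontier_def interior_open)
  have h': "homeomorphism D' D g f" using h by (rule homeomorphism_symD)
  have gD: "g (a n) \<in> D" "g (b n) \<in> D" "f (g (a n)) = a n" "f (g (b n)) = b n" for n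
    using h a(1) b(1) by (auto simp: homeomorphism_def)
  have x1: "x1 \<in> frontier D" by (rule homeomorphism_boundary_limit[OF h' open_D y0'(1) a ga])
  have x2: "x2 \<in> frontier D" by (rule homeomorphism_boundary_limit[OF h' open_D y0'(1) b gb])
  obtain W1 where W1: "open W1" "x1 \<in> W1" "\<And>x y. x \<in> W1 \<inter> D \<Longrightarrow> y \<in> W1 \<inter> D \<Longrightarrow>
       \<exists>p. path p \<and> path_image p \<subseteq> D \<inter> ball x1 \<delta> \<and> pathstart p = x \<and> pathfinish p = y"
    using weakly_flat_locally_connected[OF D x1 \<delta>(1)] by blast
  obtain W2 where W2: "open W2" "x2 \<in> W2" "\<And>x y. x \<in> W2 \<inter> D \<Longrightarrow> y \<in> W2 \<inter> D \<Longrightarrow>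
       \<exists>p. path p \<and> path_image p \<subseteq> D \<inter> ball x2 \<delta> \<and> pathstart p = x \<and> pathfinish p = y"
    using weakly_flat_locally_connected[OF D x2 \<delta>(1)] by blast
  have evW: "\<forall>\<^sub>F n in sequentially. g (a n) \<in> W1 \<and> g (b n) \<in> W2"
    by (rule eventually_conj) (rule topological_tendstoD[OF ga W1(1,2)], rule topological_tendstoD[OF gb W2(1,2)])
  obtain N where N: "g (a N) \<in> W1" "g (b N) \<in> W2"
    using eventually_happens'[OF sequentially_bot evW] by blast
  define c where "c = 1 / (2 * \<delta>)"
  have c: "c > 0" using \<delta> by (simp add: c_def)
  define I where "I = (\<integral>\<^sup>+ x\<in>D. ennreal c ^ CARD('n) * Q x \<partial>lebesgue)"
  have m3: "(\<lambda>x. Q x * indicator D x) \<in> borel_measurable lebesgue"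
    using measurable_Q by (intro measurable_completion) simp
  have "I = ennreal c ^ CARD('n) * (\<integral>\<^sup>+ x\<in>D. Q x \<partial>lebesgue)"
    unfolding I_def mult.assoc using m3 by (rule nn_integral_cmult)
  also have "\<dots> < \<infinity>" using Q_integrable c by (simp add: ennreal_mult_less_top ennreal_power)
  finally obtain P where P: "I < ennreal P" "P > 0"
    by (metis ennreal_Ex_less_of_nat infinity_ennreal_def ennreal_of_nat_eq_real_of_nat
        gr_zeroI not_less_zero of_nat_0 of_nat_0_less_iff)
  \<comment> \<open>With \<open>U\<close> the complement of two points, leaving \<open>U\<close>
    just means containing \<open>a N\<close> or \<open>b N\<close>, which the image continua do by
    construction.\<close>
  define U where "U = - {a N, b N}"
  have "open U" "y0 \<in> U" using a(1)[of N] b(1)[of N] y0' by (auto simp: U_def intro!: open_Compl)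
  then obtain V where V: "open V" "y0 \<in> V" "V \<subseteq> U"
    and Vmod: "\<And>E F. compact E \<Longrightarrow> connected E \<Longrightarrow> E \<subseteq> D' \<Longrightarrow> E \<inter> V \<noteq> {} \<Longrightarrow> E - U \<noteq> {} \<Longrightarrow>
      compact F \<Longrightarrow> connected F \<Longrightarrow> F \<subseteq> D' \<Longrightarrow> F \<inter> V \<noteq> {} \<Longrightarrow> F - U \<noteq> {} \<Longrightarrow>
      ennreal P \<le> modulus (joining_paths E F D')"
    using weakly_flat_boundaryE[OF D'(3) y0'(2) _ _ P(2), of U] by metis
  have evV: "\<forall>\<^sub>F n in sequentially. a n \<in> V \<and> b n \<in> V"
    by (rule eventually_conj) (rule topological_tendstoD[OF a(2) V(1,2)], rule topological_tendstoD[OF b(2) V(1,2)])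
  obtain m where m: "g (a m) \<in> W1" "g (b m) \<in> W2" "a m \<in> V" "b m \<in> V"
    using eventually_happens'[OF sequentially_bot eventually_conj[OF evW evV]] by blast
  obtain p where p: "path p" "path_image p \<subseteq> D \<inter> ball x1 \<delta>" "pathstart p = g (a m)" "pathfinish p = g (a N)"
    using W1(3)[of "g (a m)" "g (a N)"] m N gD by blast
  obtain p' where p': "path p'" "path_image p' \<subseteq> D \<inter> ball x2 \<delta>" "pathstart p' = g (b m)" "pathfinish p' = g (b N)"
    using W2(3)[of "g (b m)" "g (b N)"] m N gD by blast
  define E F where "E = path_image p" and "F = path_image p'"
  have "g (a m) \<in> E" "g (a N) \<in> E" "g (b m) \<in> F" "g (b N) \<in> F"
    using pathstart_in_path_image[of p] pathfinish_in_path_image[of p]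
      pathstart_in_path_image[of p'] pathfinish_in_path_image[of p'] p p' by (auto simp: E_def F_def)
  then have "a m \<in> f ` E" "a N \<in> f ` E" "b m \<in> f ` F" "b N \<in> f ` F"
    using gD by (metis imageI)+
  moreover have "path_image p \<subseteq> D" "path_image p' \<subseteq> D" using p(2) p'(2) by blast+
  ultimately have "ennreal P \<le> modulus (joining_paths (f ` E) (f ` F) D')"
    using path_image_continuum[OF p(1)] path_image_continuum[OF p'(1)] m
    by (intro Vmod) (auto simp: E_def F_def U_def)
  also have "\<dots> \<le> I"
    unfolding I_def
  proof (rule modulus_image[where v = "\<lambda>x. c * dist x x1"])
    fix x e :: real and z assume e: "e > 0"
    have "\<bar>c * dist u x1 - c * dist z x1\<bar> \<le> (c + e) * norm (u - z)" for u
    proof -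
      have "\<bar>c * dist u x1 - c * dist z x1\<bar> = c * \<bar>dist u x1 - dist z x1\<bar>"
        using c by (simp add: abs_mult flip: right_diff_distrib)
      also have "\<dots> \<le> c * norm (u - z)"
        using c norm_triangle_ineq3[of "u - x1" "z - x1"] by (intro mult_left_mono) (auto simp: dist_norm)
      also have "\<dots> \<le> (c + e) * norm (u - z)" using e by (intro mult_right_mono) auto
      finally show ?thesis .
    qed
    then show "\<exists>d>0. \<forall>u\<in>D. norm (u - z) < d \<longrightarrow> \<bar>c * dist u x1 - c * dist z x1\<bar> \<le> (c + e) * norm (u - z)"
      by (intro exI[of _ 1]) auto
  next
    fix s t assume "s \<in> E" "t \<in> F"
    then have "dist s x1 < \<delta>" "dist t x2 < \<delta>" using p(2) p'(2) by (auto simp: E_def F_def dist_commute)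
    moreover have "dist x1 x2 \<le> dist t x1 + dist t x2" using dist_triangle3[of x1 x2 t] by simp
    ultimately have "2 * \<delta> \<le> dist t x1 - dist s x1" using \<delta>(2) by linarith
    then have "c * (2 * \<delta>) \<le> c * (dist t x1 - dist s x1)" using c by (intro mult_left_mono) auto
    then show "1 \<le> c * dist t x1 - c * dist s x1" using \<delta>(1) by (simp add: c_def right_diff_distrib)
  qed (use c p(2) p'(2) in \<open>auto simp: E_def F_def\<close>)
  finally show False using P(1) by simp
qed

theorem extension: "\<exists>F G. homeomorphism (closure D) (closure D') F G \<and> (\<forall>x\<in>D. F x = f x)"
proof (rule homeomorphism_extend_closure[OF h])
  have im: "f ` D = D'" "g ` D' = D" using h by (auto simp: homeomorphism_def)
  show "uniformly_continuous_on D f"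
  proof (rule uniformly_continuous_on_cluster[OF _ _ continuous_f])
    fix x0 a b y1 y2
    assume "x0 \<in> closure D - D" "\<And>n::nat. a n \<in> D" "\<And>n::nat. b n \<in> D" "a \<longlonglongrightarrow> x0" "b \<longlonglongrightarrow> x0"
      "(\<lambda>n. f (a n)) \<longlonglongrightarrow> y1" "(\<lambda>n. f (b n)) \<longlonglongrightarrow> y2"
    then show "y1 = y2" by (intro cluster_f[of x0 a b])
  qed (use D(2) D'(2) im in auto)
  show "uniformly_continuous_on D' g"
  proof (rule uniformly_continuous_on_cluster[OF _ _ continuous_g])
    fix y0 a b x1 x2
    assume "y0 \<in> closure D' - D'" "\<And>n::nat. a n \<in> D'" "\<And>n::nat. b n \<in> D'" "a \<longlonglongrightarrow> y0" "b \<longlonglongrightarrow> y0"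
      "(\<lambda>n. g (a n)) \<longlonglongrightarrow> x1" "(\<lambda>n. g (b n)) \<longlonglongrightarrow> x2"
    then show "x1 = x2" by (intro cluster_g[of y0 a b])
  qed (use D(2) D'(2) im in auto)
qed

end

section \<open>Weights from the growth of \<open>\<Phi>\<close>\<close>

lemma le_log_ennreal_iff: "ereal x \<le> log_ennreal y \<longleftrightarrow> ennreal (exp x) \<le> y"
proof (cases y)
  case (real r)
  show ?thesis
  proof (cases "r = 0")
    case True
    then show ?thesis using real by (simp add: log_ennreal_def)
  next
    case False
    then have r: "r > 0" using real by simp
    have "x \<le> ln r \<longleftrightarrow> exp x \<le> exp (ln r)" by simp
    then have "x \<le> ln r \<longleftrightarrow> exp x \<le> r" using r by simp
    then show ?thesis using real r by (simp add: log_ennreal_def)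
  qed
qed (simp add: log_ennreal_def)

lemma mono_log_ennreal: "mono log_ennreal"
proof (rule monoI)
  fix x y :: ennreal assume xy: "x \<le> y"
  show "log_ennreal x \<le> log_ennreal y"
  proof (rule ereal_le_real)
    fix z assume "log_ennreal y \<le> ereal z"
    show "log_ennreal x \<le> ereal z"
    proof (rule ccontr)
      assume "\<not> log_ennreal x \<le> ereal z"
      then obtain z' where z': "ereal z < ereal z'" "ereal z' < log_ennreal x"
        by (meson ereal_dense2 not_le)
      then have "ereal z' \<le> log_ennreal y"
        using xy le_log_ennreal_iff[of z' x] le_log_ennreal_iff[of z' y] by (meson less_imp_le order_trans)
      with \<open>log_ennreal y \<le> ereal z\<close> z'(1) show False by order
    qed
  qed
qed

text \<open>Stated for general ordered values because it serves both \<open>H_sub\<close>, with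
  values in \<open>ereal\<close>, and \<open>\<Phi>\<close>, with values in
  \<open>ennreal\<close>.\<close>

lemma Lim_at_right_eq_INF:
  fixes f :: "ennreal \<Rightarrow> 'b::{complete_linorder,linorder_topology}"
  assumes "mono f"
  shows "Lim (at_right 0) f = (INF t\<in>{0<..}. f t)"
proof (rule tendsto_Lim)
  show "at_right (0::ennreal) \<noteq> bot"
  proof
    assume "at_right (0::ennreal) = bot"
    then have "eventually (\<lambda>_. False) (at_right (0::ennreal))" by simp
    then obtain b :: ennreal where b: "b > 0" "\<forall>y>0. y < b \<longrightarrow> False"
      using eventually_at_right[of "0::ennreal" 1] by auto
    then show False using dense[of 0 b] by auto
  qed
  show "(f \<longlongrightarrow> (INF t\<in>{0<..}. f t)) (at_right 0)"
  proof (rule order_tendstoI)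
    fix a assume "a < (INF t\<in>{0<..}. f t)"
    then show "\<forall>\<^sub>F t in at_right 0. a < f t"
      by (auto simp: eventually_at_filter dest: less_INF_D intro!: always_eventually)
  next
    fix a assume "(INF t\<in>{0<..}. f t) < a"
    then obtain t where t: "t > 0" "f t < a" by (auto simp: INF_less_iff)
    have "\<forall>\<^sub>F s in at_right 0. s \<in> {0<..<t}" using eventually_at_right[OF t(1)] t(1) by auto
    then show "\<forall>\<^sub>F s in at_right 0. f s < a"
    proof eventually_elim
      case (elim s)
      then have "f s \<le> f t" by (intro monoD[OF assms]) auto
      with t(2) show ?case by order
    qed
  qed
qed

lemma gen_inverse_mono: "x \<le> y \<Longrightarrow> gen_inverse \<Psi> x \<le> gen_inverse \<Psi> y"
  unfolding gen_inverse_def by (intro Inf_superset_mono) auto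

lemma gen_inverse_le: "\<tau> \<le> \<Psi> t \<Longrightarrow> gen_inverse \<Psi> \<tau> \<le> t"
  unfolding gen_inverse_def by (rule Inf_lower) simp

lemma gen_inverse_pos:
  fixes \<Psi> :: "ennreal \<Rightarrow> 'b::linorder"
  assumes "mono \<Psi>" "t > 0" "\<Psi> t < \<tau>"
  shows "gen_inverse \<Psi> \<tau> > 0"
proof -
  have "t \<le> gen_inverse \<Psi> \<tau>"
    unfolding gen_inverse_def
  proof (rule Inf_greatest)
    fix s assume "s \<in> {t. \<tau> \<le> \<Psi> t}"
    then have "\<Psi> t < \<Psi> s" using assms(3) by auto
    then show "t \<le> s" using monoD[OF assms(1), of s t] by (meson leD linear)
  qed
  with assms(2) show ?thesis by order
qed

lemma ennreal_inverse_finite: "0 < u \<Longrightarrow> 1 / u < (top :: ennreal)"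
  by (simp add: divide_ennreal_def less_top[symmetric] zero_less_iff_neq_zero)

lemma nn_integral_inverse_square:
  assumes "b > 0"
  shows "(\<integral>\<^sup>+ t. ennreal (1 / t\<^sup>2) * indicator {b..} t \<partial>lborel) = ennreal (1 / b)"
proof -
  have "(\<integral>\<^sup>+ t. ennreal (1 / t\<^sup>2) * indicator {b..} t \<partial>lborel) = ennreal (0 - (- 1 / b))"
  proof (rule nn_integral_FTC_atLeast)
    show "((\<lambda>t. - 1 / t) has_real_derivative 1 / t\<^sup>2) (at t)" if "b \<le> t" for t :: real
      using that assms by (auto intro!: derivative_eq_intros simp: power2_eq_square)
    show "((\<lambda>t. - 1 / t :: real) \<longlongrightarrow> 0) at_top"
      by (intro tendsto_divide_0[OF tendsto_const] filterlim_at_top_imp_at_infinity filterlim_ident)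
  qed auto
  then show ?thesis by simp
qed

text \<open>Tonelli applied to \<open>1 / t = \<integral>\<^sub>t\<^sup>\<infinity> ds / s\<^sup>2\<close>: an integration by parts that needs no regularity.\<close>

lemma nn_integral_inverse_le:
  fixes \<mu> :: "real measure" and G' :: "real \<Rightarrow> ennreal"
  assumes sf: "sigma_finite_measure \<mu>" and sets: "sets \<mu> = sets borel" and \<delta>: "\<delta> > 0"
    and d: "d \<in> borel_measurable borel"
    and G': "\<And>s. s \<ge> \<delta> \<Longrightarrow> (\<integral>\<^sup>+ t. d t * indicator {\<delta>..s} t \<partial>\<mu>) \<le> G' s"
  shows "(\<integral>\<^sup>+ t. d t * ennreal (1 / t) * indicator {\<delta>..} t \<partial>\<mu>)
    \<le> (\<integral>\<^sup>+ s. G' s * ennreal (1 / s\<^sup>2) * indicator {\<delta>..} s \<partial>lborel)"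
proof -
  interpret sigma_finite_measure \<mu> by (rule sf)
  interpret pair_sigma_finite \<mu> lborel by standard
  note [measurable_cong] = sets
  define k where "k = (\<lambda>t s. d t * ennreal (1 / s\<^sup>2) * (if \<delta> \<le> t \<and> t \<le> s then 1 else 0))"
  have km: "case_prod k \<in> borel_measurable (\<mu> \<Otimes>\<^sub>M lborel)"
    unfolding k_def using d by measurable
  have "(\<integral>\<^sup>+ t. d t * ennreal (1 / t) * indicator {\<delta>..} t \<partial>\<mu>) = (\<integral>\<^sup>+ t. \<integral>\<^sup>+ s. k t s \<partial>lborel \<partial>\<mu>)"
  proof (rule nn_integral_cong)
    fix t
    show "d t * ennreal (1 / t) * indicator {\<delta>..} t = (\<integral>\<^sup>+ s. k t s \<partial>lborel)"
    proof (cases "\<delta> \<le> t")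
      case True
      have "(\<integral>\<^sup>+ s. k t s \<partial>lborel) = (\<integral>\<^sup>+ s. d t * (ennreal (1 / s\<^sup>2) * indicator {t..} s) \<partial>lborel)"
        by (rule nn_integral_cong) (use True in \<open>auto simp: k_def indicator_def\<close>)
      also have "\<dots> = d t * ennreal (1 / t)"
        using True \<delta> by (subst nn_integral_cmult) (auto simp: nn_integral_inverse_square)
      finally show ?thesis using True by simp
    qed (simp add: k_def)
  qed
  also have "\<dots> = (\<integral>\<^sup>+ s. \<integral>\<^sup>+ t. k t s \<partial>\<mu> \<partial>lborel)"
    using Fubini'[OF km] by simp
  also have "\<dots> \<le> (\<integral>\<^sup>+ s. G' s * ennreal (1 / s\<^sup>2) * indicator {\<delta>..} s \<partial>lborel)"
  proof (rule nn_integral_mono)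
    fix s
    show "(\<integral>\<^sup>+ t. k t s \<partial>\<mu>) \<le> G' s * ennreal (1 / s\<^sup>2) * indicator {\<delta>..} s"
    proof (cases "\<delta> \<le> s")
      case True
      have "(\<integral>\<^sup>+ t. k t s \<partial>\<mu>) = (\<integral>\<^sup>+ t. ennreal (1 / s\<^sup>2) * (d t * indicator {\<delta>..s} t) \<partial>\<mu>)"
        by (rule nn_integral_cong) (auto simp: k_def indicator_def mult.commute)
      also have "\<dots> = ennreal (1 / s\<^sup>2) * (\<integral>\<^sup>+ t. d t * indicator {\<delta>..s} t \<partial>\<mu>)"
      proof (rule nn_integral_cmult)
        have "(\<lambda>t. d t * indicator {\<delta>..s} t) \<in> borel_measurable borel" using d by measurable
        then show "(\<lambda>t. d t * indicator {\<delta>..s} t) \<in> borel_measurable \<mu>"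
          by (simp add: measurable_cong_sets[OF sets refl])
      qed
      also have "\<dots> \<le> ennreal (1 / s\<^sup>2) * G' s" using G'[OF True] by (rule mult_left_mono) simp
      finally show ?thesis using True by (simp add: mult.commute)
    next
      case False
      then have "k t s = 0" for t by (auto simp: k_def)
      then show ?thesis by simp
    qed
  qed
  finally show ?thesis .
qed

text \<open>Finiteness at 1 excludes functions that are infinite from 1 on. In the theorem it
  follows from the integral hypothesis, because the outer dilatation is at least 1.\<close>

locale convex_growth =
  fixes n :: nat and \<Phi> :: "ennreal \<Rightarrow> ennreal"
  assumes n: "2 \<le> n" and convex: "convex_ennreal \<Phi>" and mono: "mono \<Phi>" and finite_1: "\<Phi> 1 < \<infinity>"
begin

lemma convex_zero:
  assumes "0 \<le> u" "u \<le> 1"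
  shows "\<Phi> (ennreal u * s) \<le> ennreal u * \<Phi> s + \<Phi> 0"
proof -
  have "\<Phi> (ennreal u * s + ennreal (1 - u) * 0) \<le> ennreal u * \<Phi> s + ennreal (1 - u) * \<Phi> 0"
    by (rule convex[unfolded convex_ennreal_def, rule_format]) (use assms in simp)
  also have "ennreal (1 - u) * \<Phi> 0 \<le> 1 * \<Phi> 0"
    using assms by (intro mult_right_mono) (auto simp: ennreal_le_1)
  finally show ?thesis by (simp add: add_left_mono)
qed

lemma finite_0: "\<Phi> 0 < \<infinity>"
  using finite_1 monoD[OF mono, of 0 1] by (auto intro: le_less_trans)

text \<open>By convexity \<open>\<Phi> u \<le> u * \<Phi> 1 + \<Phi> 0\<close> for \<open>u\<close>
  in the unit interval, and \<open>\<Phi> 1\<close> is finite. This right-continuity gives every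
  level above \<open>\<Phi> 0\<close> a positive generalised inverse.\<close>

lemma continuous_at_zero:
  assumes "\<Phi> 0 < c"
  obtains t where "t > 0" "t < 1" "\<Phi> (ennreal t) < c"
proof -
  define p z where "p = enn2real (\<Phi> 1)" and "z = enn2real (\<Phi> 0)"
  have p: "\<Phi> 1 = ennreal p" "p \<ge> 0" and z: "\<Phi> 0 = ennreal z" "z \<ge> 0"
    using finite_0 finite_1 by (auto simp: p_def z_def less_top)
  obtain c' where c': "z < c'" "ennreal c' \<le> c"
  proof (cases "c = top")
    case True
    then show ?thesis using that[of "z + 1"] by simp
  next
    case False
    then obtain b where "c = ennreal b" "b \<ge> 0" by (cases c) auto
    then show ?thesis using that[of b] assms z by (auto simp: ennreal_less_iff)
  qed
  \<comment> \<open>Small enough that \<open>u * \<Phi> 1\<close> takes less than the gap between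
    \<open>\<Phi> 0\<close> and \<open>c'\<close>; the bound \<open>1/2\<close> keeps
    \<open>u\<close> below 1.\<close>
  define u where "u = min (1/2) ((c' - z) / (2 * (p + 1)))"
  have u: "0 < u" "u < 1" using c' p by (auto simp: u_def)
  have "u * p \<le> (c' - z) / (2 * (p + 1)) * (p + 1)"
    using p c' u by (intro mult_mono) (auto simp: u_def)
  also have "\<dots> = (c' - z) / 2"
  proof -
    have "p + 1 \<noteq> 0" using p(2) by linarith
    then show ?thesis by (simp add: divide_simps)
  qed
  also have "\<dots> < c' - z" using c' by simp
  finally have "u * p + z < c'" by simp
  have "\<Phi> (ennreal u * 1) \<le> ennreal u * \<Phi> 1 + \<Phi> 0" using u by (intro convex_zero) auto
  also have "\<dots> = ennreal (u * p + z)" using u p z by (simp add: ennreal_mult)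
  also have "\<dots> < ennreal c'" 
    using \<open>u * p + z < c'\<close> c'(1) z(2) by (intro ennreal_lessI) linarith+
  finally show ?thesis using that[of u] u c'(2) by auto
qed

text \<open>A chord through \<open>(0, \<Phi> 0)\<close> lies below the graph beyond its right end point; this replaces
  Jensen's inequality in the modulus estimate.\<close>

lemma superlinear_bound:
  assumes T: "T > 0" and l: "l > 0" and TL: "\<Phi> 0 + ennreal l \<le> \<Phi> (ennreal T)"
  shows "s * ennreal (1 / T) \<le> 1 + \<Phi> s * ennreal (1 / l)"
proof -
  have real: "ennreal x * ennreal (1 / T) \<le> 1 + \<Phi> (ennreal x) * ennreal (1 / l)" if x: "x \<ge> 0" for x
  proof (cases "x \<le> T")
    case True
    then have "ennreal x * ennreal (1 / T) \<le> 1"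
      using x T by (simp add: ennreal_le_1 flip: ennreal_mult)
    then show ?thesis by (meson add_increasing2 zero_le)
  next
    case False
    \<comment> \<open>\<open>T = u * x + (1 - u) * 0\<close>, so convexity compares the value at
      \<open>T\<close> with the chord from 0 to \<open>x\<close>.\<close>
    define u where "u = T / x"
    have u: "0 < u" "u \<le> 1" using False T by (auto simp: u_def)
    have "ennreal u * ennreal x = ennreal T" using u x False T by (simp add: u_def flip: ennreal_mult)
    then have "\<Phi> (ennreal T) \<le> ennreal u * \<Phi> (ennreal x) + \<Phi> 0"
      using convex_zero[of u "ennreal x"] u by simp
    with TL have "\<Phi> 0 + ennreal l \<le> ennreal u * \<Phi> (ennreal x) + \<Phi> 0" by (rule order_trans)
    then have "ennreal l \<le> ennreal u * \<Phi> (ennreal x)"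
    proof -
      have "\<Phi> 0 + ennreal l \<le> \<Phi> 0 + ennreal u * \<Phi> (ennreal x)"
        using \<open>\<Phi> 0 + ennreal l \<le> ennreal u * \<Phi> (ennreal x) + \<Phi> 0\<close> by (simp only: add.commute)
      moreover have "\<Phi> 0 \<noteq> top" using finite_0 by auto
      ultimately show ?thesis by (simp only: ennreal_add_left_cancel_le) simp
    qed
    then have "ennreal (1 / (u * l)) * ennreal l \<le> ennreal (1 / (u * l)) * (ennreal u * \<Phi> (ennreal x))"
      by (rule mult_left_mono) simp
    moreover have "ennreal (1 / (u * l)) * ennreal l = ennreal x * ennreal (1 / T)"
      using u l x T False by (simp add: u_def flip: ennreal_mult)
    moreover have "ennreal (1 / (u * l)) * (ennreal u * \<Phi> (ennreal x)) = \<Phi> (ennreal x) * ennreal (1 / l)"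
      using u l by (simp add: mult.assoc[symmetric] mult.commute[of "\<Phi> _"] flip: ennreal_mult)
    ultimately show ?thesis by (metis add_increasing zero_le)
  qed
  show ?thesis
  proof (cases s)
    case (real x)
    then show ?thesis using \<open>\<And>x. x \<ge> 0 \<Longrightarrow> _ x \<le> _ x\<close>[of x] by simp
  next
    case top
    \<comment> \<open>The bound for finite arguments, taken at \<open>T * N\<close>, combines with
      monotonicity to show that the right-hand side is infinite.\<close>
    have "of_nat N \<le> 1 + \<Phi> s * ennreal (1 / l)" for N
    proof -
      have "of_nat N = ennreal (T * real N) * ennreal (1 / T)"
        using T by (simp add: ennreal_of_nat_eq_real_of_nat flip: ennreal_mult)
      also have "\<dots> \<le> 1 + \<Phi> (ennreal (T * real N)) * ennreal (1 / l)" using T by (intro real) auto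
      also have "\<dots> \<le> 1 + \<Phi> s * ennreal (1 / l)"
        using top by (intro add_left_mono mult_right_mono monoD[OF mono]) auto
      finally show ?thesis .
    qed
    then have "1 + \<Phi> s * ennreal (1 / l) = top"
      by (metis ennreal_Ex_less_of_nat leD top.not_eq_extremum infinity_ennreal_def)
    then show ?thesis by simp
  qed
qed

section \<open>Levels of \<open>H\<close> and the weights derived from them\<close>

abbreviation "G \<equiv> Phi_sub n \<Phi>"
abbreviation "H \<equiv> H_sub n \<Phi>"

lemma mono_G: "mono G"
  by (intro monoI) (auto simp: Phi_sub_def intro!: monoD[OF mono] power_mono)

lemma mono_H: "mono H"
  by (intro monoI) (auto simp: H_sub_def intro!: monoD[OF mono_log_ennreal] monoD[OF mono_G])

lemma G_near_zero:
  assumes "\<Phi> 0 < c"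
  obtains t where "t > 0" "G t < c"
proof -
  obtain t where t: "t > 0" "t < 1" "\<Phi> (ennreal t) < c" using continuous_at_zero[OF assms] .
  have "(ennreal t) ^ (n - 1) \<le> ennreal t"
    using t n by (cases "n - 1") (auto simp: ennreal_power intro!: ennreal_leI mult_left_le power_le_one)
  then have "G (ennreal t) \<le> \<Phi> (ennreal t)" unfolding Phi_sub_def by (rule monoD[OF mono])
  then show ?thesis using that[of "ennreal t"] t by auto
qed

text \<open>\<open>exp c0 = \<Phi> 0 + 1\<close> puts all levels above \<open>\<Phi> 0\<close>, so
  that their inverses are positive, and yields \<open>\<Phi> 0 + exp k \<le> exp (c0 + k)\<close>,
  the gap that \<open>superlinear_bound\<close> demands.\<close>

definition c0 :: real where "c0 = ln (enn2real (\<Phi> 0) + 1)"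

lemma c0: "0 \<le> c0" and exp_c0: "exp c0 = enn2real (\<Phi> 0) + 1"
proof -
  have "enn2real (\<Phi> 0) + 1 > 0" by (rule add_nonneg_pos) simp_all
  then show "0 \<le> c0" "exp c0 = enn2real (\<Phi> 0) + 1" by (simp_all add: c0_def)
qed

text \<open>The generalised inverse of \<open>\<Phi>\<^sub>n\<^sub>-\<^sub>1\<close> at
  \<open>exp (c0 + k)\<close>, expressed through the logarithm.\<close>

definition u :: "nat \<Rightarrow> ennreal" where "u k = gen_inverse H (ereal (c0 + real k))"

lemma u_pos: "u k > 0"
proof -
  have "\<Phi> 0 < ennreal (exp (c0 + real k))"
  proof -
    have "enn2real (\<Phi> 0) < exp c0" by (simp add: exp_c0)
    also have "\<dots> \<le> exp (c0 + real k)" by simp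
    finally show ?thesis using finite_0 by (metis enn2real_nonneg ennreal_enn2real ennreal_lessI exp_gt_zero infinity_ennreal_def)
  qed
  then obtain t where t: "t > 0" "G t < ennreal (exp (c0 + real k))" using G_near_zero by blast
  then have "H t < ereal (c0 + real k)"
    using le_log_ennreal_iff[of "c0 + real k" "G t"] by (simp add: H_sub_def not_le[symmetric])
  then show ?thesis unfolding u_def using t(1) by (intro gen_inverse_pos mono_H)
qed

lemma less_u: "t < u k \<Longrightarrow> H t < ereal (c0 + real k)"
  unfolding u_def by (meson gen_inverse_le leD not_le_imp_less)

lemma u_less:
  assumes "u k < t"
  shows "ereal (c0 + real k) \<le> H t"
proof -
  obtain s where s: "ereal (c0 + real k) \<le> H s" "s < t"
    using assms unfolding u_def gen_inverse_def Inf_less_iff by auto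
  have "H s \<le> H t" using s(2) by (intro monoD[OF mono_H]) simp
  with s(1) show ?thesis by (rule order_trans)
qed

text \<open>The factor \<open>1 / 2\<close> is there because the infimum \<open>u k\<close> need not be attained, whereas \<open>2 * u k\<close>
  certainly lies beyond it.\<close>

definition w :: "nat \<Rightarrow> real" where "w k = enn2real (1 / u k) / 2"

lemma w_nonneg: "0 \<le> w k"
  by (simp add: w_def)

text \<open>\<open>superlinear_bound\<close> with \<open>T = (2 * u k) ^ (n - 1)\<close> and
  \<open>l = exp k\<close>, for which \<open>w k ^ (n - 1) = 1 / T\<close>. If \<open>u k\<close> is
  infinite, the weight is 0.\<close>

lemma weight: "s * ennreal (w k ^ (n - 1)) \<le> 1 + \<Phi> s * ennreal (exp (- real k))"
proof (cases "u k = top")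
  case True
  then have "w k = 0" by (simp add: w_def divide_ennreal_def)
  then show ?thesis using n by (simp add: power_0_left)
next
  case False
  then obtain a where a: "u k = ennreal a" "a > 0" using u_pos[of k] by (cases "u k") auto
  have "1 / u k = ennreal (1 / a)" using divide_ennreal[of 1 a] a by simp
  then have w: "w k = 1 / (2 * a)" using a(2) by (simp add: w_def)
  define T where "T = (2 * a) ^ (n - 1)"
  have "u k < ennreal (2 * a)" using a by (simp add: ennreal_less_iff)
  then have "ereal (c0 + real k) \<le> H (ennreal (2 * a))" by (rule u_less)
  then have "ennreal (exp (c0 + real k)) \<le> G (ennreal (2 * a))"
    using le_log_ennreal_iff by (simp add: H_sub_def)
  also have "G (ennreal (2 * a)) = \<Phi> (ennreal T)" using a by (simp add: Phi_sub_def T_def ennreal_power)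
  finally have "ennreal (exp (c0 + real k)) \<le> \<Phi> (ennreal T)" .
  moreover have "\<Phi> 0 + ennreal (exp (real k)) \<le> ennreal (exp (c0 + real k))"
  proof -
    have "enn2real (\<Phi> 0) * 1 \<le> enn2real (\<Phi> 0) * exp (real k)" by (intro mult_left_mono) auto
    then have "enn2real (\<Phi> 0) + exp (real k) \<le> exp (c0 + real k)"
      unfolding exp_add exp_c0 by (simp add: algebra_simps)
    moreover have "\<Phi> 0 = ennreal (enn2real (\<Phi> 0))" using finite_0 by (simp add: less_top)
    ultimately show ?thesis by (metis enn2real_nonneg ennreal_leI ennreal_plus exp_ge_zero)
  qed
  ultimately have "\<Phi> 0 + ennreal (exp (real k)) \<le> \<Phi> (ennreal T)" by order
  then have "s * ennreal (1 / T) \<le> 1 + \<Phi> s * ennreal (1 / exp (real k))"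
    using a by (intro superlinear_bound) (auto simp: T_def)
  then show ?thesis by (simp add: w T_def power_divide exp_minus inverse_eq_divide)
qed

lemma not_summable_w:
  assumes "(\<Sum>k. 1 / u k) = top"
  shows "\<not> summable w"
proof
  assume "summable w"
  then have s: "summable (\<lambda>k. 2 * w k)" by (rule summable_mult)
  have "1 / u k = ennreal (2 * w k)" for k
    using ennreal_inverse_finite[OF u_pos[of k]] by (simp add: w_def)
  then have "(\<Sum>k. 1 / u k) = ennreal (\<Sum>k. 2 * w k)"
    using s w_nonneg by (simp add: suminf_ennreal2)
  with assms show False by simp
qed

text \<open>The counting function of the levels \<open>u k\<close>.\<close>

definition N :: "ennreal \<Rightarrow> ennreal" where "N t = (\<Sum>k. if u k \<le> t then 1 else 0)"

text \<open>With only \<open>j\<close> levels passed, \<open>H t\<close> has not exceeded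
  \<open>c0 + j\<close>. The conversion \<open>e2ennreal\<close> replaces negative values by 0, so
  the bound concerns the positive part.\<close>

lemma H_le_N: "e2ennreal (H t) \<le> ennreal c0 + N t"
proof (cases "\<forall>k. u k \<le> t")
  case True
  have "N t = top"
  proof (rule ccontr)
    assume "N t \<noteq> top"
    then obtain m :: nat where "N t < of_nat m" by (metis ennreal_Ex_less_of_nat infinity_ennreal_def top.not_eq_extremum)
    moreover have "(\<Sum>k<m. if u k \<le> t then 1 else 0) \<le> N t" unfolding N_def by (rule sum_le_suminf) auto
    ultimately show False using True by simp
  qed
  then have "ennreal c0 + N t = top" by (simp only: ennreal_add_eq_top simp_thms)
  then show ?thesis by (simp only: top_greatest)
next
  case False
  define j where "j = (LEAST k. t < u k)"
  have "\<exists>k. t < u k" using False by (auto simp: not_le)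
  from LeastI_ex[OF this] have j: "t < u j" by (simp add: j_def)
  have lt: "u k \<le> t" if "k < j" for k using not_less_Least[of k "\<lambda>k. t < u k"] that by (simp add: j_def)
  have "e2ennreal (H t) \<le> e2ennreal (ereal (c0 + real j))" using less_u[OF j] by (intro e2ennreal_mono) auto
  also have "\<dots> = ennreal c0 + of_nat j" using c0 by (simp add: ennreal_of_nat_eq_real_of_nat)
  also have "of_nat j \<le> N t"
  proof -
    have "(\<Sum>k<j. if u k \<le> t then 1 else 0) \<le> N t" unfolding N_def by (rule sum_le_suminf) auto
    then show ?thesis using lt by simp
  qed
  finally show ?thesis by (simp add: add_left_mono)
qed

text \<open>The level \<open>u k\<close> contributes at most the integral of
  \<open>1 / t ^ 2\<close> over \<open>t \<ge> u k / a\<close>, that is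
  \<open>a / u k\<close>.\<close>

lemma nn_integral_N:
  assumes a: "a > 0" and \<delta>: "\<delta> > 0"
  shows "(\<integral>\<^sup>+ t. N (ennreal (a * t)) * ennreal (1 / t\<^sup>2) * indicator {\<delta>..} t \<partial>lborel) \<le> ennreal a * (\<Sum>k. 1 / u k)"
proof -
  have "(\<integral>\<^sup>+ t. N (ennreal (a * t)) * ennreal (1 / t\<^sup>2) * indicator {\<delta>..} t \<partial>lborel)
      = (\<integral>\<^sup>+ t. (\<Sum>k. (if u k \<le> ennreal (a * t) then 1 else 0) * (ennreal (1 / t\<^sup>2) * indicator {\<delta>..} t)) \<partial>lborel)"
    by (simp add: N_def ennreal_suminf_multc mult.assoc)
  also have "\<dots> = (\<Sum>k. \<integral>\<^sup>+ t. (if u k \<le> ennreal (a * t) then 1 else 0) * (ennreal (1 / t\<^sup>2) * indicator {\<delta>..} t) \<partial>lborel)"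
    by (intro nn_integral_suminf) measurable
  also have "\<dots> \<le> (\<Sum>k. ennreal a * (1 / u k))"
  proof (intro suminf_le summableI)
    fix k
    show "(\<integral>\<^sup>+ t. (if u k \<le> ennreal (a * t) then 1 else 0) * (ennreal (1 / t\<^sup>2) * indicator {\<delta>..} t) \<partial>lborel) \<le> ennreal a * (1 / u k)"
    proof (cases "u k = top")
      case True
      then have "\<not> u k \<le> ennreal (a * t)" for t by (simp add: top_unique)
      then show ?thesis by simp
    next
      case False
      then obtain b where b: "u k = ennreal b" "b > 0" using u_pos[of k] by (cases "u k") auto
      have "(\<integral>\<^sup>+ t. (if u k \<le> ennreal (a * t) then 1 else 0) * (ennreal (1 / t\<^sup>2) * indicator {\<delta>..} t) \<partial>lborel)
          \<le> (\<integral>\<^sup>+ t. ennreal (1 / t\<^sup>2) * indicator {b / a..} t \<partial>lborel)"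
      proof (rule nn_integral_mono)
        fix t :: real
        have "b / a \<le> t" if "u k \<le> ennreal (a * t)" "\<delta> \<le> t"
          using that b a \<delta> by (simp add: ennreal_le_iff field_simps)
        then show "(if u k \<le> ennreal (a * t) then 1 else 0) * (ennreal (1 / t\<^sup>2) * indicator {\<delta>..} t)
            \<le> ennreal (1 / t\<^sup>2) * indicator {b / a..} t"
          by (auto simp: indicator_def)
      qed
      also have "\<dots> = ennreal (a / b)" using a b by (simp add: nn_integral_inverse_square)
      also have "\<dots> = ennreal a * (1 / u k)"
        using a b divide_ennreal[of 1 b] by (simp flip: ennreal_mult)
      finally show ?thesis .
    qed
  qed
  finally show ?thesis by simp
qed

lemma nn_integral_const_inverse_square:
  assumes "\<delta> > 0"
  shows "(\<integral>\<^sup>+ t. ennreal c * ennreal (1 / t\<^sup>2) * indicator {\<delta>..} t \<partial>lborel) < top"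
proof -
  have "(\<integral>\<^sup>+ t. ennreal c * ennreal (1 / t\<^sup>2) * indicator {\<delta>..} t \<partial>lborel) = ennreal c * ennreal (1 / \<delta>)"
    unfolding mult.assoc using nn_integral_inverse_square[OF assms] by (subst nn_integral_cmult) auto
  then show ?thesis by (simp add: ennreal_mult_less_top)
qed

text \<open>A common bound for the conditions (a) to (c). The constant \<open>c\<close> absorbs the
  value at the lower end point and the dilation \<open>a\<close> a shift of the argument; both arise
  in the integrations by parts.\<close>

lemma nn_integral_H_finite:
  assumes fin: "(\<Sum>k. 1 / u k) \<noteq> top" and a: "a > 0" and \<delta>: "\<delta> > 0"
    and h: "\<And>t. t \<ge> \<delta> \<Longrightarrow> h t \<le> e2ennreal (H (ennreal (a * t))) + ennreal c" and c: "c \<ge> 0"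
  shows "(\<integral>\<^sup>+ t. h t * ennreal (1 / t\<^sup>2) * indicator {\<delta>..} t \<partial>lborel) < top"
proof -
  have [measurable]: "(\<lambda>t. N (ennreal (a * t))) \<in> borel_measurable borel"
    unfolding N_def by measurable
  have "(\<integral>\<^sup>+ t. h t * ennreal (1 / t\<^sup>2) * indicator {\<delta>..} t \<partial>lborel)
     \<le> (\<integral>\<^sup>+ t. N (ennreal (a * t)) * ennreal (1 / t\<^sup>2) * indicator {\<delta>..} t +
            ennreal (c0 + c) * ennreal (1 / t\<^sup>2) * indicator {\<delta>..} t \<partial>lborel)"
  proof (rule nn_integral_mono)
    fix t
    show "h t * ennreal (1 / t\<^sup>2) * indicator {\<delta>..} t \<le> N (ennreal (a * t)) * ennreal (1 / t\<^sup>2) * indicator {\<delta>..} t +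
            ennreal (c0 + c) * ennreal (1 / t\<^sup>2) * indicator {\<delta>..} t"
    proof (cases "\<delta> \<le> t")
      case True
      have "h t \<le> ennreal c0 + N (ennreal (a * t)) + ennreal c"
        using h[OF True] H_le_N[of "ennreal (a * t)"] by (meson add_right_mono order_trans)
      also have "\<dots> = N (ennreal (a * t)) + ennreal (c0 + c)" using c0 c by (simp add: ac_simps)
      finally have "h t * ennreal (1 / t\<^sup>2) \<le> (N (ennreal (a * t)) + ennreal (c0 + c)) * ennreal (1 / t\<^sup>2)"
        by (rule mult_right_mono) simp
      then show ?thesis using True by (simp add: distrib_right)
    qed simp
  qed
  also have "\<dots> = (\<integral>\<^sup>+ t. N (ennreal (a * t)) * ennreal (1 / t\<^sup>2) * indicator {\<delta>..} t \<partial>lborel) +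
      (\<integral>\<^sup>+ t. ennreal (c0 + c) * ennreal (1 / t\<^sup>2) * indicator {\<delta>..} t \<partial>lborel)"
    by (rule nn_integral_add) measurable
  also have "\<dots> < top"
    using nn_integral_N[OF a \<delta>] nn_integral_const_inverse_square[OF \<delta>, of "c0 + c"] fin
    by (auto simp: ennreal_mult_less_top less_top[symmetric] top_unique ennreal_mult_eq_top_iff)
  finally show ?thesis .
qed

end

section \<open>The integral conditions force divergence\<close>

lemma e2ennreal_divide:
  assumes "c > 0"
  shows "e2ennreal (x / ereal c) = e2ennreal x * ennreal (1 / c)"
proof (cases x)
  case (real r)
  have "ennreal (r * (1 / c)) = ennreal r * ennreal (1 / c)"
    using assms by (intro ennreal_mult'') simp
  then show ?thesis using real assms by simp
qed (use assms in \<open>auto simp: e2ennreal_neg ennreal_top_mult\<close>)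

lemma ennreal_inverse_antimono: "x \<le> y \<Longrightarrow> inverse y \<le> inverse (x :: ennreal)"
proof (cases y)
  case (real q)
  assume xy: "x \<le> y"
  show ?thesis
  proof (cases "x = 0")
    case False
    with xy real obtain r where r: "x = ennreal r" "0 < r" "r \<le> q" by (cases x) (auto simp: top_unique)
    then show ?thesis using real by (simp add: inverse_ennreal le_imp_inverse_le ennreal_leI)
  qed simp
qed simp

lemma suminf_ennreal_ge_const:
  assumes c: "c > (0::ennreal)" and le: "\<And>k. c \<le> f k"
  shows "(\<Sum>k. f k) = top"
proof (rule ccontr)
  assume "(\<Sum>k. f k) \<noteq> top"
  then obtain z where z: "(\<Sum>k. f k) = ennreal z" "z \<ge> 0" by (cases "\<Sum>k. f k") auto
  obtain c' where c': "c' > 0" "ennreal c' \<le> c"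
  proof (cases c)
    case (real r)
    then show ?thesis using c that[of r] by simp
  next
    case top
    then show ?thesis using that[of 1] by simp
  qed
  obtain m :: nat where m: "z < real m * c'" using c'(1) reals_Archimedean3 by blast
  have "ennreal (real m * c') = (\<Sum>k<m. ennreal c')"
    using c' by (simp add: ennreal_mult ennreal_of_nat_eq_real_of_nat)
  also have "\<dots> \<le> (\<Sum>k<m. f k)" using c'(2) le by (intro sum_mono) (rule order_trans)
  also have "\<dots> \<le> (\<Sum>k. f k)" by (rule sum_le_suminf) auto
  finally have "real m * c' \<le> z" using z by simp
  with m show False by simp
qed

context convex_growth
begin

section \<open>Growth integrals of \<open>H\<close>: conditions (c) and (d)\<close>

lemma cond_c_diverges: "cond_c n \<Phi> \<Longrightarrow> (\<Sum>k. 1 / u k) = top"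
proof (rule ccontr)
  assume "cond_c n \<Phi>" and fin: "(\<Sum>k. 1 / u k) \<noteq> top"
  then obtain \<delta> where \<delta>: "\<delta> > 0" and
    inf: "(\<integral>\<^sup>+ t \<in> {\<delta>..}. e2ennreal (H (ennreal t) / ereal (t\<^sup>2)) \<partial>lebesgue) = \<infinity>"
    by (auto simp: cond_c_def integral_is_top_def)
  have "(\<integral>\<^sup>+ t \<in> {\<delta>..}. e2ennreal (H (ennreal t) / ereal (t\<^sup>2)) \<partial>lebesgue)
    = (\<integral>\<^sup>+ t \<in> {\<delta>..}. e2ennreal (H (ennreal t) / ereal (t\<^sup>2)) \<partial>lborel)"
    by (rule nn_integral_completion)
  also have "\<dots> = (\<integral>\<^sup>+ t. e2ennreal (H (ennreal t)) * ennreal (1 / t\<^sup>2) * indicator {\<delta>..} t \<partial>lborel)"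
  proof (rule nn_integral_cong)
    fix t :: real
    show "e2ennreal (H (ennreal t) / ereal (t\<^sup>2)) * indicator {\<delta>..} t
        = e2ennreal (H (ennreal t)) * ennreal (1 / t\<^sup>2) * indicator {\<delta>..} t"
    proof (cases "\<delta> \<le> t")
      case True
      then have "t\<^sup>2 > 0" using \<delta> by simp
      then show ?thesis by (simp only: e2ennreal_divide)
    qed simp
  qed
  also have "\<dots> < top"
    by (rule nn_integral_H_finite[OF fin zero_less_one \<delta>, where c = 0]) simp_all
  finally show False using inf by simp
qed

text \<open>In terms of \<open>1 / t\<close> the level \<open>u k\<close> is passed for
  \<open>t \<le> 1 / u k\<close>, so it contributes at most the length \<open>1 / u k\<close> to the
  integral.\<close>

lemma cond_d_diverges: "cond_d n \<Phi> \<Longrightarrow> (\<Sum>k. 1 / u k) = top"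
proof (rule ccontr)
  assume "cond_d n \<Phi>" and fin: "(\<Sum>k. 1 / u k) \<noteq> top"
  then obtain \<delta> where \<delta>: "\<delta> > 0" and
    inf: "(\<integral>\<^sup>+ t \<in> {0<..\<delta>}. e2ennreal (H (ennreal (1 / t))) \<partial>lebesgue) = \<infinity>"
    by (auto simp: cond_d_def integral_is_top_def)
  have "(\<integral>\<^sup>+ t \<in> {0<..\<delta>}. e2ennreal (H (ennreal (1 / t))) \<partial>lebesgue)
    = (\<integral>\<^sup>+ t \<in> {0<..\<delta>}. e2ennreal (H (ennreal (1 / t))) \<partial>lborel)"
    by (rule nn_integral_completion)
  also have "\<dots> \<le> (\<integral>\<^sup>+ t. ennreal c0 * indicator {0<..\<delta>} t +
      (\<Sum>k. (if u k \<le> ennreal (1 / t) then 1 else 0) * indicator {0<..} t) \<partial>lborel)"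
  proof (rule nn_integral_mono)
    fix t :: real
    show "e2ennreal (H (ennreal (1 / t))) * indicator {0<..\<delta>} t \<le> ennreal c0 * indicator {0<..\<delta>} t +
      (\<Sum>k. (if u k \<le> ennreal (1 / t) then 1 else 0) * indicator {0<..} t)"
      using H_le_N[of "ennreal (1 / t)"] by (simp add: indicator_def N_def)
  qed
  also have "\<dots> = (\<integral>\<^sup>+ t. ennreal c0 * indicator {0<..\<delta>} t \<partial>lborel) +
      (\<Sum>k. \<integral>\<^sup>+ t. (if u k \<le> ennreal (1 / t) then 1 else 0) * indicator {0<..} t \<partial>lborel)"
    by (subst nn_integral_add, measurable) (subst nn_integral_suminf, measurable)
  also have "\<dots> \<le> ennreal c0 * ennreal \<delta> + (\<Sum>k. 1 / u k)"
  proof (intro add_mono suminf_le summableI)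
    show "(\<integral>\<^sup>+ t. ennreal c0 * indicator {0<..\<delta>} t \<partial>lborel) \<le> ennreal c0 * ennreal \<delta>"
      using \<delta> by (subst nn_integral_cmult_indicator) auto
    fix k
    show "(\<integral>\<^sup>+ t. (if u k \<le> ennreal (1 / t) then 1 else 0) * indicator {0<..} t \<partial>lborel) \<le> 1 / u k"
    proof (cases "u k = top")
      case False
      then obtain b where b: "u k = ennreal b" "b > 0" using u_pos[of k] by (cases "u k") auto
      have "(\<integral>\<^sup>+ t. (if u k \<le> ennreal (1 / t) then 1 else 0) * indicator {0<..} t \<partial>lborel)
          \<le> (\<integral>\<^sup>+ t. indicator {0..1 / b} t \<partial>lborel)"
      proof (rule nn_integral_mono)
        fix t :: real
        have "t \<le> 1 / b" if "u k \<le> ennreal (1 / t)" "0 < t"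
          using that b by (simp add: ennreal_le_iff field_simps)
        then show "(if u k \<le> ennreal (1 / t) then 1 else 0) * indicator {0<..} t \<le> (indicator {0..1 / b} t :: ennreal)"
          by (auto simp: indicator_def)
      qed
      also have "\<dots> = 1 / u k" using b divide_ennreal[of 1 b] by simp
      finally show ?thesis .
    qed (simp add: top_unique)
  qed
  also have "\<dots> < top" using fin by (simp add: ennreal_mult_less_top less_top)
  finally show False using inf by simp
qed

text \<open>The comparison behind (e) and (f). The k-th step has length \<open>L * l k\<close> and
  the integrand is at most \<open>1 / (l k * u k)\<close> on it, so the step contributes at most
  \<open>L / u k\<close>; before \<open>\<tau> 0\<close> only a bounded piece is left. Condition (e)
  uses unit steps, condition (f) geometric ones.\<close>

lemma step_integral_finite:
  fixes g :: "real \<Rightarrow> ennreal" and \<tau> :: "nat \<Rightarrow> real"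
  assumes fin: "(\<Sum>k. 1 / u k) \<noteq> top" and C: "C < top"
    and first: "\<And>t. \<delta> \<le> t \<Longrightarrow> t < \<tau> 0 \<Longrightarrow> g t \<le> C"
    and step: "\<And>k t. \<delta> \<le> t \<Longrightarrow> \<tau> k \<le> t \<Longrightarrow> t < \<tau> (Suc k) \<Longrightarrow> g t \<le> ennreal (1 / l k) * (1 / u k)"
    and cover: "\<And>t. \<tau> 0 \<le> t \<Longrightarrow> \<exists>k. \<tau> k \<le> t \<and> t < \<tau> (Suc k)"
    and len: "\<And>k. \<tau> (Suc k) - \<tau> k = L * l k" "\<And>k. l k > 0" "L > 0"
  shows "(\<integral>\<^sup>+ t. g t * indicator {\<delta>..} t \<partial>lborel) < top"
proof -
  have "(\<integral>\<^sup>+ t. g t * indicator {\<delta>..} t \<partial>lborel) \<le> (\<integral>\<^sup>+ t. C * indicator {\<delta>..\<tau> 0} t +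
      (\<Sum>k. ennreal (1 / l k) * (1 / u k) * indicator {\<tau> k..\<tau> (Suc k)} t) \<partial>lborel)"
  proof (rule nn_integral_mono)
    fix t
    show "g t * indicator {\<delta>..} t \<le> C * indicator {\<delta>..\<tau> 0} t +
      (\<Sum>k. ennreal (1 / l k) * (1 / u k) * indicator {\<tau> k..\<tau> (Suc k)} t)"
    proof (cases "\<delta> \<le> t")
      case True
      show ?thesis
      proof (cases "t < \<tau> 0")
        case True
        then show ?thesis using first[of t] \<open>\<delta> \<le> t\<close> by (simp add: add_increasing2)
      next
        case False
        then obtain k where k: "\<tau> k \<le> t" "t < \<tau> (Suc k)" using cover[of t] by auto
        define ff where "ff i = ennreal (1 / l i) * (1 / u i) * indicator {\<tau> i..\<tau> (Suc i)} t" for i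
        have ff_eq: "ff = (\<lambda>i. ennreal (1 / l i) * (1 / u i) * indicator {\<tau> i..\<tau> (Suc i)} t)"
          by (rule ext) (simp add: ff_def)
        have "g t * indicator {\<delta>..} t \<le> ff k"
          using step[OF \<open>\<delta> \<le> t\<close> k] \<open>\<delta> \<le> t\<close> k by (simp add: ff_def)
        also have "ff k = sum ff {k}" by simp
        also have "\<dots> \<le> suminf ff" by (rule sum_le_suminf) auto
        also have "\<dots> = (\<Sum>k. ennreal (1 / l k) * (1 / u k) * indicator {\<tau> k..\<tau> (Suc k)} t)"
          unfolding ff_eq ..
        finally show ?thesis by (simp add: add_increasing)
      qed
    qed simp
  qed
  also have "\<dots> = (\<integral>\<^sup>+ t. C * indicator {\<delta>..\<tau> 0} t \<partial>lborel) +
      (\<Sum>k. \<integral>\<^sup>+ t. ennreal (1 / l k) * (1 / u k) * indicator {\<tau> k..\<tau> (Suc k)} t \<partial>lborel)"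
    by (subst nn_integral_add, measurable) (subst nn_integral_suminf, measurable)
  also have "(\<integral>\<^sup>+ t. C * indicator {\<delta>..\<tau> 0} t \<partial>lborel) = C * emeasure lborel {\<delta>..\<tau> 0}"
    by (rule nn_integral_cmult_indicator) simp
  also have "(\<lambda>k. \<integral>\<^sup>+ t. ennreal (1 / l k) * (1 / u k) * indicator {\<tau> k..\<tau> (Suc k)} t \<partial>lborel)
      = (\<lambda>k. ennreal L * (1 / u k))"
  proof
    fix k
    have "\<tau> k \<le> \<tau> (Suc k)" using len(1)[of k] mult_pos_pos[OF len(3) len(2)[of k]] by linarith
    then have em: "emeasure lborel {\<tau> k..\<tau> (Suc k)} = ennreal (L * l k)"
      by (simp flip: len(1)[of k])
    have "(\<integral>\<^sup>+ t. ennreal (1 / l k) * (1 / u k) * indicator {\<tau> k..\<tau> (Suc k)} t \<partial>lborel)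
        = ennreal (1 / l k) * (1 / u k) * ennreal (L * l k)"
      by (subst nn_integral_cmult_indicator) (auto simp: em)
    also have "\<dots> = (ennreal (1 / l k) * ennreal (L * l k)) * (1 / u k)" by (simp only: mult_ac)
    also have "ennreal (1 / l k) * ennreal (L * l k) = ennreal L"
      using len(2)[of k] len(3) by (simp flip: ennreal_mult)
    finally show "(\<integral>\<^sup>+ t. ennreal (1 / l k) * (1 / u k) * indicator {\<tau> k..\<tau> (Suc k)} t \<partial>lborel)
        = ennreal L * (1 / u k)" .
  qed
  also have "C * emeasure lborel {\<delta>..\<tau> 0} + (\<Sum>k. ennreal L * (1 / u k)) < top"
  proof -
    have "emeasure lborel {\<delta>..\<tau> 0} < top" by (simp add: emeasure_lborel_Icc_eq)
    then show ?thesis using C fin by (simp add: ennreal_mult_less_top less_top)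
  qed
  finally show ?thesis .
qed

lemma cond_e_diverges: "cond_e n \<Phi> \<Longrightarrow> (\<Sum>k. 1 / u k) = top"
proof (rule ccontr)
  assume "cond_e n \<Phi>" and fin: "(\<Sum>k. 1 / u k) \<noteq> top"
  then obtain \<delta> where \<delta>: "Lim (at_right 0) H < ereal \<delta>" and
    inf: "(\<integral>\<^sup>+ \<eta> \<in> {\<delta>..}. 1 / gen_inverse H (ereal \<eta>) \<partial>lebesgue) = \<infinity>"
    by (auto simp: cond_e_def)
  obtain t where t: "t > 0" "H t < ereal \<delta>"
    using \<delta> unfolding Lim_at_right_eq_INF[OF mono_H] INF_less_iff by auto
  define C where "C = 1 / gen_inverse H (ereal \<delta>)"
  \<comment> \<open>The threshold lies above the right limit of \<open>H\<close> at 0, so the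
    inverse is positive there and the integrand is bounded on the initial piece.\<close>
  have "gen_inverse H (ereal \<delta>) > 0" by (rule gen_inverse_pos[OF mono_H t])
  then have C: "C < top" unfolding C_def by (rule ennreal_inverse_finite)
  have anti: "1 / gen_inverse H (ereal y) \<le> 1 / gen_inverse H (ereal x)" if "x \<le> y" for x y
    using gen_inverse_mono[of "ereal x" "ereal y" H] that
    unfolding divide_ennreal_def by (intro mult_left_mono ennreal_inverse_antimono) auto
  have "(\<integral>\<^sup>+ \<eta>. 1 / gen_inverse H (ereal \<eta>) * indicator {\<delta>..} \<eta> \<partial>lborel) < top"
  proof (rule step_integral_finite[OF fin C, where \<tau> = "\<lambda>k. c0 + real k" and l = "\<lambda>_. 1" and L = 1])
    show "\<exists>k. c0 + real k \<le> t \<and> t < c0 + real (Suc k)" if "c0 + real 0 \<le> t" for t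
    proof -
      have "c0 + real (nat \<lfloor>t - c0\<rfloor>) \<le> t \<and> t < c0 + real (Suc (nat \<lfloor>t - c0\<rfloor>))"
        using that by simp linarith
      then show ?thesis by blast
    qed
    show "1 / gen_inverse H (ereal t) \<le> C" if "\<delta> \<le> t" "t < c0 + real 0" for t
      using anti[OF that(1)] by (simp add: C_def)
    show "1 / gen_inverse H (ereal t) \<le> ennreal (1 / 1) * (1 / u k)"
      if "\<delta> \<le> t" "c0 + real k \<le> t" "t < c0 + real (Suc k)" for k t
      using anti[OF that(2)] by (simp add: u_def)
  qed simp_all
  with inf show False unfolding nn_integral_completion by simp
qed

lemma gen_inverse_G:
  assumes "\<tau> > 0"
  shows "gen_inverse G (ennreal \<tau>) = gen_inverse H (ereal (ln \<tau>))"
  unfolding gen_inverse_def H_sub_def using assms by (simp add: le_log_ennreal_iff)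

text \<open>Convexity makes \<open>\<Phi>\<close> right-continuous at 0, so the thresholds in the
  two forms of condition (f) coincide.\<close>

lemma Lim_Phi: "Lim (at_right 0) \<Phi> = \<Phi> 0"
  unfolding Lim_at_right_eq_INF[OF mono]
proof (rule antisym)
  show "(INF t\<in>{0<..}. \<Phi> t) \<le> \<Phi> 0"
  proof (rule ccontr)
    assume "\<not> ?thesis"
    then obtain t where t: "t > 0" "\<Phi> (ennreal t) < (INF t\<in>{0<..}. \<Phi> t)"
      using continuous_at_zero by (metis not_le)
    have "(INF t\<in>{0<..}. \<Phi> t) \<le> \<Phi> (ennreal t)" using t(1) by (intro INF_lower) simp
    with t(2) show False by simp
  qed
  show "\<Phi> 0 \<le> (INF t\<in>{0<..}. \<Phi> t)" by (intro INF_greatest monoD[OF mono]) simp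
qed

lemma cond_f_diverges: "cond_f n \<Phi> \<Longrightarrow> (\<Sum>k. 1 / u k) = top"
proof (rule ccontr)
  assume "cond_f n \<Phi>" and fin: "(\<Sum>k. 1 / u k) \<noteq> top"
  then obtain \<delta> where \<delta>: "\<Phi> 0 < ennreal \<delta>" and
    inf: "(\<integral>\<^sup>+ \<tau> \<in> {\<delta>..}. 1 / (ennreal \<tau> * gen_inverse G (ennreal \<tau>)) \<partial>lebesgue) = \<infinity>"
    by (auto simp: cond_f_def Lim_Phi)
  have \<delta>0: "\<delta> > 0" using \<delta> by (metis ennreal_eq_0_iff not_less zero_le leD linorder_le_cases)
  obtain t where t: "t > 0" "G t < ennreal \<delta>" using G_near_zero[OF \<delta>] by blast
  have v0: "gen_inverse G (ennreal \<delta>) > 0" by (rule gen_inverse_pos[OF mono_G t])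
  define C where "C = ennreal (1 / \<delta>) * (1 / gen_inverse G (ennreal \<delta>))"
  have C: "C < top" using ennreal_inverse_finite[OF v0] by (simp add: C_def ennreal_mult_less_top)
  have bound: "1 / (ennreal y * gen_inverse G (ennreal y)) \<le> ennreal (1 / x) * (1 / gen_inverse G (ennreal x))"
    if xy: "0 < x" "x \<le> y" and pos: "gen_inverse G (ennreal x) > 0" for x y
  proof -
    have "ennreal x * gen_inverse G (ennreal x) \<le> ennreal y * gen_inverse G (ennreal y)"
      using xy by (intro mult_mono gen_inverse_mono ennreal_leI) auto
    then have "1 / (ennreal y * gen_inverse G (ennreal y)) \<le> 1 / (ennreal x * gen_inverse G (ennreal x))"
      unfolding divide_ennreal_def by (intro mult_left_mono ennreal_inverse_antimono) auto
    \<comment> \<open>Inverses multiply except for the product of 0 and infinity, which positivity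
      excludes.\<close>
    also have "\<dots> = ennreal (1 / x) * (1 / gen_inverse G (ennreal x))"
      using xy pos ennreal_inverse_mult'[of "gen_inverse G (ennreal x)" "ennreal x"]
      by (simp add: divide_ennreal_def inverse_ennreal inverse_eq_divide mult.commute)
    finally show ?thesis .
  qed
  have uk: "gen_inverse G (ennreal (exp (c0 + real k))) = u k" for k
    by (simp add: gen_inverse_G u_def)
  have "(\<integral>\<^sup>+ \<tau>. 1 / (ennreal \<tau> * gen_inverse G (ennreal \<tau>)) * indicator {\<delta>..} \<tau> \<partial>lborel) < top"
  \<comment> \<open>Geometric steps: the factor \<open>1 / \<tau>\<close> of the integrand
    compensates the length of a step, and \<open>exp 1 - 1\<close> is the ratio of that length to
    the left end point.\<close>
  proof (rule step_integral_finite[OF fin C, where \<tau> = "\<lambda>k. exp (c0 + real k)" and l = "\<lambda>k. exp (c0 + real k)" and L = "exp 1 - 1"])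
    show "\<exists>k. exp (c0 + real k) \<le> t \<and> t < exp (c0 + real (Suc k))" if t: "exp (c0 + real 0) \<le> t" for t
    proof -
      have t0: "t > 0" using t exp_gt_zero[of "c0 + real 0"] by linarith
      define k where "k = nat \<lfloor>ln t - c0\<rfloor>"
      have "c0 \<le> ln t" using t t0 by (simp add: ln_ge_iff)
      then have "c0 + real k \<le> ln t" "ln t < c0 + real (Suc k)"
        unfolding k_def by simp_all linarith+
      then have "exp (c0 + real k) \<le> exp (ln t)" "exp (ln t) < exp (c0 + real (Suc k))" by simp_all
      then show ?thesis using t0 by auto
    qed
    show "1 / (ennreal t * gen_inverse G (ennreal t)) \<le> C" if "\<delta> \<le> t" "t < exp (c0 + real 0)" for t
      using bound[OF \<delta>0 that(1) v0] by (simp add: C_def)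
    show "1 / (ennreal t * gen_inverse G (ennreal t)) \<le> ennreal (1 / exp (c0 + real k)) * (1 / u k)"
      if "\<delta> \<le> t" "exp (c0 + real k) \<le> t" "t < exp (c0 + real (Suc k))" for k t
      using bound[OF exp_gt_zero that(2)] u_pos[of k] unfolding uk by simp
    show "exp (c0 + real (Suc k)) - exp (c0 + real k) = (exp 1 - 1) * exp (c0 + real k)" for k
      by (simp add: exp_add algebra_simps)
  qed simp_all
  with inf show False unfolding nn_integral_completion by simp
qed

text \<open>All levels are reached by a single finite \<open>T\<close>, so the terms of the series
  are bounded below by \<open>1 / T\<close>, which is positive.\<close>

lemma eventually_infinite_diverges:
  assumes "eventually_infinite G"
  shows "(\<Sum>k. 1 / u k) = top"
proof -
  obtain T where T: "T < top" "G T = top" using assms by (auto simp: eventually_infinite_def)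
  have le: "u k \<le> T" for k
    unfolding u_def by (rule gen_inverse_le) (simp add: H_sub_def T le_log_ennreal_iff)
  show ?thesis
  proof (rule suminf_ennreal_ge_const[of "1 / T"])
    show "1 / T > 0" using T(1) by (simp add: divide_ennreal_def zero_less_iff_neq_zero)
    show "1 / T \<le> 1 / u k" for k
      unfolding divide_ennreal_def using le by (intro mult_left_mono ennreal_inverse_antimono) auto
  qed
qed

section \<open>Integration by parts: conditions (a) and (b)\<close>

definition h :: "real \<Rightarrow> real" where "h t = real_of_ereal (H (ennreal t))"

context
  fixes \<delta> :: real
  assumes not_inf: "\<not> eventually_infinite G" and \<delta>: "0 < \<delta>" "zero_sup G < ennreal \<delta>"
begin

lemma G_finite: "t < top \<Longrightarrow> G t < top"
proof (rule ccontr)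
  assume t: "t < top" "\<not> G t < top"
  then have "G s = top" if "t \<le> s" for s
    using monoD[OF mono_G that] by (simp add: top_unique not_less)
  with t(1) not_inf show False by (auto simp: eventually_infinite_def)
qed

lemma G_positive: "\<delta> \<le> t \<Longrightarrow> 0 < G (ennreal t)"
proof (rule ccontr)
  assume t: "\<delta> \<le> t" "\<not> 0 < G (ennreal t)"
  then have "ennreal t \<le> zero_sup G" unfolding zero_sup_def by (intro Sup_upper) simp
  moreover have "ennreal \<delta> \<le> ennreal t" using t by (intro ennreal_leI)
  ultimately show False using \<delta>(2) by order
qed

lemma H_eq: "\<delta> \<le> t \<Longrightarrow> H (ennreal t) = ereal (h t)"
  using G_finite[of "ennreal t"] G_positive[of t] by (auto simp: h_def H_sub_def log_ennreal_def)

lemma h_eq: "\<delta> \<le> t \<Longrightarrow> h t = ln (enn2real (\<Phi> (ennreal (t ^ (n - 1)))))"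
  using G_finite[of "ennreal t"] G_positive[of t] \<delta>(1)
  by (auto simp: h_def H_sub_def log_ennreal_def Phi_sub_def ennreal_power)

lemma h_mono: "\<delta> \<le> s \<Longrightarrow> s \<le> t \<Longrightarrow> h s \<le> h t"
  using monoD[OF mono_H, of "ennreal s" "ennreal t"] H_eq[of s] H_eq[of t] by (simp add: ennreal_leI)

lemma h_measurable: "h \<in> borel_measurable borel"
  unfolding h_def using borel_measurable_mono_complete[OF mono_H] by measurable

lemma ennreal_h_diff_le: "\<delta> \<le> t \<Longrightarrow> ennreal (h t - h \<delta>) \<le> e2ennreal (H (ennreal t)) + ennreal \<bar>h \<delta>\<bar>"
proof -
  assume "\<delta> \<le> t"
  have "ennreal (h t - h \<delta>) \<le> ennreal (max 0 (h t) + \<bar>h \<delta>\<bar>)" by (intro ennreal_leI) linarith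
  also have "\<dots> = ennreal (max 0 (h t)) + ennreal \<bar>h \<delta>\<bar>" by simp
  also have "ennreal (max 0 (h t)) = ennreal (h t)" by (simp add: max_def ennreal_neg)
  finally show ?thesis using H_eq[OF \<open>\<delta> \<le> t\<close>] by simp
qed

text \<open>A finite convex function on the open half-line is continuous, and \<open>h\<close> is
  its logarithm after a power substitution. Beyond 1 finiteness of \<open>\<Phi>\<close> comes from
  that of \<open>G\<close>, since \<open>x \<le> x ^ (n - 1)\<close>. The Stieltjes measure relies
  on the resulting right-continuity.\<close>

lemma h_continuous: "continuous_on {\<delta>..} h"
proof -
  define \<phi> where "\<phi> x = enn2real (\<Phi> (ennreal x))" for x
  have fin: "\<Phi> (ennreal x) < top" for x
  proof (cases "x \<le> 1")
    case True
    then show ?thesis using monoD[OF mono, of "ennreal x" 1] finite_1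
      by (simp add: ennreal_le_1)
  next
    case False
    then have "x \<le> x ^ (n - 1)" using n by (intro self_le_power) auto
    then have "\<Phi> (ennreal x) \<le> G (ennreal x)"
      using False unfolding Phi_sub_def by (intro monoD[OF mono]) (simp add: ennreal_power ennreal_leI)
    then show ?thesis using G_finite[of "ennreal x"] by (simp add: le_less_trans)
  qed
  have "convex_on {0<..} \<phi>"
  proof (rule convex_onI)
    fix t x y :: real assume t: "0 < t" "t < 1" and xy: "x \<in> {0<..}" "y \<in> {0<..}"
    have "\<Phi> (ennreal (1 - t) * ennreal x + ennreal (1 - (1 - t)) * ennreal y)
        \<le> ennreal (1 - t) * \<Phi> (ennreal x) + ennreal (1 - (1 - t)) * \<Phi> (ennreal y)"
      by (rule convex[unfolded convex_ennreal_def, rule_format]) (use t in simp)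
    moreover have "ennreal (1 - t) * ennreal x + ennreal (1 - (1 - t)) * ennreal y = ennreal ((1 - t) * x + t * y)"
      using t xy by (simp add: ennreal_mult)
    moreover have "ennreal (1 - t) * \<Phi> (ennreal x) + ennreal (1 - (1 - t)) * \<Phi> (ennreal y)
        = ennreal ((1 - t) * \<phi> x + t * \<phi> y)"
      using t fin[of x] fin[of y] by (simp add: \<phi>_def ennreal_mult)
    ultimately have "\<Phi> (ennreal ((1 - t) * x + t * y)) \<le> ennreal ((1 - t) * \<phi> x + t * \<phi> y)" by simp
    then have "enn2real (\<Phi> (ennreal ((1 - t) * x + t * y))) \<le> (1 - t) * \<phi> x + t * \<phi> y"
      using t by (intro enn2real_leI) (auto simp: \<phi>_def)
    then show "\<phi> ((1 - t) *\<^sub>R x + t *\<^sub>R y) \<le> (1 - t) * \<phi> x + t * \<phi> y" by (simp add: \<phi>_def)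
  qed simp
  then have c\<phi>: "continuous_on {0<..} \<phi>" by (intro convex_on_continuous) auto
  have "continuous_on {\<delta>..} (\<lambda>t. ln (\<phi> (t ^ (n - 1))))"
  proof (intro continuous_on_ln ballI)
    show "continuous_on {\<delta>..} (\<lambda>t. \<phi> (t ^ (n - 1)))"
      using \<delta>(1) by (intro continuous_on_compose2[OF c\<phi>] continuous_intros) auto
    fix t assume "t \<in> {\<delta>..}"
    then have "0 < \<Phi> (ennreal (t ^ (n - 1)))"
      using G_positive[of t] \<delta>(1) by (simp add: Phi_sub_def ennreal_power)
    then show "\<phi> (t ^ (n - 1)) \<noteq> 0" using fin[of "t ^ (n - 1)"] by (auto simp: \<phi>_def enn2real_eq_0_iff)
  qed
  then show ?thesis by (rule continuous_on_eq) (simp add: h_eq \<phi>_def)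
qed

lemma Stieltjes_integral_finite:
  assumes fin: "(\<Sum>k. 1 / u k) \<noteq> top"
  shows "(\<integral>\<^sup>+ t \<in> {\<delta>..}. ennreal (1 / t)
            \<partial>interval_measure (\<lambda>t. real_of_ereal (H (ennreal (max \<delta> t))))) < top"
proof -
  define F where "F t = h (max \<delta> t)" for t
  have F_mono: "F x \<le> F y" if "x \<le> y" for x y using that by (auto simp: F_def intro!: h_mono)
  have "continuous_on UNIV F"
    unfolding F_def by (intro continuous_on_compose2[OF h_continuous] continuous_intros) auto
  then have F_cont: "continuous (at_right a) F" for a
    using continuous_on_eq_continuous_within[of UNIV F] continuous_within_subset[of a UNIV F "{a<..}"] by auto
  let ?\<mu> = "interval_measure F"
  have "(\<integral>\<^sup>+ t. 1 * ennreal (1 / t) * indicator {\<delta>..} t \<partial>?\<mu>)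
    \<le> (\<integral>\<^sup>+ s. ennreal (h s - h \<delta>) * ennreal (1 / s\<^sup>2) * indicator {\<delta>..} s \<partial>lborel)"
  proof (rule nn_integral_inverse_le)
    show "sigma_finite_measure ?\<mu>" using F_mono F_cont by (rule sigma_finite_interval_measure)
    fix s assume s: "\<delta> \<le> s"
    have "(\<integral>\<^sup>+ t. 1 * indicator {\<delta>..s} t \<partial>?\<mu>) = emeasure ?\<mu> {\<delta>..s}" by simp
    \<comment> \<open>\<open>F\<close> is constant up to \<open>\<delta>\<close>, so starting at
      \<open>\<delta> - 1\<close> gives a half-open interval that contains the point
      \<open>\<delta>\<close> without adding mass.\<close>
    also have "\<dots> \<le> emeasure ?\<mu> {\<delta> - 1<..s}" by (intro emeasure_mono) auto
    also have "\<dots> = ennreal (F s - F (\<delta> - 1))"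
      using s by (intro emeasure_interval_measure_Ioc F_mono F_cont) auto
    also have "\<dots> = ennreal (h s - h \<delta>)" using s by (simp add: F_def max_def)
    finally show "(\<integral>\<^sup>+ t. 1 * indicator {\<delta>..s} t \<partial>?\<mu>) \<le> ennreal (h s - h \<delta>)" .
  qed (use \<delta> in auto)
  also have "\<dots> < top"
    using ennreal_h_diff_le by (intro nn_integral_H_finite[OF fin zero_less_one \<delta>(1), where c = "\<bar>h \<delta>\<bar>"]) auto
  finally show ?thesis by (simp add: F_def[abs_def] h_def)
qed

text \<open>Shifting the variable by \<open>e\<close> makes the two integrals cancel except near the
  end points. The piece over \<open>{s..s + e}\<close> remains, and with \<open>h\<close> measured
  from its value at \<open>\<delta>\<close> it is at most
  \<open>e * (h (s + e) - h \<delta>)\<close>.\<close>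

lemma difference_quotient_integral:
  assumes s: "\<delta> \<le> s" and e: "0 < e" "e \<le> 1"
  shows "(\<integral>\<^sup>+ t. ennreal ((h (t + e) - h t) / e) * indicator {\<delta>..s} t \<partial>lborel) \<le> ennreal (h (s + 1) - h \<delta>)"
proof -
  note [measurable] = h_measurable
  define k where "k t = h t - h \<delta>" for t
  have [measurable]: "k \<in> borel_measurable borel" unfolding k_def by measurable
  have k: "0 \<le> k x" "k x \<le> k y" if "\<delta> \<le> x" "x \<le> y" for x y
    using h_mono[of \<delta> x] h_mono[of x y] that by (auto simp: k_def)
  \<comment> \<open>Instead of subtracting integrals in \<open>ennreal\<close>, \<open>A + B\<close>
    is recognised as the integral of the shifted function, and the finite \<open>A\<close> is
    cancelled at the end.\<close>
  define A B where "A = (\<integral>\<^sup>+ t. ennreal (k t) * indicator {\<delta>..s} t \<partial>lborel)"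
    and "B = (\<integral>\<^sup>+ t. ennreal (k (t + e) - k t) * indicator {\<delta>..s} t \<partial>lborel)"
  have "A \<le> (\<integral>\<^sup>+ t. ennreal (k s) * indicator {\<delta>..s} t \<partial>lborel)"
    unfolding A_def using k by (intro nn_integral_mono) (auto simp: indicator_def intro!: ennreal_leI)
  also have "\<dots> < top" using s by (subst nn_integral_cmult_indicator) (auto simp: ennreal_mult_less_top)
  finally have A: "A < top" .
  have "A + B = (\<integral>\<^sup>+ t. ennreal (k (t + e)) * indicator {\<delta>..s} t \<partial>lborel)"
  proof -
    have "A + B = (\<integral>\<^sup>+ t. ennreal (k t) * indicator {\<delta>..s} t + ennreal (k (t + e) - k t) * indicator {\<delta>..s} t \<partial>lborel)"
      unfolding A_def B_def by (rule nn_integral_add[symmetric]) measurable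
    also have "\<dots> = (\<integral>\<^sup>+ t. ennreal (k (t + e)) * indicator {\<delta>..s} t \<partial>lborel)"
    proof (rule nn_integral_cong)
      fix t
      show "ennreal (k t) * indicator {\<delta>..s} t + ennreal (k (t + e) - k t) * indicator {\<delta>..s} t
          = ennreal (k (t + e)) * indicator {\<delta>..s} t"
      proof (cases "\<delta> \<le> t")
        case True
        then show ?thesis using k[of t "t + e"] e by (simp add: indicator_def flip: ennreal_plus)
      qed simp
    qed
    finally show ?thesis .
  qed
  also have "\<dots> = (\<integral>\<^sup>+ x. ennreal (k x) * indicator {\<delta> + e..s + e} x \<partial>lborel)"
  proof -
    have "(\<lambda>x. ennreal (k x) * indicator {\<delta> + e..s + e} x) \<in> borel_measurable borel" by measurable
    from nn_integral_real_affine[OF this, of 1 e]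
    have "(\<integral>\<^sup>+ x. ennreal (k x) * indicator {\<delta> + e..s + e} x \<partial>lborel)
        = (\<integral>\<^sup>+ t. ennreal (k (e + t)) * indicator {\<delta> + e..s + e} (e + t) \<partial>lborel)" by simp
    also have "\<dots> = (\<integral>\<^sup>+ t. ennreal (k (t + e)) * indicator {\<delta>..s} t \<partial>lborel)"
      by (rule nn_integral_cong) (auto simp: indicator_def add.commute)
    finally show ?thesis by simp
  qed
  also have "\<dots> \<le> (\<integral>\<^sup>+ x. ennreal (k x) * indicator {\<delta>..s} x + ennreal (k (s + e)) * indicator {s..s + e} x \<partial>lborel)"
  proof (rule nn_integral_mono)
    fix x
    show "ennreal (k x) * indicator {\<delta> + e..s + e} x
        \<le> ennreal (k x) * indicator {\<delta>..s} x + ennreal (k (s + e)) * indicator {s..s + e} x"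
    proof (cases "x \<in> {\<delta> + e..s + e}")
      case True
      then show ?thesis
        using e s k(2)[of x "s + e"] by (cases "x \<le> s") (auto simp: add_increasing2 add_increasing intro!: ennreal_leI)
    qed simp
  qed
  also have "\<dots> = A + ennreal (k (s + e)) * ennreal e"
    unfolding A_def using e by (subst nn_integral_add) (auto simp: nn_integral_cmult_indicator)
  finally have B: "B \<le> ennreal (k (s + e)) * ennreal e"
    using A by (auto simp: ennreal_add_left_cancel_le)
  have "(\<integral>\<^sup>+ t. ennreal ((h (t + e) - h t) / e) * indicator {\<delta>..s} t \<partial>lborel)
      = (\<integral>\<^sup>+ t. ennreal (1 / e) * (ennreal (k (t + e) - k t) * indicator {\<delta>..s} t) \<partial>lborel)"
  proof (rule nn_integral_cong)
    fix t
    have "ennreal ((1 / e) * (k (t + e) - k t)) = ennreal (1 / e) * ennreal (k (t + e) - k t)"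
      using e by (intro ennreal_mult') simp
    then show "ennreal ((h (t + e) - h t) / e) * indicator {\<delta>..s} t
        = ennreal (1 / e) * (ennreal (k (t + e) - k t) * indicator {\<delta>..s} t)"
      by (simp add: k_def mult.assoc)
  qed
  also have "\<dots> = ennreal (1 / e) * B" unfolding B_def by (rule nn_integral_cmult) measurable
  also have "\<dots> \<le> ennreal (1 / e) * (ennreal (k (s + e)) * ennreal e)" using B by (rule mult_left_mono) simp
  also have "\<dots> = ennreal (k (s + e))"
    using e k(1)[of "s + e" "s + e"] s by (simp flip: ennreal_mult)
  also have "\<dots> \<le> ennreal (h (s + 1) - h \<delta>)"
    using k(2)[of "s + e" "s + 1"] s e by (intro ennreal_leI) (simp add: k_def)
  finally show ?thesis .
qed

text \<open>Fatou's lemma for difference quotients replaces the differentiation theorem for monotone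
  functions; the Borel function \<open>d\<close> also bypasses the measurability of the derivative.\<close>

lemma derivative_integral_finite:
  assumes fin: "(\<Sum>k. 1 / u k) \<noteq> top"
  shows "(\<integral>\<^sup>+ t \<in> {\<delta>..}. ennreal (H_sub_deriv n \<Phi> t / t) \<partial>lebesgue) < top"
proof -
  note [measurable] = h_measurable
  define \<epsilon> where "\<epsilon> m = 1 / (real m + 1)" for m :: nat
  have \<epsilon>: "0 < \<epsilon> m" "\<epsilon> m \<le> 1" for m by (auto simp: \<epsilon>_def)
  define d where "d t = liminf (\<lambda>m. ennreal ((h (t + \<epsilon> m) - h t) / \<epsilon> m))" for t
  have [measurable]: "d \<in> borel_measurable borel" unfolding d_def by measurable
  have flt: "filterlim \<epsilon> (at 0) sequentially"
  proof -
    have "\<epsilon> \<longlonglongrightarrow> 0"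
      using LIMSEQ_inverse_real_of_nat by (simp add: \<epsilon>_def[abs_def] inverse_eq_divide add.commute)
    then show ?thesis using \<epsilon>(1) by (simp add: filterlim_at less_imp_neq[symmetric])
  qed
  have deriv_le: "ennreal (H_sub_deriv n \<Phi> t) \<le> d t" for t
  proof (cases "H (ennreal t) \<noteq> - \<infinity> \<and> h differentiable (at t)")
    case True
    then obtain D where D: "(h has_real_derivative D) (at t)" by (auto simp: real_differentiable_def)
    then have "deriv h t = D" by (rule DERIV_imp_deriv)
    moreover have "H_sub_deriv n \<Phi> t = deriv h t"
      using True by (simp add: H_sub_deriv_def Let_def h_def[abs_def])
    moreover have "(\<lambda>m. (h (t + \<epsilon> m) - h t) / \<epsilon> m) \<longlonglongrightarrow> D"
      using filterlim_compose[OF DERIV_D[OF D] flt] .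
    then have "(\<lambda>m. ennreal ((h (t + \<epsilon> m) - h t) / \<epsilon> m)) \<longlonglongrightarrow> ennreal D" by (rule tendsto_ennrealI)
    then have "d t = ennreal D" unfolding d_def by (intro lim_imp_Liminf) auto
    ultimately show ?thesis by simp
  next
    case False
    then have "H_sub_deriv n \<Phi> t = 0" by (auto simp: H_sub_deriv_def Let_def h_def[abs_def])
    then show ?thesis by simp
  qed
  have "(\<integral>\<^sup>+ t. ennreal (H_sub_deriv n \<Phi> t / t) * indicator {\<delta>..} t \<partial>lborel)
      \<le> (\<integral>\<^sup>+ t. d t * ennreal (1 / t) * indicator {\<delta>..} t \<partial>lborel)"
  proof (rule nn_integral_mono)
    fix t
    show "ennreal (H_sub_deriv n \<Phi> t / t) * indicator {\<delta>..} t \<le> d t * ennreal (1 / t) * indicator {\<delta>..} t"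
    proof (cases "\<delta> \<le> t")
      case True
      then have "ennreal (H_sub_deriv n \<Phi> t * (1 / t)) = ennreal (H_sub_deriv n \<Phi> t) * ennreal (1 / t)"
        using \<delta>(1) by (intro ennreal_mult'') simp
      then show ?thesis using deriv_le[of t] True by (simp add: mult_right_mono)
    qed simp
  qed
  also have "\<dots> \<le> (\<integral>\<^sup>+ s. ennreal (h (s + 1) - h \<delta>) * ennreal (1 / s\<^sup>2) * indicator {\<delta>..} s \<partial>lborel)"
  proof (rule nn_integral_inverse_le)
    show "sigma_finite_measure (lborel :: real measure)" by standard
    fix s assume s: "\<delta> \<le> s"
    have "(\<integral>\<^sup>+ t. d t * indicator {\<delta>..s} t \<partial>lborel)
        = (\<integral>\<^sup>+ t. liminf (\<lambda>m. ennreal ((h (t + \<epsilon> m) - h t) / \<epsilon> m) * indicator {\<delta>..s} t) \<partial>lborel)"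
      by (rule nn_integral_cong) (auto simp: d_def indicator_def Liminf_const)
    also have "\<dots> \<le> liminf (\<lambda>m. \<integral>\<^sup>+ t. ennreal ((h (t + \<epsilon> m) - h t) / \<epsilon> m) * indicator {\<delta>..s} t \<partial>lborel)"
      by (rule nn_integral_liminf) measurable
    also have "\<dots> \<le> limsup (\<lambda>m. \<integral>\<^sup>+ t. ennreal ((h (t + \<epsilon> m) - h t) / \<epsilon> m) * indicator {\<delta>..s} t \<partial>lborel)"
      by (rule Liminf_le_Limsup) simp
    also have "\<dots> \<le> ennreal (h (s + 1) - h \<delta>)"
      using difference_quotient_integral[OF s \<epsilon>] by (intro Limsup_bounded always_eventually) auto
    finally show "(\<integral>\<^sup>+ t. d t * indicator {\<delta>..s} t \<partial>lborel) \<le> ennreal (h (s + 1) - h \<delta>)" .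
  qed (use \<delta> in auto)
  also have "\<dots> < top"
  \<comment> \<open>The dilation \<open>a = 1 + 1 / \<delta>\<close> satisfies
    \<open>s + 1 \<le> a * s\<close> for \<open>s \<ge> \<delta>\<close>; it absorbs the shift left
    over from the difference quotients.\<close>
  proof (rule nn_integral_H_finite[OF fin _ \<delta>(1), where a = "1 + 1 / \<delta>" and c = "\<bar>h \<delta>\<bar>"])
    fix s assume s: "\<delta> \<le> s"
    have le: "s + 1 \<le> (1 + 1 / \<delta>) * s" using s \<delta>(1) by (simp add: field_simps)
    have "ennreal (h (s + 1) - h \<delta>) \<le> ennreal (h ((1 + 1 / \<delta>) * s) - h \<delta>)"
      using h_mono[OF _ le] s by (intro ennreal_leI) simp
    also have "\<dots> \<le> e2ennreal (H (ennreal ((1 + 1 / \<delta>) * s))) + ennreal \<bar>h \<delta>\<bar>"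
      using le s by (intro ennreal_h_diff_le) linarith
    finally show "ennreal (h (s + 1) - h \<delta>) \<le> e2ennreal (H (ennreal ((1 + 1 / \<delta>) * s))) + ennreal \<bar>h \<delta>\<bar>" .
  qed (use \<delta>(1) in \<open>auto intro: add_pos_pos\<close>)
  finally show ?thesis unfolding nn_integral_completion .
qed

end

lemma cond_a_diverges: "cond_a n \<Phi> \<Longrightarrow> (\<Sum>k. 1 / u k) = top"
  using eventually_infinite_diverges derivative_integral_finite
  by (fastforce simp: cond_a_def)

lemma cond_b_diverges: "cond_b n \<Phi> \<Longrightarrow> (\<Sum>k. 1 / u k) = top"
  using eventually_infinite_diverges Stieltjes_integral_finite
  by (fastforce simp: cond_b_def)

end

text \<open>At regular points this is the determinant bound; the other values are 1 and infinity.
  For monotone \<open>\<Phi>\<close> it keeps the integrand of the hypothesis above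
  \<open>\<Phi> 1\<close>.\<close>

lemma outer_dilatation_ge_1: "1 \<le> outer_dilatation f x"
proof -
  define A where "A = frechet_derivative f (at x)"
  consider "f differentiable (at x)" "det (matrix A) \<noteq> 0" | "\<not> (f differentiable (at x) \<and> det (matrix A) \<noteq> 0)"
    by blast
  then show ?thesis
  proof cases
    case 1
    have "linear A" using 1(1) has_derivative_linear frechet_derivative_works unfolding A_def by blast
    then have "1 \<le> onorm A ^ CARD('a) / \<bar>det (matrix A)\<bar>"
      using abs_det_le_onorm_power 1(2) by (simp add: le_divide_eq)
    then show ?thesis using 1 by (simp add: outer_dilatation_def Let_def A_def[symmetric])
  qed (auto simp: outer_dilatation_def Let_def A_def)
qed

section \<open>The reformulated conditions and the theorem\<close>

lemma power_powr_ennreal: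
  assumes "p > 0"
  shows "powr_ennreal x (1 / real p) ^ p = x" and "powr_ennreal (x ^ p) (1 / real p) = x"
proof -
  have top: "(top :: ennreal) ^ p = top" using assms
    by (induction p rule: nat_induct_non_zero) (simp_all add: ennreal_top_mult)
  show "powr_ennreal x (1 / real p) ^ p = x"
  proof (cases x)
    case (real r)
    have "(r powr (1 / real p)) ^ p = r"
      using real assms by (cases "r = 0") (simp_all add: powr_powr flip: powr_realpow)
    then show ?thesis using real by (simp add: powr_ennreal_def ennreal_power)
  qed (simp add: powr_ennreal_def top)
  show "powr_ennreal (x ^ p) (1 / real p) = x"
  proof (cases x)
    case (real r)
    have "(r ^ p) powr (1 / real p) = r"
      using real assms by (cases "r = 0") (simp_all add: powr_powr flip: powr_realpow)
    then show ?thesis using real by (simp add: powr_ennreal_def ennreal_power)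
  qed (simp add: powr_ennreal_def top)
qed

lemma powr_ennreal_mono: "x \<le> y \<Longrightarrow> 0 \<le> a \<Longrightarrow> powr_ennreal x a \<le> powr_ennreal y a"
  by (cases x; cases y) (auto simp: powr_ennreal_def top_unique intro!: ennreal_leI powr_mono2)

text \<open>Raising to the power \<open>n - 1\<close> is an order isomorphism of the extended
  half-line, with the root \<open>R\<close> as its inverse, and order isomorphisms commute with
  infima.\<close>

lemma gen_inverse_Phi_sub:
  assumes n: "2 \<le> n"
  shows "gen_inverse (Phi_sub n \<Phi>) \<tau> = powr_ennreal (gen_inverse \<Phi> \<tau>) (1 / (real n - 1))"
proof -
  define p where "p = n - 1"
  have p: "p > 0" "real n - 1 = real p" using n by (auto simp: p_def)
  define R where "R x = powr_ennreal x (1 / real p)" for x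
  have R: "R x ^ p = x" "R (x ^ p) = x" for x using power_powr_ennreal[OF p(1)] by (auto simp: R_def)
  have R_mono: "R x \<le> R y" if "x \<le> y" for x y using that by (auto simp: R_def intro: powr_ennreal_mono)
  have "Inf {t. \<tau> \<le> \<Phi> (t ^ p)} = R (Inf {s. \<tau> \<le> \<Phi> s})"
  proof (rule antisym)
    show "R (Inf {s. \<tau> \<le> \<Phi> s}) \<le> Inf {t. \<tau> \<le> \<Phi> (t ^ p)}"
    proof (rule Inf_greatest)
      fix t assume "t \<in> {t. \<tau> \<le> \<Phi> (t ^ p)}"
      then have "Inf {s. \<tau> \<le> \<Phi> s} \<le> t ^ p" by (intro Inf_lower) simp
      then show "R (Inf {s. \<tau> \<le> \<Phi> s}) \<le> t" using R_mono R(2)[of t] by metis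
    qed
    have "Inf {t. \<tau> \<le> \<Phi> (t ^ p)} ^ p \<le> Inf {s. \<tau> \<le> \<Phi> s}"
    proof (rule Inf_greatest)
      fix s assume "s \<in> {s. \<tau> \<le> \<Phi> s}"
      then have "Inf {t. \<tau> \<le> \<Phi> (t ^ p)} \<le> R s" by (intro Inf_lower) (simp add: R)
      then have "Inf {t. \<tau> \<le> \<Phi> (t ^ p)} ^ p \<le> R s ^ p" by (rule power_mono) simp
      then show "Inf {t. \<tau> \<le> \<Phi> (t ^ p)} ^ p \<le> s" by (simp add: R)
    qed
    then show "Inf {t. \<tau> \<le> \<Phi> (t ^ p)} \<le> R (Inf {s. \<tau> \<le> \<Phi> s})" using R_mono R(2) by metis
  qed
  then show ?thesis unfolding gen_inverse_def Phi_sub_def p(2) R_def p_def[symmetric] .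
qed

lemma (in convex_growth) cond_f_iff: "cond_f n \<Phi> \<longleftrightarrow> cond_f' n \<Phi>"
  by (simp add: cond_f_def cond_f'_def Lim_Phi gen_inverse_Phi_sub[OF n])

text \<open>The substitution rule on compact intervals, carried to the half-line by monotone
  convergence along the right end points \<open>b i\<close>.\<close>

lemma nn_integral_power_substitution:
  fixes f :: "real \<Rightarrow> ennreal"
  assumes f: "f \<in> borel_measurable borel" and \<delta>: "\<delta> > 0" and p: "p > 0"
  shows "(\<integral>\<^sup>+ s. f s * indicator {\<delta> ^ p..} s \<partial>lborel)
    = (\<integral>\<^sup>+ t. f (t ^ p) * ennreal (real p * t ^ (p - 1)) * indicator {\<delta>..} t \<partial>lborel)"
proof -
  \<comment> \<open>Right end points beyond \<open>\<delta>\<close> that exhaust the half-line;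
    their p-th powers do so as well, because \<open>b i \<le> b i ^ p\<close> for
    \<open>b i \<ge> 1\<close>.\<close>
  define b where "b i = \<delta> + real i + 1" for i :: nat
  have b: "\<delta> < b i" for i by (simp add: b_def)
  have b_mono: "b i \<le> b j" if "i \<le> j" for i j using that by (simp add: b_def)
  have b_ex: "\<exists>i. t \<le> b i" for t
  proof -
    obtain i :: nat where "t < real i" using reals_Archimedean2 by blast
    then show ?thesis using \<delta> by (intro exI[of _ i]) (simp add: b_def)
  qed
  have sup: "(SUP i. c * indicator {\<delta>..b i} t) = c * indicator {\<delta>..} t" for c :: ennreal and t
  proof (cases "\<delta> \<le> t")
    case True
    obtain i where "t \<le> b i" using b_ex by blast
    show ?thesis
    proof (rule antisym)
      show "(SUP i. c * indicator {\<delta>..b i} t) \<le> c * indicator {\<delta>..} t"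
        by (rule SUP_least) (auto simp: indicator_def)
      show "c * indicator {\<delta>..} t \<le> (SUP i. c * indicator {\<delta>..b i} t)"
        using True \<open>t \<le> b i\<close> by (intro SUP_upper2[of i]) simp_all
    qed
  qed simp
  have sup': "(SUP i. c * indicator {\<delta> ^ p..b i ^ p} s) = c * indicator {\<delta> ^ p..} s" for c :: ennreal and s
  proof (cases "\<delta> ^ p \<le> s")
    case True
    obtain i where i: "max 1 s \<le> b i" using b_ex by blast
    then have "1 \<le> b i" "s \<le> b i" by auto
    then have "s \<le> b i ^ p" using self_le_power[of "b i" p] p by linarith
    show ?thesis
    proof (rule antisym)
      show "(SUP i. c * indicator {\<delta> ^ p..b i ^ p} s) \<le> c * indicator {\<delta> ^ p..} s"
        by (rule SUP_least) (auto simp: indicator_def)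
      show "c * indicator {\<delta> ^ p..} s \<le> (SUP i. c * indicator {\<delta> ^ p..b i ^ p} s)"
        using True \<open>s \<le> b i ^ p\<close> by (intro SUP_upper2[of i]) simp_all
    qed
  qed simp
  have "(\<integral>\<^sup>+ s. f s * indicator {\<delta> ^ p..} s \<partial>lborel) = (SUP i. \<integral>\<^sup>+ s. f s * indicator {\<delta> ^ p..b i ^ p} s \<partial>lborel)"
    unfolding sup'[symmetric]
  proof (rule nn_integral_monotone_convergence_SUP)
    show "incseq (\<lambda>i s. f s * indicator {\<delta> ^ p..b i ^ p} s)"
    proof (intro incseq_SucI le_funI mult_left_mono)
      fix i s
      have "b i ^ p \<le> b (Suc i) ^ p" using b_mono[of i "Suc i"] b[of i] \<delta> by (intro power_mono) auto
      then have "s \<le> b i ^ p \<Longrightarrow> s \<le> b (Suc i) ^ p" by (rule order_trans[rotated])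
      then show "indicator {\<delta> ^ p..b i ^ p} s \<le> (indicator {\<delta> ^ p..b (Suc i) ^ p} s :: ennreal)"
        by (simp add: indicator_def)
    qed simp
  qed (use f in measurable)
  also have "\<dots> = (SUP i. \<integral>\<^sup>+ t. f (t ^ p) * ennreal (real p * t ^ (p - 1)) * indicator {\<delta>..b i} t \<partial>lborel)"
  proof (rule SUP_cong[OF refl])
    fix i
    show "(\<integral>\<^sup>+ s. f s * indicator {\<delta> ^ p..b i ^ p} s \<partial>lborel)
        = (\<integral>\<^sup>+ t. f (t ^ p) * ennreal (real p * t ^ (p - 1)) * indicator {\<delta>..b i} t \<partial>lborel)"
    proof (rule nn_integral_substitution_aux[where g = "\<lambda>t. t ^ p" and g' = "\<lambda>t. real p * t ^ (p - 1)"])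
      show "((\<lambda>t. t ^ p) has_real_derivative real p * t ^ (p - 1)) (at t)" for t :: real
        by (auto intro!: derivative_eq_intros)
    qed (use f b \<delta> in \<open>auto intro!: continuous_intros\<close>)
  qed
  also have "\<dots> = (\<integral>\<^sup>+ t. f (t ^ p) * ennreal (real p * t ^ (p - 1)) * indicator {\<delta>..} t \<partial>lborel)"
    unfolding sup[symmetric]
  proof (rule nn_integral_monotone_convergence_SUP[symmetric])
    show "incseq (\<lambda>i t. f (t ^ p) * ennreal (real p * t ^ (p - 1)) * indicator {\<delta>..b i} t)"
    proof (intro incseq_SucI le_funI mult_left_mono)
      fix i t
      show "indicator {\<delta>..b i} t \<le> (indicator {\<delta>..b (Suc i)} t :: ennreal)"
        by (simp add: indicator_def b_def)
    qed simp
    show "(\<lambda>t. f (t ^ p) * ennreal (real p * t ^ (p - 1)) * indicator {\<delta>..b i} t) \<in> borel_measurable lborel" for i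
      using f by measurable
  qed
  finally show ?thesis .
qed

text \<open>The zero thresholds correspond under the power map. A strict inequality leaves room for
  a point in between at which the function is already nonzero, and monotonicity transfers this
  point.\<close>

lemma zero_sup_Phi_sub_less_iff:
  assumes mono: "mono \<Phi>" and p: "n - 1 > 0" and \<delta>: "\<delta> > 0"
  shows "zero_sup (Phi_sub n \<Phi>) < ennreal \<delta> \<longleftrightarrow> zero_sup \<Phi> < ennreal (\<delta> ^ (n - 1))"
proof -
  define p where "p = n - 1"
  have p: "p > 0" using p by (simp add: p_def)
  show ?thesis
  proof
    assume "zero_sup (Phi_sub n \<Phi>) < ennreal \<delta>"
    then obtain t where t: "zero_sup (Phi_sub n \<Phi>) < t" "t < ennreal \<delta>" using dense by blast
    then obtain t' where t': "t = ennreal t'" "0 \<le> t'" "t' < \<delta>"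
      by (cases t) (auto simp: ennreal_less_iff)
    have "\<Phi> (t ^ p) \<noteq> 0"
    proof
      assume "\<Phi> (t ^ p) = 0"
      then have "t \<le> zero_sup (Phi_sub n \<Phi>)"
        unfolding zero_sup_def by (intro Sup_upper) (simp add: Phi_sub_def p_def)
      with t(1) show False by simp
    qed
    then have "zero_sup \<Phi> \<le> t ^ p"
      unfolding zero_sup_def using monoD[OF mono, of "t ^ p"]
      by (intro Sup_least) (metis (mono_tags) linear mem_Collect_eq le_zero_eq)
    also have "\<dots> < ennreal (\<delta> ^ p)"
      using t' p \<delta> by (simp add: ennreal_power ennreal_less_iff power_strict_mono)
    finally show "zero_sup \<Phi> < ennreal (\<delta> ^ (n - 1))" by (simp add: p_def)
  next
    assume "zero_sup \<Phi> < ennreal (\<delta> ^ (n - 1))"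
    then obtain s where s: "zero_sup \<Phi> < s" "s < ennreal (\<delta> ^ p)" using dense by (auto simp: p_def)
    define t where "t = powr_ennreal s (1 / real p)"
    have tp: "t ^ p = s" unfolding t_def by (rule power_powr_ennreal(1)[OF p])
    have "\<Phi> s \<noteq> 0"
    proof
      assume "\<Phi> s = 0"
      then have "s \<le> zero_sup \<Phi>" unfolding zero_sup_def by (intro Sup_upper) simp
      with s(1) show False by simp
    qed
    have "zero_sup (Phi_sub n \<Phi>) \<le> t"
      unfolding zero_sup_def
    proof (rule Sup_least)
      fix x assume "x \<in> {x. Phi_sub n \<Phi> x = 0}"
      then have x: "\<Phi> (x ^ p) = 0" by (simp add: Phi_sub_def p_def)
      show "x \<le> t"
      proof (rule ccontr)
        assume "\<not> x \<le> t"
        then have "t ^ p \<le> x ^ p" by (intro power_mono) auto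
        then have "\<Phi> s \<le> \<Phi> (x ^ p)" unfolding tp by (rule monoD[OF mono])
        with x \<open>\<Phi> s \<noteq> 0\<close> show False by simp
      qed
    qed
    also have "t < ennreal \<delta>"
    proof (rule ccontr)
      assume "\<not> t < ennreal \<delta>"
      then have "ennreal \<delta> ^ p \<le> t ^ p" by (intro power_mono) auto
      with s(2) \<delta> show False unfolding tp by (simp add: ennreal_power)
    qed
    finally show "zero_sup (Phi_sub n \<Phi>) < ennreal \<delta>" .
  qed
qed

text \<open>Substitute \<open>s = t ^ (n - 1)\<close>: as \<open>(n - 1) * n' = n\<close>, the
  weight \<open>1 / s powr n'\<close> together with the derivative
  \<open>(n - 1) * t ^ (n - 2)\<close> becomes \<open>(n - 1) / t ^ 2\<close>. The same computation
  with the opposite sign handles the negative part, whose finiteness belongs to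
  \<open>integral_is_top\<close>.\<close>

lemma integral_is_top_iff:
  assumes mono: "mono \<Phi>" and n: "2 \<le> n" and n': "1 / real n + 1 / n' = 1" and \<delta>: "\<delta> > 0"
  shows "integral_is_top {\<delta>..} (\<lambda>t. H_sub n \<Phi> (ennreal t) / ereal (t\<^sup>2))
    \<longleftrightarrow> integral_is_top {\<delta> ^ (n - 1)..} (\<lambda>t. log_ennreal (\<Phi> (ennreal t)) / ereal (t powr n'))"
proof -
  define p where "p = n - 1"
  have p: "p > 0" "real p = real n - 1" using n by (auto simp: p_def)
  have n'p: "real p * n' = real n"
  proof -
    have "n' \<noteq> 0" using n' n by (auto simp: divide_simps)
    then have "n' + real n = real n * n'" using n' n by (simp add: divide_simps)
    then show ?thesis by (simp add: p algebra_simps)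
  qed
  define X where "X s = log_ennreal (\<Phi> (ennreal s))" for s
  have Xm: "X \<in> borel_measurable borel"
  proof -
    have "mono (\<lambda>s. log_ennreal (\<Phi> s))"
      using mono by (intro monoI) (auto intro!: monoD[OF mono_log_ennreal] dest: monoD)
    then have "(\<lambda>s. log_ennreal (\<Phi> s)) \<in> borel_measurable borel" by (rule borel_measurable_mono_complete)
    from measurable_compose[OF measurable_ennreal this] show ?thesis by (simp add: X_def[abs_def])
  qed
  have main: "(\<integral>\<^sup>+ s \<in> {\<delta> ^ p..}. e2ennreal (Y s / ereal (s powr n')) \<partial>lebesgue)
      = ennreal (real p) * (\<integral>\<^sup>+ t \<in> {\<delta>..}. e2ennreal (Y (t ^ p) / ereal (t\<^sup>2)) \<partial>lebesgue)"
    if Ym[measurable]: "Y \<in> borel_measurable borel" for Y :: "real \<Rightarrow> ereal"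
  proof -
    have "(\<integral>\<^sup>+ s \<in> {\<delta> ^ p..}. e2ennreal (Y s / ereal (s powr n')) \<partial>lebesgue)
        = (\<integral>\<^sup>+ s. e2ennreal (Y s / ereal (s powr n')) * indicator {\<delta> ^ p..} s \<partial>lborel)"
      by (rule nn_integral_completion)
    also have "\<dots> = (\<integral>\<^sup>+ s. (e2ennreal (Y s) * ennreal (1 / s powr n')) * indicator {\<delta> ^ p..} s \<partial>lborel)"
    proof (rule nn_integral_cong)
      fix s :: real
      show "e2ennreal (Y s / ereal (s powr n')) * indicator {\<delta> ^ p..} s
          = (e2ennreal (Y s) * ennreal (1 / s powr n')) * indicator {\<delta> ^ p..} s"
      proof (cases "\<delta> ^ p \<le> s")
        case True
        then have "s > 0" using \<delta> by (meson less_le_trans zero_less_power)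
        then show ?thesis by (simp only: e2ennreal_divide powr_gt_zero[THEN iffD2] less_imp_neq[symmetric] not_False_eq_True)
      qed simp
    qed
    also have "\<dots> = (\<integral>\<^sup>+ t. (e2ennreal (Y (t ^ p)) * ennreal (1 / (t ^ p) powr n')) *
        ennreal (real p * t ^ (p - 1)) * indicator {\<delta>..} t \<partial>lborel)"
      by (rule nn_integral_power_substitution[OF _ \<delta> p(1)]) measurable
    also have "\<dots> = (\<integral>\<^sup>+ t. ennreal (real p) * (e2ennreal (Y (t ^ p) / ereal (t\<^sup>2)) * indicator {\<delta>..} t) \<partial>lborel)"
    proof (rule nn_integral_cong)
      fix t :: real
      show "(e2ennreal (Y (t ^ p)) * ennreal (1 / (t ^ p) powr n')) * ennreal (real p * t ^ (p - 1)) * indicator {\<delta>..} t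
          = ennreal (real p) * (e2ennreal (Y (t ^ p) / ereal (t\<^sup>2)) * indicator {\<delta>..} t)"
      proof (cases "\<delta> \<le> t")
        case True
        then have t: "t > 0" using \<delta> by simp
        have "(t ^ p) powr n' = t ^ n"
          using t n'p by (simp add: powr_powr flip: powr_realpow)
        also have "n = (p - 1) + 2" using n by (simp add: p_def)
        also have "t ^ ((p - 1) + 2) = t ^ (p - 1) * t\<^sup>2" by (rule power_add)
        finally have "1 / (t ^ p) powr n' * (real p * t ^ (p - 1)) = real p * (1 / t\<^sup>2)"
          using t by simp
        then have "ennreal (1 / (t ^ p) powr n') * ennreal (real p * t ^ (p - 1)) = ennreal (real p) * ennreal (1 / t\<^sup>2)"
          using t by (metis ennreal_mult' of_nat_0_le_iff powr_ge_zero zero_le_divide_1_iff)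
        then have "e2ennreal (Y (t ^ p)) * ennreal (1 / (t ^ p) powr n') * ennreal (real p * t ^ (p - 1))
            = ennreal (real p) * (e2ennreal (Y (t ^ p)) * ennreal (1 / t\<^sup>2))"
          by (metis mult.assoc mult.left_commute)
        also have "e2ennreal (Y (t ^ p)) * ennreal (1 / t\<^sup>2) = e2ennreal (Y (t ^ p) / ereal (t\<^sup>2))"
          using t by (intro e2ennreal_divide[symmetric]) simp
        finally show ?thesis using True by simp
      qed simp
    qed
    also have "\<dots> = ennreal (real p) * (\<integral>\<^sup>+ t. e2ennreal (Y (t ^ p) / ereal (t\<^sup>2)) * indicator {\<delta>..} t \<partial>lborel)"
      by (rule nn_integral_cmult) measurable
    finally show ?thesis unfolding nn_integral_completion .
  qed
  have HX: "H_sub n \<Phi> (ennreal t) = X (t ^ p)" if "\<delta> \<le> t" for t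
    using that \<delta> by (simp add: H_sub_def Phi_sub_def X_def p_def ennreal_power)
  have neg: "- (x / ereal c) = (- x) / ereal c" for x c by simp
  have "(\<integral>\<^sup>+ t \<in> {\<delta>..}. e2ennreal (H_sub n \<Phi> (ennreal t) / ereal (t\<^sup>2)) \<partial>lebesgue)
      = (\<integral>\<^sup>+ t \<in> {\<delta>..}. e2ennreal (X (t ^ p) / ereal (t\<^sup>2)) \<partial>lebesgue)"
    using HX by (intro nn_integral_cong) (auto simp: indicator_def)
  moreover have "(\<integral>\<^sup>+ t \<in> {\<delta>..}. e2ennreal (- (H_sub n \<Phi> (ennreal t) / ereal (t\<^sup>2))) \<partial>lebesgue)
      = (\<integral>\<^sup>+ t \<in> {\<delta>..}. e2ennreal (- X (t ^ p) / ereal (t\<^sup>2)) \<partial>lebesgue)"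
    using HX unfolding neg by (intro nn_integral_cong) (auto simp: indicator_def)
  moreover have "(\<lambda>s. - X s) \<in> borel_measurable borel" using Xm by measurable
  ultimately show ?thesis
    using main[OF Xm] main[of "\<lambda>s. - X s"] p(1)
    unfolding integral_is_top_def neg X_def[symmetric] p_def[symmetric]
    by (auto simp: ennreal_mult_eq_top_iff ennreal_mult_less_top)
qed

lemma cond_c_iff:
  assumes mono: "mono \<Phi>" and n: "2 \<le> n" and n': "1 / real n + 1 / n' = 1"
  shows "cond_c n \<Phi> \<longleftrightarrow> cond_c' n' \<Phi>"
proof
  have p: "n - 1 > 0" using n by simp
  note eqs = zero_sup_Phi_sub_less_iff[OF mono p] integral_is_top_iff[OF mono n n']
  show "cond_c' n' \<Phi>" if "cond_c n \<Phi>"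
  proof -
    obtain \<delta> where "\<delta> > 0" "zero_sup (Phi_sub n \<Phi>) < ennreal \<delta>"
      "integral_is_top {\<delta>..} (\<lambda>t. H_sub n \<Phi> (ennreal t) / ereal (t\<^sup>2))"
      using \<open>cond_c n \<Phi>\<close> by (auto simp: cond_c_def)
    then show ?thesis unfolding cond_c'_def using eqs[of \<delta>] by (intro exI[of _ "\<delta> ^ (n - 1)"]) simp
  qed
  show "cond_c n \<Phi>" if "cond_c' n' \<Phi>"
  proof -
    obtain d where d: "d > 0" "zero_sup \<Phi> < ennreal d"
      "integral_is_top {d..} (\<lambda>t. log_ennreal (\<Phi> (ennreal t)) / ereal (t powr n'))"
      using \<open>cond_c' n' \<Phi>\<close> by (auto simp: cond_c'_def)
    define \<delta> where "\<delta> = root (n - 1) d"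
    have "\<delta> > 0" "\<delta> ^ (n - 1) = d" using d(1) p by (simp_all add: \<delta>_def)
    then show ?thesis unfolding cond_c_def using eqs[of \<delta>] d by (intro exI[of _ \<delta>]) simp
  qed
qed

theorem corollary4p3:
  fixes D D' :: "(real ^ 'n) set"
    and f :: "real ^ 'n \<Rightarrow> real ^ 'n"
    and \<Phi> :: "ennreal \<Rightarrow> ennreal"
    and n' :: real
  assumes "2 \<le> CARD('n)"
    and "1 / real CARD('n) + 1 / n' = 1"
    and "is_domain D" and "bounded D" and "weakly_flat_boundary D"
    and "is_domain D'" and "bounded D'" and "weakly_flat_boundary D'"
    and "finitely_bi_Lipschitz D D' f"
    and "convex_ennreal \<Phi>" and "mono \<Phi>"
    and "(\<integral>\<^sup>+ x \<in> D. \<Phi> (outer_dilatation f x ^ (CARD('n) - 1)) \<partial>lebesgue) < \<infinity>"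
  shows "(cond_c CARD('n) \<Phi> \<longleftrightarrow> cond_c' n' \<Phi>) \<and>
         (cond_f CARD('n) \<Phi> \<longleftrightarrow> cond_f' CARD('n) \<Phi>) \<and>
         (cond_a CARD('n) \<Phi> \<or> cond_b CARD('n) \<Phi> \<or> cond_c CARD('n) \<Phi> \<or>
          cond_d CARD('n) \<Phi> \<or> cond_e CARD('n) \<Phi> \<or> cond_f CARD('n) \<Phi> \<longrightarrow>
          (\<exists>F G. homeomorphism (closure D) (closure D') F G \<and> (\<forall>x\<in>D. F x = f x)))"
proof -
  have D: "open D" "D \<noteq> {}" using assms(3) by (auto simp: is_domain_def)
  \<comment> \<open>Otherwise the integrand would be infinite on all of \<open>D\<close>, a set of
    positive measure.\<close>
  have "\<Phi> 1 < \<infinity>"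
  proof (rule ccontr)
    assume "\<not> \<Phi> 1 < \<infinity>"
    then have "\<Phi> 1 = top" by (simp add: less_top[symmetric])
    have "\<Phi> (outer_dilatation f x ^ (CARD('n) - 1)) = top" for x
    proof -
      have "1 ^ (CARD('n) - 1) \<le> outer_dilatation f x ^ (CARD('n) - 1)"
        by (rule power_mono[OF outer_dilatation_ge_1]) simp
      then show ?thesis
        using monoD[OF assms(11), of 1 "outer_dilatation f x ^ (CARD('n) - 1)"] \<open>\<Phi> 1 = top\<close>
        by (simp add: top_unique)
    qed
    then have "top * emeasure lebesgue D < \<infinity>"
      using assms(12) D(1) by (simp add: nn_integral_cmult_indicator del: nn_integral_completion)
    moreover have "emeasure lebesgue D \<noteq> 0"
      using open_not_negligible[OF D] D(1) by (auto simp: negligible_iff_null_sets null_sets_def)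
    ultimately show False by (simp add: ennreal_top_mult)
  qed
  then interpret convex_growth "CARD('n)" \<Phi>
    using assms by unfold_locales auto
  have ext: "\<exists>F G. homeomorphism (closure D) (closure D') F G \<and> (\<forall>x\<in>D. F x = f x)"
    if div: "(\<Sum>k. 1 / u k) = top"
  proof -
    obtain g where g: "homeomorphism D D' f g" using assms(9) by (auto simp: finitely_bi_Lipschitz_def)
    interpret weighted_bi_Lipschitz D D' f g \<Phi> w
      using assms g finitely_bi_Lipschitz_bounds[OF assms(9)] w_nonneg weight not_summable_w[OF div]
      by unfold_locales auto
    show ?thesis by (rule extension)
  qed
  have "cond_c CARD('n) \<Phi> \<longleftrightarrow> cond_c' n' \<Phi>" by (rule cond_c_iff[OF assms(11,1,2)])
  moreover have "cond_f CARD('n) \<Phi> \<longleftrightarrow> cond_f' CARD('n) \<Phi>" by (rule cond_f_iff)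
  ultimately show ?thesis
    using ext cond_a_diverges cond_b_diverges cond_c_diverges cond_d_diverges cond_e_diverges cond_f_diverges
    by blast
qed

end
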